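(* Let $F$ be a nonarchimedean local field with $\mathrm{char}(F)\neq2$, $B$ the quaternion division $F$-algebra, $O_B$ its maximal order, and $*$ an orthogonal involution on $B$, given by $\alpha^*=\gamma\bar\alpha\gamma^{-1}$ with $\gamma\in B^\times$, $\gamma+\bar\gamma=0$. Assume that $\mathrm{ord}_B(\gamma)$ is even. Let $L$ be an $(O_B,O_B)$-bilattice with structural invariant $(r_1,r_2,t_1,t_2)\in\mathbb{Z}_{\ge0}^4$, that is, $L\simeq\mathbb{O}^{\oplus r_1}\oplus\mathbb{P}^{\oplus r_2}\oplus\mathbb{L}_1^{\oplus t_1}\oplus\mathbb{L}_2^{\oplus t_2}$. Then there exists a perfect hermitian $(O_B,*,O_B)$-pairing $\langle\ ,\ \rangle$ on $L$ if and only if both $r_1$ and $r_2$ are even and $t_1=t_2$. In this case, $(L,\langle\ ,\ \rangle_u)$ is isometric to the orthogonal direct sum $$\mathbb{M}_4^{\boxplus\frac{r_1}{2}}\boxplus\mathbb{M}_5^{\boxplus\frac{r_2}{2}}\boxplus\mathbb{M}_6^{\boxplus t}\quad\text{with } t:=t_1=t_2.$$ In particular, up to isometry there exists a unique self-dual hermitian $(O_B,*,O_B)$-bilattice with given structural invariant $(r_1,r_2,t,t)$ for $r_1,r_2\in2\mathbb{Z}_{\ge0}$ and $t\in\mathbb{Z}_{\ge0}$.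
   Context: Bilattices: an $(O_B,O_B)$-bilattice is a finitely generated $O_F$-torsion-free $(O_B,O_B)$-bimodule with agreeing left and right $O_F$-actions. An $O_F$-algebra embedding $\varphi:O_B\hookrightarrow\mathrm{Mat}_n(O_B)$ makes the right module $O_B^{\oplus n}$ of column vectors a bilattice $(O_B^{\oplus n},\varphi)$ with left action $\alpha\cdot x=\varphi(\alpha)x$. Let $K/F$ be the unramified quadratic extension with nontrivial automorphism $\sigma$, embedded in $B$, $\pi$ a fixed uniformizer of $F$, and $\Pi\in O_B$ with $O_B=O_K\oplus O_K\Pi$, $\Pi^2=\pi$, $\Pi a=a^\sigma\Pi$ ($a\in O_K$). Let $\mathrm{id}(\alpha)=\alpha$, $\tau(\alpha)=\Pi^{-1}\alpha\Pi$, $\varphi_1(\Pi)=\varphi_2(\Pi)=\begin{bmatrix}0&\pi\\1&0\end{bmatrix}$, $\varphi_1(a)=\mathrm{diag}(a,a^\sigma)$, $\varphi_2(a)=\mathrm{diag}(a^\sigma,a)$ for $a\in O_K$. Put $\mathbb{O}=(O_B,\mathrm{id})$, $\mathbb{P}=(O_B,\tau)$, $\mathbb{L}_i=(O_B^{\oplus2},\varphi_i)$ for $i=1,2$, and $\mathbb{L}_4=\mathbb{O}\oplus\mathbb{O}$, $\mathbb{L}_5=\mathbb{P}\oplus\mathbb{P}$, $\mathbb{L}_6=\mathbb{L}_1\oplus\mathbb{L}_2$. Every bilattice is isomorphic to $\mathbb{O}^{\oplus r_1}\oplus\mathbb{P}^{\oplus r_2}\oplus\mathbb{L}_1^{\oplus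 t_1}\oplus\mathbb{L}_2^{\oplus t_2}$ for a unique quadruple, its structural invariant. Hermitian forms: for an involution $\star$ of $O_B$, a hermitian (resp. skew-hermitian) $(O_B,\star,O_B)$-pairing on $L$ is an $O_F$-bilinear pairing $\langle\ ,\ \rangle:L\times L\to B$, non-degenerate on $L\otimes_{O_F}F$, with $\langle x,y\rangle=\overline{\langle y,x\rangle}$ (resp. $=-\overline{\langle y,x\rangle}$), $\langle x\alpha,y\beta\rangle=\bar\alpha\langle x,y\rangle\beta$ and $\langle\alpha x,y\rangle=\langle x,\alpha^{\star}y\rangle$ for $x,y\in L$, $\alpha,\beta\in O_B$; here $\bar{\ }$ is the canonical involution. The pairing is perfect (and $L$ with it is self-dual) if $\{x\in L\otimes F:\langle x,L\rangle\subseteq O_B\}=L$; equivalently, its Gram matrix in a right $O_B$-basis of $L$ is invertible over $O_B$. Isometries are bimodule isomorphisms preserving pairings; $\boxplus$ is orthogonal direct sum. $\mathrm{ord}_B$ is the normalized discrete valuation of $B$. Auxiliary objects: since $\gamma$ is determined by $*$ only up to $F^\times$, normalize $\mathrm{ord}_B(\gamma)=0$ and put $u=\gamma\in O_B^\times$. For a hermitian $(O_B,*,O_B)$-pairing $\langle\ ,\ \rangle$ put $\langle x,y\rangle_u=\langle x,uy\rangle$; this is a skew-hermitian $(O_B,\bar{\ },O_B)$-pairing. For $i=4,5,6$, $\mathbb{M}_i$ is the self-dual skew-hermitian $(O_B,\bar{\ },O_B)$-bilattice with underlying bilattice $\mathbb{L}_i$ and Gram matrix $C_i$ in the standard right $O_B$-basis,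 where $$C_4=C_5=\begin{bmatrix}0&1\\-1&0\end{bmatrix},\qquad C_6=\begin{bmatrix}0&0&0&1\\0&0&-1&0\\0&1&0&0\\-1&0&0&0\end{bmatrix}.$$ *)

theory Defs
  imports "Jordan_Normal_Form.Matrix"
begin

section \<open>Valued fields and division algebras\<close>

text \<open>Valuations are integer valued; the value at \<open>0\<close> (which should be infinity) is irrelevant, and
  all definitions below ignore it.\<close>

definition normalized_valuation :: "('a::division_ring \<Rightarrow> int) \<Rightarrow> bool" where
  "normalized_valuation w \<longleftrightarrow>
     (\<forall>x y. x \<noteq> 0 \<longrightarrow> y \<noteq> 0 \<longrightarrow> w (x * y) = w x + w y) \<and>
     (\<forall>x y. x \<noteq> 0 \<longrightarrow> y \<noteq> 0 \<longrightarrow> x + y \<noteq> 0 \<longrightarrow> min (w x) (w y) \<le> w (x + y)) \<and>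
     (\<exists>x. x \<noteq> 0 \<and> w x = 1)"

definition val_ring :: "('a::division_ring \<Rightarrow> int) \<Rightarrow> 'a set" where
  "val_ring w = {x. x = 0 \<or> 0 \<le> w x}"

definition val_ideal :: "('a::division_ring \<Rightarrow> int) \<Rightarrow> 'a set" where
  "val_ideal w = {x. x = 0 \<or> 0 < w x}"

definition val_tendsto :: "('a::division_ring \<Rightarrow> int) \<Rightarrow> (nat \<Rightarrow> 'a) \<Rightarrow> 'a \<Rightarrow> bool" where
  "val_tendsto w s l \<longleftrightarrow> (\<forall>N. \<exists>n0. \<forall>n\<ge>n0. s n = l \<or> N \<le> w (s n - l))"

definition val_Cauchy :: "('a::division_ring \<Rightarrow> int) \<Rightarrow> (nat \<Rightarrow> 'a) \<Rightarrow> bool" where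
  "val_Cauchy w s \<longleftrightarrow> (\<forall>N. \<exists>n0. \<forall>m\<ge>n0. \<forall>n\<ge>n0. s m = s n \<or> N \<le> w (s m - s n))"

definition nonarch_local_field :: "('f::field \<Rightarrow> int) \<Rightarrow> bool" where
  "nonarch_local_field v \<longleftrightarrow>
     normalized_valuation v \<and>
     (\<forall>s. val_Cauchy v s \<longrightarrow> (\<exists>l. val_tendsto v s l)) \<and>
     finite (val_ring v // {(x, y). x \<in> val_ring v \<and> y \<in> val_ring v \<and> x - y \<in> val_ideal v})"

text \<open>An \<open>F\<close>-algebra \<open>B\<close> is given by its structure map \<open>\<iota> : F \<rightarrow> B\<close>.\<close>

definition F_dim :: "('f::field \<Rightarrow> 'b::division_ring) \<Rightarrow> 'b set \<Rightarrow> nat" where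
  "F_dim \<iota> V = vector_space.dim (\<lambda>a x. \<iota> a * x) V"

definition quaternion_division_algebra :: "('f::field \<Rightarrow> 'b::division_ring) \<Rightarrow> bool" where
  "quaternion_division_algebra \<iota> \<longleftrightarrow>
     \<iota> 1 = 1 \<and> (\<forall>a b. \<iota> (a + b) = \<iota> a + \<iota> b) \<and> (\<forall>a b. \<iota> (a * b) = \<iota> a * \<iota> b) \<and>
     range \<iota> = {z. \<forall>x. z * x = x * z} \<and>
     F_dim \<iota> UNIV = 4"

text \<open>Involutions of the first kind, i.e. \<open>F\<close>-linear ones.\<close>

definition algebra_involution :: "('f::field \<Rightarrow> 'b::division_ring) \<Rightarrow> ('b \<Rightarrow> 'b) \<Rightarrow> bool" where
  "algebra_involution \<iota> s \<longleftrightarrow>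
     (\<forall>x y. s (x + y) = s x + s y) \<and> (\<forall>x y. s (x * y) = s y * s x) \<and>
     (\<forall>x. s (s x) = x) \<and> (\<forall>a. s (\<iota> a) = \<iota> a)"

text \<open>The canonical involution is the only involution for which all \<open>x * bar x\<close> (the reduced norm)
  and \<open>x + bar x\<close> (the reduced trace) lie in \<open>F\<close>.\<close>

definition canonical_involution :: "('f::field \<Rightarrow> 'b::division_ring) \<Rightarrow> ('b \<Rightarrow> 'b) \<Rightarrow> bool" where
  "canonical_involution \<iota> bar \<longleftrightarrow>
     algebra_involution \<iota> bar \<and> (\<forall>x. x + bar x \<in> range \<iota> \<and> x * bar x \<in> range \<iota>)"

text \<open>On a quaternion algebra in characteristic other than 2, an involution of the first kind is
  orthogonal if its space of symmetric elements has dimension 3 (and symplectic if this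
  dimension is 1).\<close>

definition orthogonal_involution :: "('f::field \<Rightarrow> 'b::division_ring) \<Rightarrow> ('b \<Rightarrow> 'b) \<Rightarrow> bool" where
  "orthogonal_involution \<iota> s \<longleftrightarrow> algebra_involution \<iota> s \<and> F_dim \<iota> {x. s x = x} = 3"

definition is_order :: "('f::field \<Rightarrow> int) \<Rightarrow> ('f \<Rightarrow> 'b::division_ring) \<Rightarrow> 'b set \<Rightarrow> bool" where
  "is_order v \<iota> R \<longleftrightarrow>
     1 \<in> R \<and> (\<forall>x\<in>R. \<forall>y\<in>R. x - y \<in> R \<and> x * y \<in> R) \<and>
     (\<exists>S. finite S \<and> R = {\<Sum>s\<in>S. \<iota> (c s) * s |c. \<forall>s\<in>S. c s \<in> val_ring v}) \<and>
     (\<forall>x. \<exists>a. a \<noteq> 0 \<and> \<iota> a * x \<in> R)"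

definition maximal_order :: "('f::field \<Rightarrow> int) \<Rightarrow> ('f \<Rightarrow> 'b::division_ring) \<Rightarrow> 'b set \<Rightarrow> bool" where
  "maximal_order v \<iota> R \<longleftrightarrow>
     is_order v \<iota> R \<and> (\<forall>R'. is_order v \<iota> R' \<longrightarrow> R \<subseteq> R' \<longrightarrow> R' = R)"

text \<open>The normalized valuation of \<open>B\<close>: its restriction to \<open>F\<close> is equivalent to \<open>v\<close>.\<close>

definition algebra_valuation ::
    "('f::field \<Rightarrow> int) \<Rightarrow> ('f \<Rightarrow> 'b::division_ring) \<Rightarrow> ('b \<Rightarrow> int) \<Rightarrow> bool" where
  "algebra_valuation v \<iota> w \<longleftrightarrow>
     normalized_valuation w \<and> (\<exists>e>0. \<forall>a. a \<noteq> 0 \<longrightarrow> w (\<iota> a) = e * v a)"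

text \<open>The integral closure of \<open>O_F\<close> in a subset \<open>K\<close> of \<open>B\<close>.\<close>

definition integers_of :: "('f::field \<Rightarrow> int) \<Rightarrow> ('f \<Rightarrow> 'b::division_ring) \<Rightarrow> 'b set \<Rightarrow> 'b set" where
  "integers_of v \<iota> K =
     {x \<in> K. \<exists>n c. c n = 1 \<and> (\<forall>i\<le>n. c i \<in> val_ring v) \<and> (\<Sum>i\<le>n. \<iota> (c i) * x ^ i) = 0}"

text \<open>The last condition says that the maximal ideal of \<open>O_F\<close> generates that of \<open>O_K\<close>; as the
  residue field of \<open>F\<close> is finite, the residue field extension is automatically separable.\<close>

definition unramified_quadratic_subfield ::
    "('f::field \<Rightarrow> int) \<Rightarrow> ('f \<Rightarrow> 'b::division_ring) \<Rightarrow> 'b set \<Rightarrow> bool" where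
  "unramified_quadratic_subfield v \<iota> K \<longleftrightarrow>
     range \<iota> \<subseteq> K \<and>
     (\<forall>x\<in>K. \<forall>y\<in>K. x - y \<in> K \<and> x * y \<in> K \<and> x * y = y * x) \<and> (\<forall>x\<in>K. inverse x \<in> K) \<and>
     F_dim \<iota> K = 2 \<and>
     {x \<in> integers_of v \<iota> K. x = 0 \<or> inverse x \<notin> integers_of v \<iota> K} =
       {\<iota> m * y |m y. m \<in> val_ideal v \<and> y \<in> integers_of v \<iota> K}"

definition nontrivial_automorphism ::
    "('f::field \<Rightarrow> 'b::division_ring) \<Rightarrow> 'b set \<Rightarrow> ('b \<Rightarrow> 'b) \<Rightarrow> bool" where
  "nontrivial_automorphism \<iota> K \<sigma> \<longleftrightarrow>
     bij_betw \<sigma> K K \<and>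
     (\<forall>x\<in>K. \<forall>y\<in>K. \<sigma> (x + y) = \<sigma> x + \<sigma> y \<and> \<sigma> (x * y) = \<sigma> x * \<sigma> y) \<and>
     (\<forall>a. \<sigma> (\<iota> a) = \<iota> a) \<and> (\<exists>x\<in>K. \<sigma> x \<noteq> x)"

text \<open>The element \<open>\<omega>\<close> plays the role of the capital Pi of the literature:
  \<open>O_B = O_K \<oplus> O_K \<omega>\<close>, \<open>\<omega>\<^sup>2 = \<pi>\<close> and \<open>\<omega> a = \<sigma>(a) \<omega>\<close>.\<close>

definition cyclic_presentation ::
    "('f::field \<Rightarrow> int) \<Rightarrow> ('f \<Rightarrow> 'b::division_ring) \<Rightarrow> 'b set \<Rightarrow> 'b set \<Rightarrow> ('b \<Rightarrow> 'b) \<Rightarrow> 'f \<Rightarrow> 'b \<Rightarrow> bool"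
  where
  "cyclic_presentation v \<iota> OB K \<sigma> \<pi> \<omega> \<longleftrightarrow>
     \<omega> \<in> OB \<and>
     OB = {a + b * \<omega> |a b. a \<in> integers_of v \<iota> K \<and> b \<in> integers_of v \<iota> K} \<and>
     (\<forall>a\<in>integers_of v \<iota> K. \<forall>b\<in>integers_of v \<iota> K. a + b * \<omega> = 0 \<longrightarrow> a = 0 \<and> b = 0) \<and>
     \<omega> * \<omega> = \<iota> \<pi> \<and>
     (\<forall>a\<in>integers_of v \<iota> K. \<omega> * a = \<sigma> a * \<omega>)"


section \<open>Bilattices\<close>

text \<open>As for the record \<open>module\<close>, the multiplicative part of the ring record is ignored.\<close>

record ('b, 'l) bimodule = "'l ring" +
  lsmult :: "'b \<Rightarrow> 'l \<Rightarrow> 'l"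
  rsmult :: "'l \<Rightarrow> 'b \<Rightarrow> 'l"

definition is_bimodule :: "'b::division_ring set \<Rightarrow> ('b, 'l) bimodule \<Rightarrow> bool" where
  "is_bimodule R L \<longleftrightarrow>
     abelian_group L \<and>
     (\<forall>\<alpha>\<in>R. \<forall>x\<in>carrier L. lsmult L \<alpha> x \<in> carrier L \<and> rsmult L x \<alpha> \<in> carrier L) \<and>
     (\<forall>\<alpha>\<in>R. \<forall>x\<in>carrier L. \<forall>y\<in>carrier L.
        lsmult L \<alpha> (x \<oplus>\<^bsub>L\<^esub> y) = lsmult L \<alpha> x \<oplus>\<^bsub>L\<^esub> lsmult L \<alpha> y \<and>
        rsmult L (x \<oplus>\<^bsub>L\<^esub> y) \<alpha> = rsmult L x \<alpha> \<oplus>\<^bsub>L\<^esub> rsmult L y \<alpha>) \<and>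
     (\<forall>\<alpha>\<in>R. \<forall>\<beta>\<in>R. \<forall>x\<in>carrier L.
        lsmult L (\<alpha> + \<beta>) x = lsmult L \<alpha> x \<oplus>\<^bsub>L\<^esub> lsmult L \<beta> x \<and>
        rsmult L x (\<alpha> + \<beta>) = rsmult L x \<alpha> \<oplus>\<^bsub>L\<^esub> rsmult L x \<beta> \<and>
        lsmult L (\<alpha> * \<beta>) x = lsmult L \<alpha> (lsmult L \<beta> x) \<and>
        rsmult L x (\<alpha> * \<beta>) = rsmult L (rsmult L x \<alpha>) \<beta> \<and>
        rsmult L (lsmult L \<alpha> x) \<beta> = lsmult L \<alpha> (rsmult L x \<beta>)) \<and>
     (\<forall>x\<in>carrier L. lsmult L 1 x = x \<and> rsmult L x 1 = x)"

definition is_subbimodule :: "'b::division_ring set \<Rightarrow> ('b, 'l) bimodule \<Rightarrow> 'l set \<Rightarrow> bool" where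
  "is_subbimodule R L N \<longleftrightarrow>
     N \<subseteq> carrier L \<and> \<zero>\<^bsub>L\<^esub> \<in> N \<and> (\<forall>x\<in>N. \<forall>y\<in>N. x \<ominus>\<^bsub>L\<^esub> y \<in> N) \<and>
     (\<forall>\<alpha>\<in>R. \<forall>x\<in>N. lsmult L \<alpha> x \<in> N \<and> rsmult L x \<alpha> \<in> N)"

definition bilattice ::
    "('f::field \<Rightarrow> int) \<Rightarrow> ('f \<Rightarrow> 'b::division_ring) \<Rightarrow> 'b set \<Rightarrow> ('b, 'l) bimodule \<Rightarrow> bool" where
  "bilattice v \<iota> OB L \<longleftrightarrow>
     is_bimodule OB L \<and>
     (\<exists>S. finite S \<and> S \<subseteq> carrier L \<and>
        (\<forall>N. is_subbimodule OB L N \<longrightarrow> S \<subseteq> N \<longrightarrow> N = carrier L)) \<and>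
     (\<forall>a\<in>val_ring v. \<forall>x\<in>carrier L. lsmult L (\<iota> a) x = rsmult L x (\<iota> a)) \<and>
     (\<forall>a\<in>val_ring v. \<forall>x\<in>carrier L. lsmult L (\<iota> a) x = \<zero>\<^bsub>L\<^esub> \<longrightarrow> a = 0 \<or> x = \<zero>\<^bsub>L\<^esub>)"

definition bimodule_iso ::
    "'b set \<Rightarrow> ('b, 'l) bimodule \<Rightarrow> ('b, 'm) bimodule \<Rightarrow> ('l \<Rightarrow> 'm) \<Rightarrow> bool" where
  "bimodule_iso R L M f \<longleftrightarrow>
     bij_betw f (carrier L) (carrier M) \<and>
     (\<forall>x\<in>carrier L. \<forall>y\<in>carrier L. f (x \<oplus>\<^bsub>L\<^esub> y) = f x \<oplus>\<^bsub>M\<^esub> f y) \<and>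
     (\<forall>\<alpha>\<in>R. \<forall>x\<in>carrier L.
        f (lsmult L \<alpha> x) = lsmult M \<alpha> (f x) \<and> f (rsmult L x \<alpha>) = rsmult M (f x) \<alpha>)"

text \<open>A pair \<open>(n, \<phi>)\<close> with \<open>\<phi> : O_B \<rightarrow> Mat_n(O_B)\<close> stands for the right module of column
  vectors with left action through \<open>\<phi>\<close>. Direct sums of such bilattices are formed by
  concatenating columns, that is, by block diagonal sums of the embeddings.\<close>

type_synonym 'b embedding = "nat \<times> ('b \<Rightarrow> 'b mat)"

definition embedding_bilattice ::
    "'b::division_ring set \<Rightarrow> 'b embedding \<Rightarrow> ('b, 'b vec) bimodule" where
  "embedding_bilattice OB e =
     \<lparr>carrier = {x \<in> carrier_vec (fst e). \<forall>i<fst e. x $ i \<in> OB},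
      mult = undefined, one = undefined, zero = 0\<^sub>v (fst e), add = (+),
      lsmult = (\<lambda>\<alpha> x. snd e \<alpha> *\<^sub>v x),
      rsmult = (\<lambda>x \<beta>. map_vec (\<lambda>c. c * \<beta>) x)\<rparr>"

definition direct_sum :: "'b::zero embedding list \<Rightarrow> 'b embedding" where
  "direct_sum es = (sum_list (map fst es), \<lambda>\<alpha>. diag_block_mat (map (\<lambda>e. snd e \<alpha>) es))"

text \<open>The coordinates \<open>(a, b)\<close> of \<open>\<alpha> = a + b \<omega>\<close> with respect to \<open>B = K \<oplus> K \<omega>\<close>.\<close>

definition K_coords :: "'b::division_ring set \<Rightarrow> 'b \<Rightarrow> 'b \<Rightarrow> 'b \<times> 'b" where
  "K_coords K \<omega> \<alpha> = (THE c. fst c \<in> K \<and> snd c \<in> K \<and> \<alpha> = fst c + snd c * \<omega>)"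

definition diag2 :: "'b::zero \<Rightarrow> 'b \<Rightarrow> 'b mat" where
  "diag2 a b = mat_of_rows_list 2 [[a, 0], [0, b]]"

definition bilat_O :: "'b embedding" where
  "bilat_O = (1, \<lambda>\<alpha>. mat_of_rows_list 1 [[\<alpha>]])"

definition bilat_P :: "'b::division_ring \<Rightarrow> 'b embedding" where
  "bilat_P \<omega> = (1, \<lambda>\<alpha>. mat_of_rows_list 1 [[inverse \<omega> * \<alpha> * \<omega>]])"

text \<open>The common value of \<open>\<phi>\<^sub>1\<close> and \<open>\<phi>\<^sub>2\<close> at \<open>\<omega>\<close>; its argument is \<open>\<pi>\<close>, viewed in \<open>B\<close>.\<close>

definition omega_mat :: "'b::division_ring \<Rightarrow> 'b mat" where
  "omega_mat p = mat_of_rows_list 2 [[0, p], [1, 0]]"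

text \<open>\<open>\<phi>\<^sub>1\<close> and \<open>\<phi>\<^sub>2\<close> are prescribed on \<open>O_K\<close> and at \<open>\<omega>\<close>; multiplicativity
  forces \<open>\<phi>(a + b \<omega>) = \<phi>(a) + \<phi>(b) \<phi>(\<omega>)\<close>.\<close>

definition bilat_L1 ::
    "('f \<Rightarrow> 'b::division_ring) \<Rightarrow> 'b set \<Rightarrow> ('b \<Rightarrow> 'b) \<Rightarrow> 'f \<Rightarrow> 'b \<Rightarrow> 'b embedding" where
  "bilat_L1 \<iota> K \<sigma> \<pi> \<omega> =
     (2, \<lambda>\<alpha>. case K_coords K \<omega> \<alpha> of (a, b) \<Rightarrow> diag2 a (\<sigma> a) + diag2 b (\<sigma> b) * omega_mat (\<iota> \<pi>))"

definition bilat_L2 ::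
    "('f \<Rightarrow> 'b::division_ring) \<Rightarrow> 'b set \<Rightarrow> ('b \<Rightarrow> 'b) \<Rightarrow> 'f \<Rightarrow> 'b \<Rightarrow> 'b embedding" where
  "bilat_L2 \<iota> K \<sigma> \<pi> \<omega> =
     (2, \<lambda>\<alpha>. case K_coords K \<omega> \<alpha> of (a, b) \<Rightarrow> diag2 (\<sigma> a) a + diag2 (\<sigma> b) b * omega_mat (\<iota> \<pi>))"

definition standard_embedding ::
    "('f \<Rightarrow> 'b::division_ring) \<Rightarrow> 'b set \<Rightarrow> ('b \<Rightarrow> 'b) \<Rightarrow> 'f \<Rightarrow> 'b \<Rightarrow>
     nat \<Rightarrow> nat \<Rightarrow> nat \<Rightarrow> nat \<Rightarrow> 'b embedding" where
  "standard_embedding \<iota> K \<sigma> \<pi> \<omega> r1 r2 t1 t2 =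
     direct_sum (replicate r1 bilat_O @ replicate r2 (bilat_P \<omega>) @
       replicate t1 (bilat_L1 \<iota> K \<sigma> \<pi> \<omega>) @ replicate t2 (bilat_L2 \<iota> K \<sigma> \<pi> \<omega>))"

definition structural_invariant ::
    "('f::field \<Rightarrow> int) \<Rightarrow> ('f \<Rightarrow> 'b::division_ring) \<Rightarrow> 'b set \<Rightarrow> 'b set \<Rightarrow> ('b \<Rightarrow> 'b) \<Rightarrow> 'f \<Rightarrow> 'b \<Rightarrow>
     ('b, 'l) bimodule \<Rightarrow> nat \<Rightarrow> nat \<Rightarrow> nat \<Rightarrow> nat \<Rightarrow> bool" where
  "structural_invariant v \<iota> OB K \<sigma> \<pi> \<omega> L r1 r2 t1 t2 \<longleftrightarrow>
     bilattice v \<iota> OB L \<and>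
     (\<exists>f. bimodule_iso OB L
        (embedding_bilattice OB (standard_embedding \<iota> K \<sigma> \<pi> \<omega> r1 r2 t1 t2)) f)"


section \<open>Hermitian pairings\<close>

text \<open>\<open>L \<otimes> F\<close> is realized as the localization of \<open>L\<close> at the non-zero elements of \<open>O_F\<close>: the pair
  \<open>(x, a)\<close> represents \<open>x \<otimes> a\<^sup>-\<^sup>1\<close>. As \<open>L\<close> is torsion-free, no further factor is needed
  in the equivalence relation.\<close>

definition frac_rel ::
    "('f::field \<Rightarrow> int) \<Rightarrow> ('f \<Rightarrow> 'b) \<Rightarrow> ('b, 'l) bimodule \<Rightarrow> (('l \<times> 'f) \<times> ('l \<times> 'f)) set" where
  "frac_rel v \<iota> L =
     {((x, a), (y, b)). x \<in> carrier L \<and> y \<in> carrier L \<and> a \<in> val_ring v - {0} \<and> b \<in> val_ring v - {0} \<and>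
        lsmult L (\<iota> b) x = lsmult L (\<iota> a) y}"

definition frac_space ::
    "('f::field \<Rightarrow> int) \<Rightarrow> ('f \<Rightarrow> 'b) \<Rightarrow> ('b, 'l) bimodule \<Rightarrow> ('l \<times> 'f) set set" where
  "frac_space v \<iota> L = (carrier L \<times> (val_ring v - {0})) // frac_rel v \<iota> L"

definition frac_of ::
    "('f::field \<Rightarrow> int) \<Rightarrow> ('f \<Rightarrow> 'b) \<Rightarrow> ('b, 'l) bimodule \<Rightarrow> 'l \<Rightarrow> ('l \<times> 'f) set" where
  "frac_of v \<iota> L x = frac_rel v \<iota> L `` {(x, 1)}"

text \<open>The \<open>F\<close>-bilinear extension of a pairing on \<open>L\<close> to \<open>L \<otimes> F\<close>.\<close>

definition frac_pairing ::
    "('f::field \<Rightarrow> 'b::division_ring) \<Rightarrow> ('l \<Rightarrow> 'l \<Rightarrow> 'b) \<Rightarrow> ('l \<times> 'f) set \<Rightarrow> ('l \<times> 'f) set \<Rightarrow> 'b" where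
  "frac_pairing \<iota> p X Y = (THE c. \<forall>(x, a)\<in>X. \<forall>(y, b)\<in>Y. c = \<iota> (inverse (a * b)) * p x y)"

definition hermitian_pairing ::
    "('f::field \<Rightarrow> int) \<Rightarrow> ('f \<Rightarrow> 'b::division_ring) \<Rightarrow> ('b \<Rightarrow> 'b) \<Rightarrow> 'b set \<Rightarrow> ('b \<Rightarrow> 'b) \<Rightarrow>
     ('b, 'l) bimodule \<Rightarrow> ('l \<Rightarrow> 'l \<Rightarrow> 'b) \<Rightarrow> bool" where
  "hermitian_pairing v \<iota> bar OB star L p \<longleftrightarrow>
     (\<forall>x\<in>carrier L. \<forall>y\<in>carrier L. \<forall>z\<in>carrier L.
        p (x \<oplus>\<^bsub>L\<^esub> y) z = p x z + p y z \<and> p x (y \<oplus>\<^bsub>L\<^esub> z) = p x y + p x z) \<and>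
     (\<forall>a\<in>val_ring v. \<forall>x\<in>carrier L. \<forall>y\<in>carrier L.
        p (lsmult L (\<iota> a) x) y = \<iota> a * p x y \<and> p x (lsmult L (\<iota> a) y) = \<iota> a * p x y) \<and>
     (\<forall>X\<in>frac_space v \<iota> L.
        (\<forall>Y\<in>frac_space v \<iota> L. frac_pairing \<iota> p X Y = 0) \<longrightarrow> X = frac_of v \<iota> L \<zero>\<^bsub>L\<^esub>) \<and>
     (\<forall>x\<in>carrier L. \<forall>y\<in>carrier L. p x y = bar (p y x)) \<and>
     (\<forall>x\<in>carrier L. \<forall>y\<in>carrier L. \<forall>\<alpha>\<in>OB. \<forall>\<beta>\<in>OB.
        p (rsmult L x \<alpha>) (rsmult L y \<beta>) = bar \<alpha> * p x y * \<beta>) \<and>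
     (\<forall>x\<in>carrier L. \<forall>y\<in>carrier L. \<forall>\<alpha>\<in>OB. p (lsmult L \<alpha> x) y = p x (lsmult L (star \<alpha>) y))"

definition perfect_pairing ::
    "('f::field \<Rightarrow> int) \<Rightarrow> ('f \<Rightarrow> 'b::division_ring) \<Rightarrow> 'b set \<Rightarrow>
     ('b, 'l) bimodule \<Rightarrow> ('l \<Rightarrow> 'l \<Rightarrow> 'b) \<Rightarrow> bool" where
  "perfect_pairing v \<iota> OB L p \<longleftrightarrow>
     {X \<in> frac_space v \<iota> L. \<forall>y\<in>carrier L. frac_pairing \<iota> p X (frac_of v \<iota> L y) \<in> OB} =
     frac_of v \<iota> L ` carrier L"

definition perfect_hermitian_pairing ::
    "('f::field \<Rightarrow> int) \<Rightarrow> ('f \<Rightarrow> 'b::division_ring) \<Rightarrow> ('b \<Rightarrow> 'b) \<Rightarrow> 'b set \<Rightarrow> ('b \<Rightarrow> 'b) \<Rightarrow>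
     ('b, 'l) bimodule \<Rightarrow> ('l \<Rightarrow> 'l \<Rightarrow> 'b) \<Rightarrow> bool" where
  "perfect_hermitian_pairing v \<iota> bar OB star L p \<longleftrightarrow>
     hermitian_pairing v \<iota> bar OB star L p \<and> perfect_pairing v \<iota> OB L p"

definition isometric ::
    "'b set \<Rightarrow> ('b, 'l) bimodule \<Rightarrow> ('l \<Rightarrow> 'l \<Rightarrow> 'b) \<Rightarrow>
     ('b, 'm) bimodule \<Rightarrow> ('m \<Rightarrow> 'm \<Rightarrow> 'b) \<Rightarrow> bool" where
  "isometric OB L p M q \<longleftrightarrow>
     (\<exists>f. bimodule_iso OB L M f \<and> (\<forall>x\<in>carrier L. \<forall>y\<in>carrier L. q (f x) (f y) = p x y))"

text \<open>The pairing \<open>\<langle>x, y\<rangle>\<^sub>u = \<langle>x, u y\<rangle>\<close>.\<close>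

definition twist_pairing :: "('b, 'l) bimodule \<Rightarrow> ('l \<Rightarrow> 'l \<Rightarrow> 'b) \<Rightarrow> 'b \<Rightarrow> 'l \<Rightarrow> 'l \<Rightarrow> 'b" where
  "twist_pairing L p u x y = p x (lsmult L u y)"

text \<open>The pairing on column vectors with Gram matrix \<open>C\<close>: conjugate transpose of \<open>x\<close> times
  \<open>C y\<close>.\<close>

definition gram_pairing :: "('b::division_ring \<Rightarrow> 'b) \<Rightarrow> 'b mat \<Rightarrow> 'b vec \<Rightarrow> 'b vec \<Rightarrow> 'b" where
  "gram_pairing bar C x y = map_vec bar x \<bullet> (C *\<^sub>v y)"

type_synonym 'b gram_bilattice = "'b embedding \<times> 'b mat"

definition orthogonal_sum :: "'b::zero gram_bilattice list \<Rightarrow> 'b gram_bilattice" where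
  "orthogonal_sum ms = (direct_sum (map fst ms), diag_block_mat (map snd ms))"

definition bilat_M4 :: "'b::division_ring gram_bilattice" where
  "bilat_M4 = (direct_sum [bilat_O, bilat_O], mat_of_rows_list 2 [[0, 1], [-1, 0]])"

definition bilat_M5 :: "'b::division_ring \<Rightarrow> 'b gram_bilattice" where
  "bilat_M5 \<omega> = (direct_sum [bilat_P \<omega>, bilat_P \<omega>], mat_of_rows_list 2 [[0, 1], [-1, 0]])"

definition bilat_M6 ::
    "('f \<Rightarrow> 'b::division_ring) \<Rightarrow> 'b set \<Rightarrow> ('b \<Rightarrow> 'b) \<Rightarrow> 'f \<Rightarrow> 'b \<Rightarrow> 'b gram_bilattice" where
  "bilat_M6 \<iota> K \<sigma> \<pi> \<omega> =
     (direct_sum [bilat_L1 \<iota> K \<sigma> \<pi> \<omega>, bilat_L2 \<iota> K \<sigma> \<pi> \<omega>],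
      mat_of_rows_list 4 [[0, 0, 0, 1], [0, 0, -1, 0], [0, 1, 0, 0], [-1, 0, 0, 0]])"

definition standard_skew_sum ::
    "('f \<Rightarrow> 'b::division_ring) \<Rightarrow> 'b set \<Rightarrow> ('b \<Rightarrow> 'b) \<Rightarrow> 'f \<Rightarrow> 'b \<Rightarrow>
     nat \<Rightarrow> nat \<Rightarrow> nat \<Rightarrow> 'b gram_bilattice" where
  "standard_skew_sum \<iota> K \<sigma> \<pi> \<omega> m4 m5 m6 =
     orthogonal_sum (replicate m4 bilat_M4 @ replicate m5 (bilat_M5 \<omega>) @
       replicate m6 (bilat_M6 \<iota> K \<sigma> \<pi> \<omega>))"

end

theory Submission
  imports Defs "HOL-Library.Product_Plus" "HOL-Library.Function_Algebras"
begin

text \<open>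
  For \<open>u = c \<gamma>\<close> a unit, \<open>q(x, y) = p(x, u y)\<close> is skew-hermitian with
  \<open>q(\<alpha> x, y) = q(x, bar \<alpha> y)\<close>. On elements commuting with \<open>O_B\<close> it is \<open>F\<close>-valued and alternating,
  because the characteristic is not 2; this forces the parity conditions.
  The generators of the standard bilattice are plus or minus elements (\<open>a x = x a\<close> or \<open>a x = x \<sigma>(a)\<close> for
  \<open>a\<close> in \<open>O_K\<close>), and a plus element pairs with a minus element into \<open>O_K \<omega>\<close>. Hence, if \<open>x\<close> generates a
  summand of type \<open>L_1\<close> and no generator of a summand \<open>L_2\<close> pairs with \<open>\<omega> x\<close> to a unit,
  then \<open>\<omega> x\<close> pairs with everything into the maximal ideal, and self-duality makes \<open>\<omega> x\<close> divisible
  by \<open>\<omega>\<close> from the right, which it is not. So there is such a partner; the pair can be normalized to a hyperbolic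
  plane, which splits off orthogonally. Once these summands are gone the same argument pairs up the summands \<open>O\<close>,
  and conjugating the left action by \<open>\<omega>\<close> reduces \<open>P\<close> and \<open>L_2\<close> to \<open>O\<close> and \<open>L_1\<close>.
  The normalization only needs an element \<open>\<theta>\<close> of \<open>O_K\<close> with \<open>\<theta> - \<sigma>(\<theta>)\<close> a unit, so that \<open>2\<close> may
  be a nonunit.
\<close>

section \<open>Valuations\<close>

text \<open>Two obstacles shape the argument. In residue characteristic 2 a skew-hermitian value
  cannot be halved, so isotropy is reached by solving \<open>b - \<sigma> b = d\<close> in O_K; and
  every correction of a generator has to stay inside its plus or minus part, because otherwise its
  kind would be lost. The numbers of summands are controlled through index sets: each plane is
  spanned by two of the current generators, and the projections of the others to its complement keep
  their kinds, so splitting off a plane removes exactly two indices. Evenness of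
  \<open>ordB \<gamma>\<close> enters because \<open>ordB\<close> takes exactly the even values on
  F, which makes some F-multiple of \<open>\<gamma>\<close> a unit. All computations take place in
  an ambient module over B that contains the lattice; the form is extended to it, and elements of L
  \<otimes> F become vectors there instead of equivalence classes.\<close>

definition val_ge :: "('a::division_ring \<Rightarrow> int) \<Rightarrow> int \<Rightarrow> 'a set" where
  "val_ge w n = {x. x = 0 \<or> n \<le> w x}"

lemma val_ring_ge: "val_ring w = val_ge w 0"
  by (simp add: val_ring_def val_ge_def)

locale valued =
  fixes w :: "'a::division_ring \<Rightarrow> int"
  assumes normalized: "normalized_valuation w"
begin

lemma val_mult: "x \<noteq> 0 \<Longrightarrow> y \<noteq> 0 \<Longrightarrow> w (x * y) = w x + w y"
  using normalized by (simp add: normalized_valuation_def)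

lemma val_add: "x \<noteq> 0 \<Longrightarrow> y \<noteq> 0 \<Longrightarrow> x + y \<noteq> 0 \<Longrightarrow> min (w x) (w y) \<le> w (x + y)"
  using normalized by (simp add: normalized_valuation_def)

lemma val_one [simp]: "w 1 = 0"
  using val_mult[of 1 1] by simp

lemma val_minus [simp]: "w (- x) = w x"
proof (cases "x = 0")
  case False
  have "w ((-1) * (-1)) = w (-1) + w (-1)" by (rule val_mult) auto
  then have "w (-1) = 0" by simp
  then show ?thesis using val_mult[of "-1" x] False by simp
qed simp

lemma val_inverse: "x \<noteq> 0 \<Longrightarrow> w (inverse x) = - w x"
  using val_mult[of x "inverse x"] by simp

lemma val_power: "x \<noteq> 0 \<Longrightarrow> w (x ^ n) = int n * w x"
  by (induction n) (auto simp: val_mult algebra_simps)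

lemma zero_ge [simp]: "0 \<in> val_ge w n" by (simp add: val_ge_def)

lemma one_ge [simp]: "1 \<in> val_ge w 0" by (simp add: val_ge_def)

lemma minus_ge [simp]: "- x \<in> val_ge w n \<longleftrightarrow> x \<in> val_ge w n" by (simp add: val_ge_def)

lemma add_ge: "x \<in> val_ge w n \<Longrightarrow> y \<in> val_ge w n \<Longrightarrow> x + y \<in> val_ge w n"
  using val_add[of x y] by (cases "x = 0"; cases "y = 0"; cases "x + y = 0") (auto simp: val_ge_def)

lemma diff_ge: "x \<in> val_ge w n \<Longrightarrow> y \<in> val_ge w n \<Longrightarrow> x - y \<in> val_ge w n"
  using add_ge[of x n "- y"] by simp

lemma mult_ge: "x \<in> val_ge w n \<Longrightarrow> y \<in> val_ge w m \<Longrightarrow> x * y \<in> val_ge w (n + m)"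
  using val_mult[of x y] by (cases "x = 0"; cases "y = 0") (auto simp: val_ge_def)

lemma ge_mono: "x \<in> val_ge w n \<Longrightarrow> m \<le> n \<Longrightarrow> x \<in> val_ge w m"
  by (auto simp: val_ge_def)

lemma sum_ge: "(\<And>i. i \<in> I \<Longrightarrow> f i \<in> val_ge w n) \<Longrightarrow> sum f I \<in> val_ge w n"
  by (induction I rule: infinite_finite_induct) (auto intro: add_ge)

lemma power_ge: "x \<in> val_ge w 0 \<Longrightarrow> x ^ n \<in> val_ge w 0"
  by (induction n) (use mult_ge[of _ 0 _ 0] in auto)

text \<open>Summands of different valuation cannot cancel: otherwise the one of smaller valuation
  would be a difference of two elements of larger valuation.\<close>

lemma add_ge_distinct:
  assumes "x + y \<in> val_ge w n" and ne: "x \<noteq> 0 \<Longrightarrow> y \<noteq> 0 \<Longrightarrow> w x \<noteq> w y"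
  shows "x \<in> val_ge w n \<and> y \<in> val_ge w n"
proof -
  have *: "a \<in> val_ge w n" if ab: "a + b \<in> val_ge w n" and n: "a \<noteq> 0 \<Longrightarrow> b \<noteq> 0 \<Longrightarrow> w a < w b" for a b
  proof (rule ccontr)
    assume a: "a \<notin> val_ge w n"
    then have a': "a \<noteq> 0" "w a < n" by (auto simp: val_ge_def)
    have "b \<in> val_ge w (w a + 1)" using n a' by (cases "b = 0") (auto simp: val_ge_def)
    moreover have "a + b \<in> val_ge w (w a + 1)" using ab a' by (intro ge_mono[OF ab]) auto
    ultimately have "a + b - b \<in> val_ge w (w a + 1)" by (rule diff_ge[rotated])
    then show False using a' by (simp add: val_ge_def)
  qed
  consider "x = 0" | "y = 0" | "x \<noteq> 0" "y \<noteq> 0" "w x < w y" | "x \<noteq> 0" "y \<noteq> 0" "w y < w x"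
    using ne by fastforce
  then show ?thesis
  proof cases
    case 3
    have "x \<in> val_ge w n" by (rule *[OF assms(1)]) (use 3 in auto)
    then show ?thesis using diff_ge[OF assms(1), of x] by simp
  next
    case 4
    have "y \<in> val_ge w n" by (rule *[of y x]) (use 4 assms(1) in \<open>auto simp: add.commute\<close>)
    then show ?thesis using diff_ge[OF assms(1), of y] by simp
  qed (use assms(1) in auto)
qed

end

section \<open>The quaternion algebra\<close>

locale quat =
  fixes v :: "'f::field \<Rightarrow> int"
    and \<iota> :: "'f \<Rightarrow> 'b::division_ring"
    and bar \<sigma> :: "'b \<Rightarrow> 'b"
    and OB K :: "'b set"
    and ordB :: "'b \<Rightarrow> int"
    and \<pi> :: 'f
    and \<omega> :: 'b
  assumes local_field: "nonarch_local_field v" and two: "(2::'f) \<noteq> 0"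
    and quaternion: "quaternion_division_algebra \<iota>"
    and canonical: "canonical_involution \<iota> bar"
    and maximal: "maximal_order v \<iota> OB"
    and algebra_val: "algebra_valuation v \<iota> ordB"
    and unramified: "unramified_quadratic_subfield v \<iota> K"
    and autom: "nontrivial_automorphism \<iota> K \<sigma>"
    and pi: "\<pi> \<noteq> 0" "v \<pi> = 1"
    and cyclic: "cyclic_presentation v \<iota> OB K \<sigma> \<pi> \<omega>"
begin

sublocale F: valued v
  using local_field by unfold_locales (simp add: nonarch_local_field_def)

sublocale B: valued ordB
  using algebra_val by unfold_locales (simp add: algebra_valuation_def)

abbreviation "R \<equiv> integers_of v \<iota> K"
abbreviation "P \<equiv> val_ge ordB 1"

lemma iota_1 [simp]: "\<iota> 1 = 1" and iota_add: "\<iota> (a + b) = \<iota> a + \<iota> b"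
  and iota_mult: "\<iota> (a * b) = \<iota> a * \<iota> b"
  using quaternion by (simp_all add: quaternion_division_algebra_def)

lemma iota_commute: "\<iota> a * x = x * \<iota> a"
proof -
  have "\<iota> a \<in> {z. \<forall>x. z * x = x * z}"
    using quaternion unfolding quaternion_division_algebra_def by blast
  then show ?thesis by simp
qed

lemma iota_0 [simp]: "\<iota> 0 = 0"
  using iota_add[of 0 0] by simp

lemma iota_minus: "\<iota> (- a) = - \<iota> a"
  using iota_add[of a "- a"] by (simp add: add_eq_0_iff)

lemma iota_eq_0 [simp]: "\<iota> a = 0 \<longleftrightarrow> a = 0"
proof
  assume "\<iota> a = 0"
  show "a = 0"
  proof (rule ccontr)
    assume "a \<noteq> 0"
    then have "\<iota> a * \<iota> (inverse a) = 1" by (simp flip: iota_mult)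
    with \<open>\<iota> a = 0\<close> show False by simp
  qed
qed simp

lemma iota_inverse: "\<iota> (inverse a) = inverse (\<iota> a)"
proof (cases "a = 0")
  case False
  then have "\<iota> a * \<iota> (inverse a) = 1" by (simp flip: iota_mult)
  then show ?thesis by (metis inverse_unique)
qed simp

lemma two_B: "(2::'b) \<noteq> 0"
proof -
  have "\<iota> 2 = 2" using iota_add[of 1 1] by simp
  then show ?thesis using two iota_eq_0[of 2] by auto
qed

lemma double_eq_0: "x + x = 0 \<longleftrightarrow> (x::'b) = 0"
  using two_B by (metis mult_2 mult_eq_0_iff add_0)

text \<open>The ramification index of B over F; it turns out to be 2 in
  \<open>ram_2\<close>.\<close>

definition ram where "ram = (SOME e. e > 0 \<and> (\<forall>a. a \<noteq> 0 \<longrightarrow> ordB (\<iota> a) = e * v a))"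

lemma ram: "ram > 0" "a \<noteq> 0 \<Longrightarrow> ordB (\<iota> a) = ram * v a"
proof -
  have "\<exists>e. e > 0 \<and> (\<forall>a. a \<noteq> 0 \<longrightarrow> ordB (\<iota> a) = e * v a)"
    using algebra_val by (simp add: algebra_valuation_def)
  from someI_ex[OF this] show "ram > 0" "a \<noteq> 0 \<Longrightarrow> ordB (\<iota> a) = ram * v a"
    by (auto simp: ram_def)
qed

lemma iota_ge: "\<iota> a \<in> val_ge ordB 0 \<longleftrightarrow> a \<in> val_ring v"
  using ram(1) ram(2)[of a] by (cases "a = 0") (auto simp: val_ge_def val_ring_def zero_le_mult_iff)

subsection \<open>The subfield and its ring of integers\<close>

lemma K_iota [simp]: "\<iota> a \<in> K" and K_diff: "x \<in> K \<Longrightarrow> y \<in> K \<Longrightarrow> x - y \<in> K"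
  and K_mult: "x \<in> K \<Longrightarrow> y \<in> K \<Longrightarrow> x * y \<in> K"
  and K_commute: "x \<in> K \<Longrightarrow> y \<in> K \<Longrightarrow> x * y = y * x"
  and K_inverse: "x \<in> K \<Longrightarrow> inverse x \<in> K"
  using unramified by (auto simp: unramified_quadratic_subfield_def)

lemma K_0 [simp]: "0 \<in> K" and K_1 [simp]: "1 \<in> K"
  using K_iota[of 0] K_iota[of 1] by simp_all

lemma K_minus: "x \<in> K \<Longrightarrow> - x \<in> K"
  using K_diff[of 0 x] by simp

lemma K_add: "x \<in> K \<Longrightarrow> y \<in> K \<Longrightarrow> x + y \<in> K"
  using K_diff[of x "- y"] K_minus by simp

lemma K_power: "x \<in> K \<Longrightarrow> x ^ n \<in> K"
  by (induction n) (auto intro: K_mult)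

lemmas K_closed = K_add K_diff K_mult K_minus K_inverse

lemma sigma_K: "x \<in> K \<Longrightarrow> \<sigma> x \<in> K"
  and sigma_add: "x \<in> K \<Longrightarrow> y \<in> K \<Longrightarrow> \<sigma> (x + y) = \<sigma> x + \<sigma> y"
  and sigma_mult: "x \<in> K \<Longrightarrow> y \<in> K \<Longrightarrow> \<sigma> (x * y) = \<sigma> x * \<sigma> y"
  and sigma_iota [simp]: "\<sigma> (\<iota> a) = \<iota> a"
  and sigma_nontrivial: "\<exists>x\<in>K. \<sigma> x \<noteq> x"
  using autom by (auto simp: nontrivial_automorphism_def bij_betw_def)

lemma sigma_0 [simp]: "\<sigma> 0 = 0" and sigma_1 [simp]: "\<sigma> 1 = 1"
  using sigma_iota[of 0] sigma_iota[of 1] by simp_all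

lemma sigma_minus: "x \<in> K \<Longrightarrow> \<sigma> (- x) = - \<sigma> x"
  using sigma_add[of x "- x"] K_minus[of x] by (simp add: add_eq_0_iff)

lemma sigma_diff: "x \<in> K \<Longrightarrow> y \<in> K \<Longrightarrow> \<sigma> (x - y) = \<sigma> x - \<sigma> y"
  using sigma_add[of x "- y"] sigma_minus[of y] K_minus[of y] by simp

lemma sigma_power: "x \<in> K \<Longrightarrow> \<sigma> (x ^ n) = \<sigma> x ^ n"
  by (induction n) (auto simp: sigma_mult K_power)

lemma sigma_inverse: assumes "x \<in> K" shows "\<sigma> (inverse x) = inverse (\<sigma> x)"
proof (cases "x = 0")
  case False
  then have "\<sigma> x * \<sigma> (inverse x) = 1" using assms by (simp flip: sigma_mult add: K_inverse)
  then show ?thesis by (metis inverse_unique)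
qed simp

lemma sigma_sum: "(\<And>i. i \<in> I \<Longrightarrow> f i \<in> K) \<Longrightarrow> \<sigma> (sum f I) = (\<Sum>i\<in>I. \<sigma> (f i)) \<and> sum f I \<in> K"
  by (induction I rule: infinite_finite_induct) (auto simp: sigma_add K_add)

lemma R_K: "x \<in> R \<Longrightarrow> x \<in> K" by (simp add: integers_of_def)

lemma sigma_R: assumes "x \<in> R" shows "\<sigma> x \<in> R"
proof -
  obtain n c where c: "c n = 1" "\<forall>i\<le>n. c i \<in> val_ring v" "(\<Sum>i\<le>n. \<iota> (c i) * x ^ i) = 0" and x: "x \<in> K"
    using assms by (auto simp: integers_of_def)
  have "\<sigma> (\<Sum>i\<le>n. \<iota> (c i) * x ^ i) = (\<Sum>i\<le>n. \<sigma> (\<iota> (c i) * x ^ i))"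
    using sigma_sum[of "{..n}" "\<lambda>i. \<iota> (c i) * x ^ i"] x by (auto simp: K_mult K_power)
  also have "\<dots> = (\<Sum>i\<le>n. \<iota> (c i) * \<sigma> x ^ i)"
    using x by (intro sum.cong) (auto simp: sigma_mult K_power sigma_power)
  finally have "(\<Sum>i\<le>n. \<iota> (c i) * \<sigma> x ^ i) = 0" using c by simp
  then show ?thesis unfolding integers_of_def
    by (intro CollectI conjI exI[of _ n] exI[of _ c]) (use c x sigma_K in auto)
qed

lemma iota_R: assumes "a \<in> val_ring v" shows "\<iota> a \<in> R"
proof -
  let ?c = "\<lambda>i::nat. if i = 0 then - a else 1"
  have "\<forall>i\<le>1. ?c i \<in> val_ring v" using assms by (auto simp: val_ring_ge)
  moreover have "(\<Sum>i\<le>1. \<iota> (?c i) * \<iota> a ^ i) = 0" by (simp add: iota_minus)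
  ultimately show ?thesis unfolding integers_of_def
    by (intro CollectI conjI exI[of _ 1] exI[of _ ?c]) auto
qed

text \<open>If \<open>x\<close> had negative valuation, the leading term of its monic equation would
  have strictly smaller valuation than all the other terms together.\<close>

lemma R_ge: assumes "x \<in> R" shows "x \<in> val_ge ordB 0"
proof (rule ccontr)
  assume "x \<notin> val_ge ordB 0"
  then have x: "x \<noteq> 0" "ordB x < 0" by (auto simp: val_ge_def)
  obtain n c where c: "c n = 1" "\<forall>i\<le>n. c i \<in> val_ring v" "(\<Sum>i\<le>n. \<iota> (c i) * x ^ i) = 0"
    using assms by (auto simp: integers_of_def)
  have "n \<noteq> 0" using c by (auto intro: gr0I)
  then obtain m where n: "n = Suc m" by (cases n) auto
  have "(\<Sum>i\<le>m. \<iota> (c i) * x ^ i) \<in> val_ge ordB (int m * ordB x)"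
  proof (rule B.sum_ge)
    fix i assume i: "i \<in> {..m}"
    have "x ^ i \<in> val_ge ordB (int m * ordB x)"
      using i x by (auto simp: val_ge_def B.val_power mult_right_mono_neg)
    then show "\<iota> (c i) * x ^ i \<in> val_ge ordB (int m * ordB x)"
      using B.mult_ge[of "\<iota> (c i)" 0] c(2) i n by (simp add: iota_ge)
  qed
  moreover have "x ^ n = - (\<Sum>i\<le>m. \<iota> (c i) * x ^ i)"
    using c n by (simp add: eq_neg_iff_add_eq_0 add.commute)
  ultimately have "x ^ n \<in> val_ge ordB (int m * ordB x)" by simp
  then show False using x B.val_power[of x n] n
    by (auto simp: val_ge_def algebra_simps simp del: power_Suc)
qed

lemma bar_add: "bar (x + y) = bar x + bar y" and bar_mult: "bar (x * y) = bar y * bar x"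
  and bar_bar [simp]: "bar (bar x) = x" and bar_iota [simp]: "bar (\<iota> a) = \<iota> a"
  and trace_F: "x + bar x \<in> range \<iota>" and norm_F: "x * bar x \<in> range \<iota>"
  using canonical by (simp_all add: canonical_involution_def algebra_involution_def)

lemma bar_0 [simp]: "bar 0 = 0" and bar_1 [simp]: "bar 1 = 1"
  using bar_iota[of 0] bar_iota[of 1] by simp_all

lemma bar_minus: "bar (- x) = - bar x"
  using bar_add[of x "- x"] by (simp add: add_eq_0_iff)

lemma bar_diff: "bar (x - y) = bar x - bar y"
  using bar_add[of x "- y"] by (simp add: bar_minus)

lemma bar_eq_0 [simp]: "bar x = 0 \<longleftrightarrow> x = 0"
  by (metis bar_0 bar_bar)

lemma bar_inverse: "bar (inverse x) = inverse (bar x)"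
proof (cases "x = 0")
  case False
  then have "bar (inverse x * x) = 1" by simp
  then show ?thesis unfolding bar_mult by (metis inverse_unique)
qed simp

text \<open>Every element is a root of a monic quadratic polynomial whose coefficients are its
  reduced trace and norm. A power of \<open>\<pi>\<close> that clears the denominators of both makes
  the multiple integral.\<close>

lemma scale_R: assumes "x \<in> K" shows "\<exists>c. c \<noteq> 0 \<and> \<iota> c * x \<in> R"
proof -
  obtain t n where t: "x + bar x = \<iota> t" and n: "x * bar x = \<iota> n"
    using trace_F[of x] norm_F[of x] by auto
  define m where "m = nat (\<bar>v t\<bar> + \<bar>v n\<bar>)"
  define c where "c = \<pi> ^ m"
  have c0: "c \<noteq> 0" and vc: "v c = int m" using pi by (auto simp: c_def F.val_power)
  have *: "c * s \<in> val_ring v" if "- v s \<le> int m" for s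
    using F.val_mult[OF c0, of s] vc that by (cases "s = 0") (auto simp: val_ring_def)
  have ct: "c * t \<in> val_ring v" by (rule *) (simp add: m_def)
  have cn: "c * n \<in> val_ring v" by (rule *) (simp add: m_def)
  have cc: "c \<in> val_ring v" using vc by (simp add: val_ring_def)
  have ccn: "c * c * n \<in> val_ring v" using F.mult_ge[of c 0 "c * n" 0] cn cc by (simp add: val_ring_ge mult.assoc)
  define y where "y = \<iota> c * x"
  let ?d = "\<lambda>i::nat. if i = 0 then c * c * n else if i = 1 then - (c * t) else 1"
  have quad: "x * x - \<iota> t * x + \<iota> n = 0"
  proof -
    have b: "bar x = \<iota> t - x" using t by (metis add_diff_cancel_left')
    have "\<iota> n = x * \<iota> t - x * x" using n unfolding b by (simp add: right_diff_distrib)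
    then show ?thesis by (simp add: iota_commute[of t])
  qed
  have "y * y = \<iota> c * (x * \<iota> c) * x" by (simp add: y_def mult.assoc)
  also have "\<dots> = \<iota> c * \<iota> c * (x * x)" unfolding iota_commute[of c x, symmetric] by (simp add: mult.assoc)
  finally have yy: "y * y = \<iota> c * \<iota> c * (x * x)" .
  have "\<iota> (c * t) * y = \<iota> c * (\<iota> t * \<iota> c) * x" by (simp add: y_def iota_mult mult.assoc)
  also have "\<dots> = \<iota> c * \<iota> c * (\<iota> t * x)" unfolding iota_commute[of t "\<iota> c"] by (simp add: mult.assoc)
  finally have "y * y - \<iota> (c * t) * y + \<iota> (c * c * n) = \<iota> c * \<iota> c * (x * x - \<iota> t * x + \<iota> n)"
    unfolding yy by (simp add: iota_mult distrib_left right_diff_distrib)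
  then have y: "y * y - \<iota> (c * t) * y + \<iota> (c * c * n) = 0" using quad by simp
  have "(\<Sum>i\<le>2. \<iota> (?d i) * y ^ i) = \<iota> (c*c*n) - \<iota> (c*t) * y + y * y"
    by (simp add: numeral_2_eq_2 iota_minus)
  also have "\<dots> = 0" using y by (simp add: algebra_simps)
  finally have "(\<Sum>i\<le>2. \<iota> (?d i) * y ^ i) = 0" .
  moreover have "\<forall>i\<le>2. ?d i \<in> val_ring v" using ct ccn by (auto simp: val_ring_ge)
  moreover have "?d 2 = 1" by simp
  moreover have "y \<in> K" using assms by (simp add: y_def K_mult)
  ultimately have "y \<in> R" unfolding integers_of_def
    by (intro CollectI conjI exI[of _ 2] exI[of _ ?d]) auto
  then show ?thesis using c0 y_def by blast
qed

lemma omega_OB: "\<omega> \<in> OB"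
  and OB_eq: "OB = {a + b * \<omega> |a b. a \<in> R \<and> b \<in> R}"
  and omega_sq: "\<omega> * \<omega> = \<iota> \<pi>"
  using cyclic unfolding cyclic_presentation_def by (fast+)

lemma omega_0 [simp]: "\<omega> \<noteq> 0"
  using omega_sq pi by auto

lemma omega_K: assumes "a \<in> K" shows "\<omega> * a = \<sigma> a * \<omega>"
proof -
  obtain c where c: "c \<noteq> 0" "\<iota> c * a \<in> R" using scale_R[OF assms] by blast
  have "\<omega> * (\<iota> c * a) = \<sigma> (\<iota> c * a) * \<omega>"
    using cyclic c unfolding cyclic_presentation_def by fast
  moreover have "\<omega> * (\<iota> c * a) = \<iota> c * (\<omega> * a)"
    using iota_commute[of c \<omega>] by (simp flip: mult.assoc)
  ultimately have "\<iota> c * (\<omega> * a) = \<iota> c * (\<sigma> a * \<omega>)"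
    using assms by (simp add: sigma_mult mult.assoc)
  then show ?thesis using c by simp
qed

text \<open>Conjugation by \<open>\<omega>\<close> induces \<open>\<sigma>\<close> on the
  commutative field \<open>K\<close>, and \<open>\<sigma>\<close> is not the identity.\<close>

lemma omega_notin_K: "\<omega> \<notin> K"
proof
  assume "\<omega> \<in> K"
  then have "\<sigma> a = a" if "a \<in> K" for a
    using omega_K[OF that] K_commute[of \<omega> a] that by simp
  then show False using sigma_nontrivial by blast
qed

lemma K_omega_disjoint: assumes "b \<in> K" "b * \<omega> \<in> K" shows "b = 0"
proof (rule ccontr)
  assume "b \<noteq> 0"
  then have "\<omega> = inverse b * (b * \<omega>)" by (simp flip: mult.assoc)
  then show False using assms omega_notin_K K_mult K_inverse by metis
qed

lemma R_0 [simp]: "0 \<in> R" and R_1 [simp]: "1 \<in> R"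
  using iota_R[of 0] iota_R[of 1] by (simp_all add: val_ring_def)

lemma R_eq_K_OB: "R = K \<inter> OB"
proof (intro equalityI subsetI)
  fix x assume "x \<in> R"
  then show "x \<in> K \<inter> OB" using R_K OB_eq R_0 by force
next
  fix x assume "x \<in> K \<inter> OB"
  then obtain a b where ab: "x \<in> K" "x = a + b * \<omega>" "a \<in> R" "b \<in> R" using OB_eq by auto
  then have "b * \<omega> = x - a" by simp
  then have "b * \<omega> \<in> K" using ab K_diff R_K by metis
  then have "b = 0" using K_omega_disjoint R_K ab by blast
  then show "x \<in> R" using ab by simp
qed

lemma order: "1 \<in> OB" "x \<in> OB \<Longrightarrow> y \<in> OB \<Longrightarrow> x - y \<in> OB" "x \<in> OB \<Longrightarrow> y \<in> OB \<Longrightarrow> x * y \<in> OB"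
  "\<exists>a. a \<noteq> 0 \<and> \<iota> a * x \<in> OB"
  using maximal by (auto simp: maximal_order_def is_order_def)

lemma R_diff: "x \<in> R \<Longrightarrow> y \<in> R \<Longrightarrow> x - y \<in> R" and R_mult: "x \<in> R \<Longrightarrow> y \<in> R \<Longrightarrow> x * y \<in> R"
  using R_eq_K_OB order K_diff K_mult by auto

text \<open>Since \<open>K / F\<close> is unramified, every element of \<open>K\<close> is an element of \<open>F\<close> times a unit.
  This replaces the uniqueness of extensions of valuations.\<close>

lemma K_unit_decomp:
  assumes "x \<in> K" "x \<noteq> 0"
  shows "\<exists>a r. a \<noteq> 0 \<and> r \<in> R \<and> inverse r \<in> R \<and> x = \<iota> a * r"
proof -
  have R: "\<exists>a r. a \<noteq> 0 \<and> r \<in> R \<and> inverse r \<in> R \<and> x = \<iota> a * r" if "x \<in> R" "x \<noteq> 0" for x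
    using that
  proof (induction "nat (ordB x)" arbitrary: x rule: less_induct)
    case less
    show ?case
    proof (cases "inverse x \<in> R")
      case True
      then show ?thesis using less.prems by (intro exI[of _ 1] exI[of _ x]) auto
    next
      case False
      then have "x \<in> {x \<in> R. x = 0 \<or> inverse x \<notin> R}" using less.prems by simp
      then have "x \<in> {\<iota> m * y |m y. m \<in> val_ideal v \<and> y \<in> R}"
        using unramified unfolding unramified_quadratic_subfield_def by blast
      then obtain m y where m: "x = \<iota> m * y" "m \<in> val_ideal v" "y \<in> R" by blast
      have m0: "m \<noteq> 0" using m less.prems by auto
      then have vm: "v m > 0" using m by (auto simp: val_ideal_def)
      \<comment> \<open>As \<open>m\<close> lies in the maximal ideal, \<open>m / \<pi>\<close> is
        still integral. Splitting off a single factor \<open>\<pi>\<close> lowers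
        \<open>ordB\<close> by \<open>ram\<close>, which drives the induction.\<close>
      define z where "z = \<iota> (m / \<pi>) * y"
      have vmp: "v (m / \<pi>) = v m - 1"
        using m0 pi F.val_mult[of m "inverse \<pi>"] F.val_inverse[of \<pi>] by (simp add: divide_inverse)
      have z: "z \<in> R" unfolding z_def using m(3) vm vmp by (intro R_mult iota_R) (auto simp: val_ring_def)
      have xz: "x = \<iota> \<pi> * z" using m pi by (simp add: z_def flip: iota_mult mult.assoc)
      then have z0: "z \<noteq> 0" using less.prems by auto
      have "ordB x = ram + ordB z" using xz z0 pi B.val_mult[of "\<iota> \<pi>" z] ram(2)[of \<pi>] by simp
      moreover have "ordB z \<ge> 0" using R_ge[OF z] z0 by (simp add: val_ge_def)
      ultimately have "nat (ordB z) < nat (ordB x)" using ram(1) by simp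
      from less.hyps[OF this z z0] obtain a r where "a \<noteq> 0" "r \<in> R" "inverse r \<in> R" "z = \<iota> a * r" by blast
      then show ?thesis using xz pi by (intro exI[of _ "\<pi> * a"] exI[of _ r]) (simp add: iota_mult mult.assoc)
    qed
  qed
  obtain c where c: "c \<noteq> 0" "\<iota> c * x \<in> R" using scale_R[OF assms(1)] by blast
  obtain a r where ar: "a \<noteq> 0" "r \<in> R" "inverse r \<in> R" "\<iota> c * x = \<iota> a * r"
    using R[OF c(2)] c assms by auto
  have "x = inverse (\<iota> c) * (\<iota> c * x)" using c by (simp flip: mult.assoc)
  also have "\<dots> = \<iota> (a / c) * r"
    using iota_commute[of a "inverse (\<iota> c)"]
    unfolding ar(4) divide_inverse iota_mult iota_inverse by (simp flip: mult.assoc)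
  finally show ?thesis using ar c by (intro exI[of _ "a / c"] exI[of _ r]) auto
qed

lemma unit_ord: assumes "r \<in> R" "inverse r \<in> R" "r \<noteq> 0" shows "ordB r = 0"
proof -
  have "0 \<le> ordB r" using R_ge[OF assms(1)] assms(3) by (simp add: val_ge_def)
  moreover have "0 \<le> ordB (inverse r)" using R_ge[OF assms(2)] assms(3) by (simp add: val_ge_def)
  ultimately show ?thesis using B.val_inverse[OF assms(3)] by simp
qed

text \<open>All four facts are read off from \<open>K_unit_decomp\<close>: \<open>\<sigma>\<close>
  fixes the scalar and sends units of O_K to units, and the value of the scalar is a multiple of
  \<open>ram\<close>.\<close>

lemma K_ord: assumes "x \<in> K" "x \<noteq> 0"
  shows "ram dvd ordB x" "ordB (\<sigma> x) = ordB x" "\<sigma> x \<noteq> 0" "ordB x \<ge> 0 \<Longrightarrow> x \<in> R"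
proof -
  obtain a r where ar: "a \<noteq> 0" "r \<in> R" "inverse r \<in> R" "x = \<iota> a * r"
    using K_unit_decomp[OF assms] by blast
  have r0: "r \<noteq> 0" using ar assms by auto
  have sr: "\<sigma> r \<in> R" "inverse (\<sigma> r) \<in> R"
    using sigma_R[OF ar(2)] sigma_R[OF ar(3)] unfolding sigma_inverse[OF R_K[OF ar(2)]] .
  have "\<sigma> r * \<sigma> (inverse r) = 1" using r0 ar by (simp flip: sigma_mult add: R_K K_inverse)
  then have sr0: "\<sigma> r \<noteq> 0" by auto
  have o: "ordB x = ram * v a" using ar r0 B.val_mult[of "\<iota> a" r] unit_ord[of r] ram(2) by simp
  then show "ram dvd ordB x" by simp
  have sx: "\<sigma> x = \<iota> a * \<sigma> r" using ar by (simp add: sigma_mult R_K)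
  then show "\<sigma> x \<noteq> 0" using ar sr0 by simp
  show "ordB (\<sigma> x) = ordB x"
    using sx o ar sr0 B.val_mult[of "\<iota> a" "\<sigma> r"] unit_ord[OF sr sr0] ram(2) by simp
  assume "ordB x \<ge> 0"
  then have "a \<in> val_ring v" using o ram(1) ar(1) by (auto simp: val_ring_def zero_le_mult_iff)
  then show "x \<in> R" using ar R_mult iota_R by simp
qed

section \<open>The valuation of \<open>\<omega>\<close>, and the maximal order as valuation
  ring\<close>

lemma B_decomp: "\<exists>a\<in>K. \<exists>b\<in>K. x = a + b * \<omega>"
proof -
  obtain c where c: "c \<noteq> 0" "\<iota> c * x \<in> OB" using order(4) by blast
  then obtain a b where ab: "a \<in> R" "b \<in> R" "\<iota> c * x = a + b * \<omega>" using OB_eq by auto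
  have "x = inverse (\<iota> c) * (\<iota> c * x)" using c by (simp flip: mult.assoc)
  also have "\<dots> = inverse (\<iota> c) * a + inverse (\<iota> c) * b * \<omega>" by (simp add: ab algebra_simps)
  finally show ?thesis using ab R_K K_iota K_mult K_inverse by metis
qed

lemma ord_omega_ram: "2 * ordB \<omega> = ram"
  using B.val_mult[of \<omega> \<omega>] omega_sq ram(2)[of \<pi>] pi by simp

text \<open>Values on \<open>K\<close> are multiples of \<open>ram\<close>, which is twice
  \<open>ordB \<omega>\<close>. Hence \<open>a\<close> and \<open>b * \<omega>\<close> have values
  in different classes modulo \<open>ram\<close> and cannot cancel.\<close>

lemma ge_decomp0:
  assumes "a \<in> K" "b \<in> K" "a + b * \<omega> \<in> val_ge ordB n"
  shows "a \<in> val_ge ordB n \<and> b * \<omega> \<in> val_ge ordB n"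
proof (rule B.add_ge_distinct[OF assms(3)])
  assume a: "a \<noteq> 0" "b * \<omega> \<noteq> 0"
  show "ordB a \<noteq> ordB (b * \<omega>)"
  proof
    assume "ordB a = ordB (b * \<omega>)"
    then have "ordB \<omega> = ordB a - ordB b" using a B.val_mult[of b \<omega>] by auto
    moreover have "ram dvd ordB a - ordB b" using K_ord(1) assms a by (intro dvd_diff) auto
    ultimately have "2 * ordB \<omega> dvd ordB \<omega>" using ord_omega_ram by simp
    moreover have "ordB \<omega> > 0" using ord_omega_ram ram(1) by simp
    ultimately show False using zdvd_not_zless[of "ordB \<omega>" "2 * ordB \<omega>"] zdvd_imp_le by fastforce
  qed
qed

text \<open>An element of value 1 splits as \<open>a + b * \<omega>\<close>, and both terms have
  values divisible by \<open>ordB \<omega>\<close>. If this were at least 2, so would be the value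
  of the sum.\<close>

lemma ord_omega: "ordB \<omega> = 1"
proof -
  obtain x where x: "x \<noteq> 0" "ordB x = 1" using B.normalized unfolding normalized_valuation_def by blast
  obtain a b where ab: "a \<in> K" "b \<in> K" "x = a + b * \<omega>" using B_decomp by blast
  have pos: "ordB \<omega> > 0" using ord_omega_ram ram(1) by simp
  have d: "ordB \<omega> dvd ram" using ord_omega_ram by (metis dvd_triv_right)
  have da: "ordB \<omega> dvd ordB a" if "a \<noteq> 0" using K_ord(1) ab that d dvd_trans by blast
  have db: "ordB \<omega> dvd ordB (b * \<omega>)" if "b \<noteq> 0"
    using B.val_mult[of b \<omega>] K_ord(1)[of b] ab that d dvd_trans[of "ordB \<omega>" ram "ordB b"] by simp
  have ge: "a \<in> val_ge ordB 1 \<and> b * \<omega> \<in> val_ge ordB 1"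
    using ge_decomp0[OF ab(1,2)] x ab by (auto simp: val_ge_def)
  have "ordB \<omega> \<le> 1"
  proof (rule ccontr)
    assume "\<not> ordB \<omega> \<le> 1"
    then have "a \<in> val_ge ordB 2 \<and> b * \<omega> \<in> val_ge ordB 2"
      using ge da db zdvd_imp_le[of "ordB \<omega>" "ordB a"] zdvd_imp_le[of "ordB \<omega>" "ordB (b * \<omega>)"]
      by (cases "a = 0"; cases "b = 0") (auto simp: val_ge_def)
    then have "x \<in> val_ge ordB 2" using ab B.add_ge by auto
    then show False using x by (simp add: val_ge_def)
  qed
  then show ?thesis using pos by simp
qed

lemma ram_2: "ram = 2" using ord_omega_ram ord_omega by simp

text \<open>The nontrivial inclusion uses parity: integrality of \<open>b * \<omega>\<close> only
  gives \<open>ordB b \<ge> -1\<close>, but values on \<open>K\<close> are even.\<close>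

lemma OB_ge: "OB = val_ge ordB 0"
proof (intro equalityI subsetI)
  fix x assume "x \<in> OB"
  then obtain a b where ab: "x = a + b * \<omega>" "a \<in> R" "b \<in> R" using OB_eq by auto
  have "\<omega> \<in> val_ge ordB 0" by (simp add: val_ge_def ord_omega)
  then have "b * \<omega> \<in> val_ge ordB 0" using B.mult_ge[of b 0 \<omega> 0] R_ge ab by simp
  then show "x \<in> val_ge ordB 0" using ab R_ge B.add_ge by auto
next
  fix x assume x: "x \<in> val_ge ordB 0"
  obtain a b where ab: "a \<in> K" "b \<in> K" "x = a + b * \<omega>" using B_decomp by blast
  then have g: "a \<in> val_ge ordB 0" "b * \<omega> \<in> val_ge ordB 0" using ge_decomp0 x by auto
  have "a \<in> R" using g(1) K_ord(4)[of a] ab by (cases "a = 0") (auto simp: val_ge_def)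
  moreover have "b \<in> R"
  proof (cases "b = 0")
    case False
    then have "ordB b \<ge> -1" using g B.val_mult[of b \<omega>] ord_omega by (auto simp: val_ge_def)
    moreover have "even (ordB b)" using K_ord(1)[of b] ab False ram_2 by simp
    ultimately have "ordB b \<ge> 0" by presburger
    then show ?thesis using K_ord(4) ab False by blast
  qed simp
  ultimately show "x \<in> OB" using ab OB_eq by blast
qed


lemma OB_closed: "0 \<in> OB" "1 \<in> OB" "x \<in> OB \<Longrightarrow> y \<in> OB \<Longrightarrow> x + y \<in> OB"
  "x \<in> OB \<Longrightarrow> y \<in> OB \<Longrightarrow> x - y \<in> OB" "x \<in> OB \<Longrightarrow> y \<in> OB \<Longrightarrow> x * y \<in> OB"
  "- x \<in> OB \<longleftrightarrow> x \<in> OB"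
  using B.add_ge[of _ 0] B.diff_ge[of _ 0] B.mult_ge[of _ 0 _ 0] by (auto simp: OB_ge)

lemma P_closed: "0 \<in> P" "x \<in> P \<Longrightarrow> y \<in> P \<Longrightarrow> x + y \<in> P"
  "x \<in> P \<Longrightarrow> y \<in> P \<Longrightarrow> x - y \<in> P" "x \<in> OB \<Longrightarrow> y \<in> P \<Longrightarrow> x * y \<in> P"
  "x \<in> P \<Longrightarrow> y \<in> OB \<Longrightarrow> x * y \<in> P" "- x \<in> P \<longleftrightarrow> x \<in> P" "x \<in> P \<Longrightarrow> x \<in> OB" "\<omega> \<in> P" "1 \<notin> P"
  using B.add_ge[of _ 1] B.diff_ge[of _ 1] B.mult_ge[of _ 0 _ 1] B.mult_ge[of _ 1 _ 0] B.ge_mono[of x 1 0]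
  by (auto simp: OB_ge ord_omega) (auto simp: val_ge_def ord_omega)

lemma unit_inverse: assumes "x \<in> OB" "x \<notin> P" shows "inverse x \<in> OB" "x \<noteq> 0"
  using assms B.val_inverse[of x] by (auto simp: OB_ge val_ge_def)

lemma P_right: assumes "x \<in> P" shows "\<exists>y\<in>OB. x = y * \<omega>"
proof (cases "x = 0")
  case False
  have "ordB (x * inverse \<omega>) = ordB x - 1"
    using False B.val_mult[of x "inverse \<omega>"] B.val_inverse[of \<omega>] ord_omega by simp
  then have "x * inverse \<omega> \<in> OB" using assms by (auto simp: OB_ge val_ge_def)
  moreover have "x = x * inverse \<omega> * \<omega>" by (simp add: mult.assoc)
  ultimately show ?thesis by blast
qed (use OB_closed in \<open>intro bexI[of _ 0], auto\<close>)

lemma omega_conj_OB: assumes "x \<in> OB" shows "\<omega> * x * inverse \<omega> \<in> OB" "inverse \<omega> * x * \<omega> \<in> OB"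
proof -
  have "ordB (\<omega> * x * inverse \<omega>) = ordB x" "ordB (inverse \<omega> * x * \<omega>) = ordB x" if "x \<noteq> 0"
    using that B.val_mult[of "\<omega> * x" "inverse \<omega>"] B.val_mult[of \<omega> x] B.val_inverse[of \<omega>]
      B.val_mult[of "inverse \<omega> * x" \<omega>] B.val_mult[of "inverse \<omega>" x] by simp_all
  then show "\<omega> * x * inverse \<omega> \<in> OB" "inverse \<omega> * x * \<omega> \<in> OB"
    using assms by (cases "x = 0"; simp add: OB_ge val_ge_def)+
qed

lemma sigma_sigma: assumes "a \<in> K" shows "\<sigma> (\<sigma> a) = a"
proof -
  have "\<omega> * \<omega> * a = \<sigma> (\<sigma> a) * (\<omega> * \<omega>)"
    using omega_K[OF assms] omega_K[OF sigma_K[OF assms]] by (simp add: mult.assoc) (simp flip: mult.assoc)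
  also have "\<omega> * \<omega> * a = a * (\<omega> * \<omega>)" unfolding omega_sq by (rule iota_commute)
  finally show ?thesis by simp
qed

subsection \<open>The canonical involution in coordinates\<close>

text \<open>For \<open>x = a * \<omega>\<close> the square lies in \<open>K\<close>, so the equation
  of \<open>x\<close> over F puts \<open>x * \<iota> s\<close> into \<open>K\<close>, where
  \<open>s\<close> is the trace. As \<open>x\<close> lies in \<open>K\<close> times
  \<open>\<omega>\<close>, the trace vanishes.\<close>

lemma bar_K_omega: assumes "a \<in> K" shows "bar (a * \<omega>) = - (a * \<omega>)"
proof (cases "a = 0")
  case False
  define x where "x = a * \<omega>"
  obtain s n where s: "x + bar x = \<iota> s" and n: "x * bar x = \<iota> n"
    using trace_F[of x] norm_F[of x] by auto
  have xx: "x * x = a * \<sigma> a * \<iota> \<pi>"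
  proof -
    have "x * x = a * (\<omega> * a) * \<omega>" by (simp add: x_def mult.assoc)
    also have "\<dots> = a * \<sigma> a * (\<omega> * \<omega>)" by (simp add: omega_K[OF assms] mult.assoc)
    finally show ?thesis by (simp add: omega_sq)
  qed
  have b: "bar x = \<iota> s - x" using s by (metis add_diff_cancel_left')
  have "x * \<iota> s - x * x = \<iota> n" using n unfolding b by (simp add: right_diff_distrib)
  then have "x * \<iota> s = x * x + \<iota> n" by (simp add: algebra_simps)
  moreover have "x * x \<in> K" unfolding xx using assms by (intro K_mult sigma_K) auto
  ultimately have "x * \<iota> s \<in> K" using K_add[of "x * x" "\<iota> n"] by simp
  moreover have "x * \<iota> s = \<iota> s * a * \<omega>" using iota_commute[of s x] by (simp add: x_def mult.assoc)
  ultimately have "\<iota> s * a = 0" using K_omega_disjoint[of "\<iota> s * a"] assms K_mult by simp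
  then have "\<iota> s = 0" using False by simp
  then show ?thesis using b by (simp add: x_def)
qed simp

lemma bar_omega: "bar \<omega> = - \<omega>"
  using bar_K_omega[of 1] by simp

text \<open>Applying \<open>bar\<close> to \<open>a * \<omega>\<close>, which it negates, gives
  \<open>a * \<omega> = \<omega> * bar a\<close>. Moving \<open>\<omega>\<close> to the right turns
  this into \<open>a = \<sigma> (bar a)\<close>.\<close>

lemma bar_K: assumes "a \<in> K" shows "bar a = \<sigma> a"
proof -
  have bK: "bar a \<in> K"
  proof -
    obtain s where s: "a + bar a = \<iota> s" using trace_F[of a] by auto
    have "bar a = \<iota> s - a" using s by (metis add_diff_cancel_left')
    then show ?thesis using assms K_diff by simp
  qed
  have "a * \<omega> = \<omega> * bar a" using bar_K_omega[OF assms] by (simp add: bar_mult bar_omega)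
  also have "\<dots> = \<sigma> (bar a) * \<omega>" using omega_K[OF bK] .
  finally have "a = \<sigma> (bar a)" by simp
  then show ?thesis using sigma_sigma[OF bK] by simp
qed

lemma bar_OB: assumes "x \<in> OB" shows "bar x \<in> OB"
proof -
  obtain a b where ab: "x = a + b * \<omega>" "a \<in> R" "b \<in> R" using assms OB_eq by auto
  then have "bar x = \<sigma> a + (- b) * \<omega>" by (simp add: bar_add bar_K bar_K_omega R_K)
  moreover have "- b \<in> R" using R_diff[of 0 b] ab by simp
  ultimately show ?thesis using ab sigma_R OB_eq by blast
qed

lemma bar_P: assumes "x \<in> P" shows "bar x \<in> P"
proof -
  obtain y where "y \<in> OB" "x = y * \<omega>" using P_right[OF assms] by blast
  then show ?thesis using P_closed bar_OB by (simp add: bar_mult bar_omega)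
qed

text \<open>This is the source of all statements that a plus and a minus element never pair to a
  unit: an integral value in \<open>K\<close> times \<open>\<omega>\<close> already lies in the
  maximal ideal.\<close>

lemma K_omega_P: assumes "b \<in> K" "b * \<omega> \<in> OB" shows "b \<in> R" "b * \<omega> \<in> P"
proof -
  obtain a' b' where ab: "a' \<in> R" "b' \<in> R" "b * \<omega> = a' + b' * \<omega>" using assms OB_eq by auto
  then have "(b - b') * \<omega> = a'" by (simp add: algebra_simps)
  then have "b - b' = 0" using K_omega_disjoint[of "b - b'"] K_diff assms R_K ab by metis
  then show "b \<in> R" using ab by simp
  then show "b * \<omega> \<in> P" using P_closed R_eq_K_OB by auto
qed

section \<open>The residue field of \<open>K\<close> and the action of \<open>\<sigma>\<close> on
  it\<close>

lemma omega_R: "x \<in> R \<Longrightarrow> x \<in> P \<Longrightarrow> \<exists>y\<in>R. x = \<iota> \<pi> * y"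
proof (cases "x = 0")
  case False
  assume x: "x \<in> R" "x \<in> P"
  then have "ordB x \<ge> 1" "even (ordB x)" using False K_ord(1)[of x] R_K ram_2 by (auto simp: val_ge_def)
  then have o: "ordB x \<ge> 2" by presburger
  define y where "y = inverse (\<iota> \<pi>) * x"
  have "ordB y = ordB x - 2" unfolding y_def
    using False pi B.val_mult[of "inverse (\<iota> \<pi>)" x] B.val_inverse[of "\<iota> \<pi>"] ram(2)[of \<pi>] ram_2 by simp
  moreover have "y \<in> K" "y \<noteq> 0" using x R_K False pi by (auto simp: y_def intro!: K_mult K_inverse)
  ultimately have "y \<in> R" using K_ord(4) o by simp
  moreover have "x = \<iota> \<pi> * y" using pi by (simp add: y_def flip: mult.assoc)
  ultimately show ?thesis by blast
qed (auto intro: bexI[of _ 0])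

lemma iota_P: "\<iota> a \<in> P \<longleftrightarrow> a = 0 \<or> v a > 0"
proof (cases "a = 0")
  case False
  then show ?thesis using ram(2)[of a] ram_2 by (auto simp: val_ge_def)
qed (simp add: val_ge_def)

lemma R_sq_P: "x \<in> OB \<Longrightarrow> x ^ n \<in> P \<Longrightarrow> x \<in> P"
proof (cases "x = 0 \<or> n = 0")
  case False
  assume x: "x \<in> OB" "x ^ n \<in> P"
  then have "int n * ordB x \<ge> 1" using False B.val_power[of x n] by (auto simp: val_ge_def)
  moreover have "ordB x \<ge> 0" using x False by (auto simp: OB_ge val_ge_def)
  ultimately have "ordB x \<ge> 1" by (cases "ordB x = 0") auto
  then show ?thesis by (simp add: val_ge_def)
qed (auto simp: val_ge_def)

text \<open>Frobenius is injective on the residue field, hence surjective by the pigeonhole principle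
  applied to the iterated squares of \<open>n\<close>.\<close>

lemma residue_sqrt:
  assumes two: "\<iota> 2 \<in> P" and n: "n \<in> val_ring v"
  shows "\<exists>m \<in> val_ring v. \<iota> (n - m * m) \<in> P"
proof -
  define E where "E = {(x, y). x \<in> val_ring v \<and> y \<in> val_ring v \<and> x - y \<in> val_ideal v}"
  have fin: "finite (val_ring v // E)" using local_field by (simp add: nonarch_local_field_def E_def)
  define s where "s i = n ^ (2 ^ i)" for i :: nat
  have s: "s i \<in> val_ring v" for i using n F.power_ge by (simp add: s_def val_ring_ge)
  have "\<not> inj_on (\<lambda>i. E `` {s i}) (UNIV :: nat set)"
  proof
    assume "inj_on (\<lambda>i. E `` {s i}) (UNIV :: nat set)"
    moreover have "range (\<lambda>i. E `` {s i}) \<subseteq> val_ring v // E" using s by (auto intro: quotientI)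
    ultimately show False using fin finite_imageD finite_subset infinite_UNIV_nat by metis
  qed
  then obtain i j where ij: "i < j" "E `` {s i} = E `` {s j}"
    unfolding inj_on_def by (metis linorder_neqE_nat)
  have "s j \<in> E `` {s j}" using s by (simp add: E_def val_ideal_def)
  then have "(s i, s j) \<in> E" using ij by blast
  then have "s i - s j \<in> val_ideal v" by (simp add: E_def)
  then have d: "\<iota> (s i - s j) \<in> P" by (auto simp: iota_P val_ideal_def)
  \<comment> \<open>Injectivity of Frobenius: modulo \<open>P\<close> the square of
    \<open>x - y\<close> is \<open>x * x - y * y\<close>, because 2 lies in \<open>P\<close>. One
    square root is extracted per induction step.\<close>
  have root: "\<iota> (x - y) \<in> P" if "\<iota> (x ^ (2 ^ i) - y ^ (2 ^ i)) \<in> P" "x \<in> val_ring v" "y \<in> val_ring v" for x y and i :: nat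
    using that
  proof (induction i arbitrary: x y)
    case (Suc i)
    have xy: "x * x \<in> val_ring v" "y * y \<in> val_ring v" "y * (x - y) \<in> val_ring v" "x - y \<in> val_ring v"
      using Suc.prems F.mult_ge[of _ 0 _ 0] F.diff_ge[of _ 0] by (auto simp: val_ring_ge)
    have sq: "x ^ (2 ^ Suc i) = (x * x) ^ (2 ^ i)" for x :: 'f by (simp add: power_mult flip: power2_eq_square)
    have "\<iota> (x * x - y * y) \<in> P"
      using Suc.IH[of "x * x" "y * y"] Suc.prems(1) xy(1,2) unfolding sq by blast
    moreover have "\<iota> 2 * \<iota> (y * (x - y)) \<in> P" using P_closed(5)[OF two] iota_ge xy by (simp add: OB_ge)
    moreover have "(x - y) * (x - y) = (x * x - y * y) - 2 * (y * (x - y))" by (simp add: algebra_simps)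
    then have "\<iota> (x - y) ^ 2 = \<iota> (x * x - y * y) - \<iota> 2 * \<iota> (y * (x - y))"
      by (metis diff_conv_add_uminus iota_add iota_minus iota_mult power2_eq_square)
    ultimately have "\<iota> (x - y) ^ 2 \<in> P" using P_closed(3) by simp
    then show ?case by (rule R_sq_P[rotated]) (use xy iota_ge in \<open>simp add: OB_ge\<close>)
  qed simp
  \<comment> \<open>Cancelling \<open>i\<close> squarings in the coincidence of \<open>s i\<close>
    and \<open>s j\<close> leaves \<open>n\<close> congruent to the iterate with index
    \<open>j - i = Suc k\<close>, which is the square of \<open>s k\<close>.\<close>
  define k where "k = j - i - 1"
  have j: "j = Suc k + i" using ij by (simp add: k_def)
  have sj: "s j = (s (Suc k)) ^ (2 ^ i)" by (simp add: s_def j power_add mult.assoc flip: power_mult)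
  have "s i = n ^ (2 ^ i)" by (simp add: s_def)
  with sj d have "\<iota> (n ^ (2 ^ i) - s (Suc k) ^ (2 ^ i)) \<in> P" by metis
  then have "\<iota> (n - s (Suc k)) \<in> P" using root n s by blast
  moreover have "s (Suc k) = s k * s k" by (simp add: s_def power_mult_distrib power2_eq_square power_mult)
  ultimately show ?thesis using s by (intro bexI[of _ "s k"]) auto
qed

text \<open>If \<open>\<sigma>\<close> acted trivially on the residue field of \<open>K\<close>, then, that field being perfect,
  \<open>O_K = O_F + \<pi> O_K\<close>, so \<open>x - \<sigma> x\<close> would be divisible by all powers of \<open>\<pi>\<close>.\<close>

lemma residue_generator: "\<exists>\<theta>\<in>R. \<theta> - \<sigma> \<theta> \<notin> P"
proof (rule ccontr)
  assume "\<not> ?thesis"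
  then have triv: "x - \<sigma> x \<in> P" if "x \<in> R" for x using that by blast
  have split: "\<exists>m y. y \<in> R \<and> x = \<iota> m + \<iota> \<pi> * y" if x: "x \<in> R" for x
  proof -
    have sx: "\<sigma> x \<in> R" "x \<in> K" "\<sigma> x \<in> K" "x \<in> OB" "\<sigma> x \<in> OB" using x sigma_R R_K R_eq_K_OB by auto
    have "\<exists>m. m \<in> val_ring v \<and> x - \<iota> m \<in> P"
    proof (cases "\<iota> 2 \<in> P")
      case True
      \<comment> \<open>Since \<open>\<sigma> x\<close> is congruent to \<open>x\<close>, the square
        of \<open>x\<close> is congruent to its norm \<open>n\<close>. A square root
        \<open>m\<close> of \<open>n\<close> in the residue field of F is then congruent to
        \<open>x\<close>, because the square of their difference lies in \<open>P\<close>.\<close>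
      obtain n where n: "x * \<sigma> x = \<iota> n" using norm_F[of x] bar_K[OF sx(2)] by auto
      have "\<iota> n \<in> OB" using n OB_closed(5)[OF sx(4,5)] by simp
      then have "n \<in> val_ring v" using iota_ge by (simp add: OB_ge)
      then obtain m where m: "m \<in> val_ring v" "\<iota> (n - m * m) \<in> P" using residue_sqrt[OF True] by blast
      have mO: "\<iota> m \<in> OB" using m iota_ge by (simp add: OB_ge)
      have "x * x - \<iota> n = x * (x - \<sigma> x)" using n by (simp add: right_diff_distrib)
      then have "x * x - \<iota> n \<in> P" using P_closed(4) triv[OF x] sx by simp
      then have 1: "x * x - \<iota> n + \<iota> (n - m * m) \<in> P" using m P_closed(2) by blast
      have 2: "\<iota> 2 * (\<iota> m * (x - \<iota> m)) \<in> P" using True P_closed(5) OB_closed mO sx by simp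
      have "\<iota> 2 = 2" using iota_add[of 1 1] by simp
      then have "(x - \<iota> m) ^ 2 = x * x - \<iota> n + \<iota> (n - m * m) - \<iota> 2 * (\<iota> m * (x - \<iota> m))"
        using iota_add[of "n - m * m" "m * m"] iota_commute[of m x]
        by (simp add: power2_eq_square algebra_simps iota_mult mult_2 mult_2_right)
      then have "(x - \<iota> m) ^ 2 \<in> P" using P_closed(3)[OF 1 2] by simp
      then have "x - \<iota> m \<in> P" by (rule R_sq_P[rotated]) (use sx mO OB_closed in simp)
      then show ?thesis using m by blast
    next
      case False
      obtain t where t: "x + \<sigma> x = \<iota> t" using trace_F[of x] bar_K[OF sx(2)] by auto
      have "\<iota> 2 \<in> OB" using OB_closed(3)[OF OB_closed(2) OB_closed(2)] iota_add[of 1 1] by simp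
      then have i2: "inverse (\<iota> 2) \<in> OB" using unit_inverse(1) False by blast
      \<comment> \<open>With 2 invertible, half of the trace approximates \<open>x\<close>: the
        difference is half of \<open>x - \<sigma> x\<close>.\<close>
      define m where "m = inverse 2 * t"
      have "\<iota> m \<in> OB" unfolding m_def iota_mult iota_inverse t[symmetric]
        by (intro OB_closed(5)[OF i2] OB_closed(3) sx)
      then have "m \<in> val_ring v" using iota_ge by (simp add: OB_ge)
      moreover have "x - \<iota> m = inverse (\<iota> 2) * (x - \<sigma> x)"
      proof -
        have "\<iota> 2 * (x - \<iota> m) = \<iota> 2 * x - \<iota> t"
          using two by (simp add: right_diff_distrib m_def flip: iota_mult mult.assoc)
        also have "\<dots> = x - \<sigma> x" unfolding t[symmetric] using iota_add[of 1 1] by (simp add: mult_2)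
        finally have "\<iota> 2 * (x - \<iota> m) = x - \<sigma> x" .
        then have "inverse (\<iota> 2) * (\<iota> 2 * (x - \<iota> m)) = inverse (\<iota> 2) * (x - \<sigma> x)" by simp
        then show ?thesis using two by (simp flip: mult.assoc)
      qed
      ultimately show ?thesis using P_closed(4) i2 triv[OF x] by auto
    qed
    then obtain m where m: "m \<in> val_ring v" "x - \<iota> m \<in> P" by blast
    then have "x - \<iota> m \<in> R" using x iota_R R_diff by blast
    then obtain y where "y \<in> R" "x - \<iota> m = \<iota> \<pi> * y" using omega_R m by blast
    then show ?thesis by (intro exI[of _ m] exI[of _ y]) (simp add: algebra_simps)
  qed
  \<comment> \<open>Each use of \<open>split\<close> replaces \<open>x\<close> by \<open>y\<close>
    at the gain of a factor \<open>\<pi>\<close>, whose value is 2.\<close>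
  have deep: "x - \<sigma> x \<in> val_ge ordB (2 * int n)" if "x \<in> R" for x n
    using that
  proof (induction n arbitrary: x)
    case 0
    then show ?case using R_ge R_diff sigma_R by simp
  next
    case (Suc n)
    obtain m y where y: "y \<in> R" "x = \<iota> m + \<iota> \<pi> * y" using split Suc by blast
    then have xy: "x - \<sigma> x = \<iota> \<pi> * (y - \<sigma> y)" using R_K by (simp add: sigma_add sigma_mult K_mult right_diff_distrib)
    moreover have "\<iota> \<pi> \<in> val_ge ordB 2" using ram(2)[of \<pi>] pi ram_2 by (simp add: val_ge_def)
    ultimately show ?case using B.mult_ge[of "\<iota> \<pi>" 2 "y - \<sigma> y" "2 * int n"] Suc.IH[OF y(1)]
      unfolding xy by simp
  qed
  have "\<sigma> x = x" if x: "x \<in> R" for x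
  proof (rule ccontr)
    assume "\<sigma> x \<noteq> x"
    then have "2 * int n \<le> ordB (x - \<sigma> x)" for n using deep[OF x, of n] by (simp add: val_ge_def)
    from this[of "nat (ordB (x - \<sigma> x)) + 1"] show False
      by (cases "0 \<le> ordB (x - \<sigma> x)") auto
  qed
  moreover obtain x where x: "x \<in> K" "\<sigma> x \<noteq> x" using sigma_nontrivial by blast
  moreover obtain c where "c \<noteq> 0" "\<iota> c * x \<in> R" using scale_R[OF x(1)] by blast
  ultimately have "\<iota> c * \<sigma> x = \<iota> c * x" using sigma_mult[of "\<iota> c" x] by simp
  then show False using x \<open>c \<noteq> 0\<close> by simp
qed

text \<open>Commuting with an element \<open>t\<close> that \<open>\<sigma>\<close> moves forces the
  component along \<open>\<omega>\<close> to vanish.\<close>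

lemma K_center: assumes "\<And>a. a \<in> R \<Longrightarrow> a * x = x * a" shows "x \<in> K"
proof -
  obtain a b where ab: "a \<in> K" "b \<in> K" "x = a + b * \<omega>" using B_decomp by blast
  obtain t where tR: "t \<in> R" and "t - \<sigma> t \<notin> P" using residue_generator by blast
  then have t: "t \<in> K" "\<sigma> t \<noteq> t" using P_closed(1) R_K by auto
  have "t * b * \<omega> = b * \<omega> * t" using assms[OF tR] ab t K_commute[of t a] by (simp add: algebra_simps)
  also have "\<dots> = b * \<sigma> t * \<omega>" by (simp add: omega_K[OF t(1)] mult.assoc)
  also have "\<dots> = \<sigma> t * b * \<omega>" using K_commute[OF ab(2) sigma_K[OF t(1)]] by simp
  finally have "t * b = \<sigma> t * b" by simp
  then have "b = 0" using t by simp
  then show ?thesis using ab by simp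
qed

text \<open>Dividing by \<open>\<omega>\<close> on the right turns the twisted commutation rule into
  the ordinary one, so \<open>K_center\<close> applies.\<close>

lemma K_omega_twisted: assumes "\<And>a. a \<in> R \<Longrightarrow> a * x = x * \<sigma> a" shows "\<exists>b\<in>K. x = b * \<omega>"
proof -
  have "x * inverse \<omega> \<in> K"
  proof (rule K_center)
    fix a assume aR: "a \<in> R"
    then have a: "a \<in> K" by (rule R_K)
    have "a * (x * inverse \<omega>) = x * (\<sigma> a * inverse \<omega>)" using assms[OF aR] by (simp flip: mult.assoc)
    also have "\<sigma> a * inverse \<omega> = inverse \<omega> * (\<omega> * \<sigma> a) * inverse \<omega>" by (simp flip: mult.assoc)
    also have "\<dots> = inverse \<omega> * a" by (simp add: omega_K sigma_K a sigma_sigma mult.assoc)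
    finally show "a * (x * inverse \<omega>) = x * inverse \<omega> * a" by (simp add: mult.assoc)
  qed
  then show ?thesis by (intro bexI[of _ "x * inverse \<omega>"]) (auto simp: mult.assoc)
qed

text \<open>An integral additive Hilbert 90. The quotient \<open>s\<close> of \<open>d\<close> by
  the unit \<open>\<theta> - \<sigma> \<theta>\<close> is integral, and it is fixed by
  \<open>\<sigma>\<close> because both are negated; hence \<open>b = \<theta> * s\<close> works in
  every residue characteristic.\<close>

lemma skew_solve:
  assumes "d \<in> R" "\<sigma> d = - d"
  shows "\<exists>b\<in>R. b - \<sigma> b = d"
proof -
  obtain \<theta> where th: "\<theta> \<in> R" "\<theta> - \<sigma> \<theta> \<notin> P" using residue_generator by blast
  define \<delta> where "\<delta> = \<theta> - \<sigma> \<theta>"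
  have \<delta>: "\<delta> \<in> R" "\<delta> \<in> K" using th R_diff sigma_R R_K by (auto simp: \<delta>_def)
  have inv: "inverse \<delta> \<in> R" "\<delta> \<noteq> 0"
    using th \<delta> unit_inverse[of \<delta>] R_eq_K_OB K_inverse by (auto simp: \<delta>_def)
  have sd: "\<sigma> \<delta> = - \<delta>" using th R_K by (simp add: \<delta>_def sigma_diff sigma_K sigma_sigma)
  define s where "s = d * inverse \<delta>"
  have s: "s \<in> R" "s \<in> K" using assms inv R_mult R_K by (auto simp: s_def)
  have ss: "\<sigma> s = s" using assms(2) sd R_K[OF assms(1)] \<delta>(2) by (simp add: s_def sigma_mult sigma_inverse K_inverse)
  have "\<theta> * s - \<sigma> (\<theta> * s) = \<delta> * s" using ss s th R_K by (simp add: sigma_mult \<delta>_def left_diff_distrib)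
  also have "\<dots> = d * inverse \<delta> * \<delta>" using K_commute[of \<delta> s] \<delta> s by (simp add: s_def)
  also have "\<dots> = d" using inv by (simp add: mult.assoc)
  finally show ?thesis using th s R_mult by blast
qed

end


section \<open>Bimodules with a skew-hermitian form\<close>

text \<open>\<open>KO\<close>, \<open>KP\<close>, \<open>K1\<close>, \<open>K2\<close> stand for the four indecomposable bilattices. The first
  standard basis vector \<open>z\<close> satisfies \<open>a z = z (conj_kind k a)\<close> for \<open>a\<close> in \<open>scalars k\<close>; for
  \<open>K1\<close> and \<open>K2\<close> the second one is \<open>\<omega> z\<close>.\<close>

datatype kind = KO | KP | K1 | K2

context quat
begin

fun scalars :: "kind \<Rightarrow> 'b set" where
  "scalars KO = OB" | "scalars KP = OB" | "scalars K1 = R" | "scalars K2 = R"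

fun conj_kind :: "kind \<Rightarrow> 'b \<Rightarrow> 'b" where
  "conj_kind KO a = a" | "conj_kind KP a = inverse \<omega> * a * \<omega>"
| "conj_kind K1 a = a" | "conj_kind K2 a = \<sigma> a"

lemma R_OB: "x \<in> R \<Longrightarrow> x \<in> OB" using R_eq_K_OB by blast

lemma scalars_OB: "a \<in> scalars k \<Longrightarrow> a \<in> OB"
  by (cases k) (auto intro: R_OB)

lemma conj_kind_OB: "a \<in> scalars k \<Longrightarrow> conj_kind k a \<in> OB"
  by (cases k) (auto intro: R_OB sigma_R omega_conj_OB)

lemma unit_add_P: "x \<in> OB \<Longrightarrow> x \<notin> P \<Longrightarrow> y \<in> P \<Longrightarrow> x + y \<notin> P"
  using P_closed(3)[of "x + y" y] by auto

end

text \<open>Scalars from all of B act, on a whole type, so that identities for the actions and the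
  form carry no membership conditions. Lattices are the subsets singled out by \<open>sub\<close>
  below.\<close>

locale bimod = quat v \<iota> bar \<sigma> OB K ordB \<pi> \<omega>
  for v :: "'f::field \<Rightarrow> int" and \<iota> :: "'f \<Rightarrow> 'b::division_ring" and bar \<sigma> OB K ordB \<pi> \<omega> +
  fixes ls :: "'b \<Rightarrow> 'v::ab_group_add \<Rightarrow> 'v" and rs :: "'v \<Rightarrow> 'b \<Rightarrow> 'v" and q :: "'v \<Rightarrow> 'v \<Rightarrow> 'b"
  assumes ls_add: "ls a (x + y) = ls a x + ls a y"
    and ls_add_left: "ls (a + b) x = ls a x + ls b x"
    and ls_mult: "ls (a * b) x = ls a (ls b x)"
    and ls_1 [simp]: "ls 1 x = x"
    and rs_add: "rs (x + y) a = rs x a + rs y a"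
    and rs_add_right: "rs x (a + b) = rs x a + rs x b"
    and rs_mult: "rs x (a * b) = rs (rs x a) b"
    and rs_1 [simp]: "rs x 1 = x"
    and ls_rs: "rs (ls a x) b = ls a (rs x b)"
    and ls_iota: "ls (\<iota> c) x = rs x (\<iota> c)"
    and q_add_left: "q (x + y) z = q x z + q y z"
    and q_rs_right: "q x (rs y b) = q x y * b"
    and q_skew: "q y x = - bar (q x y)"
    and q_ls: "q (ls a x) y = q x (ls (bar a) y)"
begin

lemma rs_0 [simp]: "rs 0 a = 0" "rs x 0 = 0" and ls_0 [simp]: "ls a 0 = 0" "ls 0 x = 0"
  using rs_add[of 0 0 a] rs_add_right[of x 0 0] ls_add[of a 0 0] ls_add_left[of 0 0 x] by simp_all

lemma rs_minus: "rs (- x) a = - rs x a" and rs_minus_right: "rs x (- a) = - rs x a"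
  and ls_minus: "ls a (- x) = - ls a x" and ls_minus_left: "ls (- a) x = - ls a x"
  using rs_add[of x "- x" a] rs_add_right[of x a "- a"] ls_add[of a x "- x"] ls_add_left[of a "- a" x]
  by (simp_all add: add_eq_0_iff)

lemma rs_diff: "rs (x - y) a = rs x a - rs y a" and ls_diff: "ls a (x - y) = ls a x - ls a y"
  using rs_add[of x "- y" a] ls_add[of a x "- y"] by (simp_all add: rs_minus ls_minus)

lemma q_add: "q x (y + z) = q x y + q x z"
proof -
  have "q x (y + z) = - bar (q (y + z) x)" by (rule q_skew)
  also have "\<dots> = - bar (q y x) + - bar (q z x)" by (simp add: q_add_left bar_add)
  finally show ?thesis by (simp flip: q_skew)
qed

lemma q_rs: "q (rs x a) y = bar a * q x y"
proof -
  have "q (rs x a) y = - bar (q y (rs x a))" by (rule q_skew)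
  also have "\<dots> = bar a * - bar (q y x)" by (simp add: q_rs_right bar_mult)
  finally show ?thesis by (simp flip: q_skew)
qed

lemma q_0 [simp]: "q 0 x = 0" "q x 0 = 0"
  using q_add_left[of 0 0 x] q_add[of x 0 0] by simp_all

lemma q_minus: "q (- x) y = - q x y" "q x (- y) = - q x y"
  using q_add_left[of x "- x" y] q_add[of x y "- y"] by (simp_all add: add_eq_0_iff)

lemma q_diff: "q (x - y) z = q x z - q y z" "q x (y - z) = q x y - q x z"
  using q_add_left[of x "- y" z] q_add[of x y "- z"] by (simp_all add: q_minus)

lemma q_zero_sym: "q x y = 0 \<longleftrightarrow> q y x = 0"
  by (metis q_skew bar_0 neg_equal_0_iff_equal)

abbreviation "W \<equiv> ls \<omega>"

lemma W_W: "W (W x) = rs x (\<iota> \<pi>)"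
  by (simp add: omega_sq ls_iota flip: ls_mult)

lemma q_W: "q (W x) y = - q x (W y)"
  by (simp add: q_ls bar_omega ls_minus_left q_minus)

definition rel :: "kind \<Rightarrow> 'v \<Rightarrow> bool" where
  "rel k z \<longleftrightarrow> (\<forall>a\<in>scalars k. ls a z = rs z (conj_kind k a))"

definition sub :: "'v set \<Rightarrow> bool" where
  "sub N \<longleftrightarrow> 0 \<in> N \<and> (\<forall>x\<in>N. \<forall>y\<in>N. x + y \<in> N) \<and> (\<forall>x\<in>N. \<forall>a\<in>OB. ls a x \<in> N \<and> rs x a \<in> N)"

lemma sub_0: "sub N \<Longrightarrow> 0 \<in> N" and sub_add: "sub N \<Longrightarrow> x \<in> N \<Longrightarrow> y \<in> N \<Longrightarrow> x + y \<in> N"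
  and sub_ls: "sub N \<Longrightarrow> x \<in> N \<Longrightarrow> a \<in> OB \<Longrightarrow> ls a x \<in> N"
  and sub_rs: "sub N \<Longrightarrow> x \<in> N \<Longrightarrow> a \<in> OB \<Longrightarrow> rs x a \<in> N"
  by (auto simp: sub_def)

lemma sub_minus: "sub N \<Longrightarrow> x \<in> N \<Longrightarrow> - x \<in> N"
  using sub_rs[of N x "-1"] OB_closed(2,6) by (simp add: rs_minus_right)

lemma sub_diff: "sub N \<Longrightarrow> x \<in> N \<Longrightarrow> y \<in> N \<Longrightarrow> x - y \<in> N"
  using sub_add[of N x "- y"] sub_minus by simp

lemma sub_W: "sub N \<Longrightarrow> x \<in> N \<Longrightarrow> W x \<in> N"
  using sub_ls omega_OB by blast

text \<open>One formula serves all kinds. For \<open>K1\<close> and \<open>K2\<close> the vectors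
  \<open>z\<close> and \<open>W z\<close> are the standard basis of the summand; for
  \<open>KO\<close> and \<open>KP\<close> the second term is redundant, since then
  \<open>W z = rs z \<omega>\<close>.\<close>

definition blk :: "'v \<Rightarrow> 'b \<Rightarrow> 'b \<Rightarrow> 'v" where
  "blk z c d = rs z c + rs (W z) d"

definition Blk :: "'v \<Rightarrow> 'v set" where
  "Blk z = {blk z c d |c d. c \<in> OB \<and> d \<in> OB}"

definition Hsp :: "'v \<Rightarrow> 'v \<Rightarrow> 'v set" where
  "Hsp e f = {x + y |x y. x \<in> Blk e \<and> y \<in> Blk f}"

lemma blk_add: "blk z (c + c') (d + d') = blk z c d + blk z c' d'"
  by (simp add: blk_def rs_add_right)

lemma blk_diff_z: "blk (z - h) c d = blk z c d - blk h c d"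
  by (simp add: blk_def rs_diff ls_diff)

lemma blk_minus: "blk z (- c) (- d) = - blk z c d"
  by (simp add: blk_def rs_minus_right)

lemma blk_in: "sub N \<Longrightarrow> z \<in> N \<Longrightarrow> c \<in> OB \<Longrightarrow> d \<in> OB \<Longrightarrow> blk z c d \<in> N"
  by (auto simp: blk_def intro!: sub_add sub_rs sub_W)

lemma Blk_subset: "sub N \<Longrightarrow> z \<in> N \<Longrightarrow> Blk z \<subseteq> N"
  by (auto simp: Blk_def blk_in)

lemma Blk_self: "z \<in> Blk z"
proof -
  have "z = blk z 1 0" by (simp add: blk_def)
  then show ?thesis unfolding Blk_def using OB_closed(1,2) by blast
qed

lemma Blk_add: assumes "x \<in> Blk z" "y \<in> Blk z" shows "x + y \<in> Blk z"
proof -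
  obtain c d c' d' where "x = blk z c d" "y = blk z c' d'" "c \<in> OB" "d \<in> OB" "c' \<in> OB" "d' \<in> OB"
    using assms unfolding Blk_def by blast
  then have "x + y = blk z (c + c') (d + d')" "c + c' \<in> OB" "d + d' \<in> OB"
    using OB_closed(3) by (simp_all add: blk_add)
  then show ?thesis unfolding Blk_def by blast
qed

text \<open>For \<open>K1\<close> and \<open>K2\<close> only O_K acts on \<open>z\<close> through
  the right action. Writing \<open>a = b + d * \<omega>\<close> and moving \<open>\<omega>\<close>
  to the left, \<open>d * \<omega> = \<omega> * \<sigma> d\<close>, expresses \<open>a z\<close>
  through \<open>z\<close> and \<open>W z\<close>.\<close>

lemma rel_ls_Blk: assumes "rel k z" "a \<in> OB" shows "ls a z \<in> Blk z"
proof (cases "k = KO \<or> k = KP")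
  case True
  then have "a \<in> scalars k" using assms by auto
  then have "ls a z = blk z (conj_kind k a) 0" "conj_kind k a \<in> OB"
    using assms by (auto simp: rel_def blk_def conj_kind_OB)
  then show ?thesis unfolding Blk_def using OB_closed(1) by blast
next
  case False
  then have k: "scalars k = R" by (cases k) auto
  obtain b d where bd: "a = b + d * \<omega>" "b \<in> R" "d \<in> R" using assms OB_eq by auto
  have "d * \<omega> = \<omega> * \<sigma> d" using bd R_K by (simp add: omega_K sigma_K sigma_sigma)
  then have "ls a z = ls b z + W (ls (\<sigma> d) z)" by (simp add: bd ls_add_left ls_mult)
  also have "\<dots> = blk z (conj_kind k b) (conj_kind k (\<sigma> d))"
    using assms bd sigma_R k by (simp add: rel_def blk_def ls_rs)
  finally show ?thesis unfolding Blk_def using conj_kind_OB bd sigma_R k by blast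
qed

lemma sub_Blk: assumes "rel k z" shows "sub (Blk z)"
  unfolding sub_def
proof (intro conjI ballI)
  have "0 = blk z 0 0" by (simp add: blk_def)
  then show "0 \<in> Blk z" unfolding Blk_def using OB_closed(1) by blast
next
  fix x y assume "x \<in> Blk z" "y \<in> Blk z"
  then show "x + y \<in> Blk z" by (rule Blk_add)
next
  fix x a assume "x \<in> Blk z" and a: "a \<in> OB"
  then obtain c d where x: "x = blk z c d" "c \<in> OB" "d \<in> OB" by (auto simp: Blk_def)
  show "rs x a \<in> Blk z"
  proof -
    have "rs x a = blk z (c * a) (d * a)" by (simp add: x blk_def rs_add rs_mult)
    then show ?thesis unfolding Blk_def using OB_closed(5) x a by blast
  qed
  have *: "rs u b \<in> Blk z" if u: "u \<in> Blk z" and b: "b \<in> OB" for u b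
  proof -
    obtain c d where u: "u = blk z c d" "c \<in> OB" "d \<in> OB" using u by (auto simp: Blk_def)
    have "rs u b = blk z (c * b) (d * b)" by (simp add: u blk_def rs_add rs_mult)
    then show ?thesis unfolding Blk_def using OB_closed(5) u b by blast
  qed
  have "ls a x = rs (ls a z) c + rs (ls (a * \<omega>) z) d" by (simp add: x blk_def ls_add ls_rs ls_mult)
  moreover have "rs (ls a z) c \<in> Blk z" "rs (ls (a * \<omega>) z) d \<in> Blk z"
    using * rel_ls_Blk[OF assms] a x OB_closed(5) omega_OB by auto
  ultimately show "ls a x \<in> Blk z" using Blk_add by simp
qed

lemma sub_Hsp: assumes "rel k e" "rel l f" shows "sub (Hsp e f)"
proof -
  have s: "sub (Blk e)" "sub (Blk f)" using sub_Blk assms by auto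
  show ?thesis unfolding sub_def
  proof (intro conjI ballI)
    have "0 + 0 \<in> Hsp e f" unfolding Hsp_def using s sub_0 by blast
    then show "0 \<in> Hsp e f" by simp
  next
    fix x y assume "x \<in> Hsp e f" "y \<in> Hsp e f"
    then obtain a b c d where "x = a + b" "y = c + d" "a \<in> Blk e" "c \<in> Blk e" "b \<in> Blk f" "d \<in> Blk f"
      unfolding Hsp_def by blast
    moreover from this have "x + y = (a + c) + (b + d)" by (simp add: algebra_simps)
    ultimately show "x + y \<in> Hsp e f" unfolding Hsp_def using s sub_add by blast
  next
    fix x a assume a: "a \<in> OB" and "x \<in> Hsp e f"
    then obtain c d where x: "x = c + d" "c \<in> Blk e" "d \<in> Blk f" unfolding Hsp_def by blast
    show "ls a x \<in> Hsp e f" unfolding Hsp_def x ls_add using s sub_ls a x by blast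
    show "rs x a \<in> Hsp e f" unfolding Hsp_def x rs_add using s sub_rs a x by blast
  qed
qed

lemma Hsp_self: assumes "rel k e" "rel l f" shows "e \<in> Hsp e f" "f \<in> Hsp e f"
proof -
  have "0 \<in> Blk e" "0 \<in> Blk f" using sub_Blk sub_0 assms by auto
  then have "e + 0 \<in> Hsp e f" "0 + f \<in> Hsp e f" unfolding Hsp_def using Blk_self by blast+
  then show "e \<in> Hsp e f" "f \<in> Hsp e f" by simp_all
qed

lemma Hsp_subset: "sub N \<Longrightarrow> e \<in> N \<Longrightarrow> f \<in> N \<Longrightarrow> Hsp e f \<subseteq> N"
  by (auto simp: Hsp_def intro!: sub_add dest: Blk_subset)

lemma Hsp_eqI:
  assumes "rel k e" "rel l f" "rel k e'" "rel l f'"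
    and "e \<in> Hsp e' f'" "f \<in> Hsp e' f'" "e' \<in> Hsp e f" "f' \<in> Hsp e f"
  shows "Hsp e f = Hsp e' f'"
proof (rule equalityI)
  show "Hsp e f \<subseteq> Hsp e' f'" by (rule Hsp_subset[OF sub_Hsp[OF assms(3,4)] assms(5,6)])
  show "Hsp e' f' \<subseteq> Hsp e f" by (rule Hsp_subset[OF sub_Hsp[OF assms(1,2)] assms(7,8)])
qed

subsection \<open>Values of the form on generators\<close>

text \<open>The plus and minus parts of the bimodule as a module over \<open>K \<otimes> K \<cong> K \<times> K\<close>.\<close>

definition pl :: "'v \<Rightarrow> bool" where "pl x \<longleftrightarrow> rel K1 x"
definition mi :: "'v \<Rightarrow> bool" where "mi x \<longleftrightarrow> rel K2 x"

lemma plD: "pl x \<Longrightarrow> a \<in> R \<Longrightarrow> ls a x = rs x a"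
  and miD: "mi x \<Longrightarrow> a \<in> R \<Longrightarrow> ls a x = rs x (\<sigma> a)"
  by (auto simp: pl_def mi_def rel_def)

lemma plI: "(\<And>a. a \<in> R \<Longrightarrow> ls a x = rs x a) \<Longrightarrow> pl x"
  and miI: "(\<And>a. a \<in> R \<Longrightarrow> ls a x = rs x (\<sigma> a)) \<Longrightarrow> mi x"
  by (auto simp: pl_def mi_def rel_def)

lemma ls_R_W: assumes "a \<in> R" shows "ls a (W x) = W (ls (\<sigma> a) x)"
proof -
  have "a * \<omega> = \<omega> * \<sigma> a" using assms R_K by (simp add: omega_K sigma_K sigma_sigma)
  then show ?thesis by (simp flip: ls_mult)
qed

lemma pl_W: "pl x \<Longrightarrow> mi (W x)" and mi_W: "mi x \<Longrightarrow> pl (W x)"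
  by (auto intro!: plI miI simp: ls_R_W plD miD sigma_R sigma_sigma R_K ls_rs)

lemma pl_add: "pl x \<Longrightarrow> pl y \<Longrightarrow> pl (x + y)" and mi_add: "mi x \<Longrightarrow> mi y \<Longrightarrow> mi (x + y)"
  by (auto intro!: plI miI simp: plD miD ls_add rs_add)

lemma pl_rs: "pl x \<Longrightarrow> b \<in> K \<Longrightarrow> pl (rs x b)" and mi_rs: "mi x \<Longrightarrow> b \<in> K \<Longrightarrow> mi (rs x b)"
  by (auto intro!: plI miI simp: plD miD ls_rs[symmetric] sigma_K R_K K_commute simp flip: rs_mult)

lemma pl_rs_omega: "pl x \<Longrightarrow> b \<in> K \<Longrightarrow> mi (rs x (b * \<omega>))"
proof (rule miI)
  fix a assume *: "pl x" "b \<in> K" "a \<in> R"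
  have "a * (b * \<omega>) = b * (a * \<omega>)" using * R_K K_commute[of a b] by (simp flip: mult.assoc)
  also have "\<dots> = b * \<omega> * \<sigma> a" using * R_K by (simp add: omega_K sigma_K sigma_sigma mult.assoc)
  finally show "ls a (rs x (b * \<omega>)) = rs (rs x (b * \<omega>)) (\<sigma> a)"
    using * by (simp add: plD ls_rs[symmetric] flip: rs_mult)
qed

lemma mi_rs_omega: "mi x \<Longrightarrow> b \<in> K \<Longrightarrow> pl (rs x (b * \<omega>))"
proof (rule plI)
  fix a assume *: "mi x" "b \<in> K" "a \<in> R"
  have "\<sigma> a * (b * \<omega>) = b * (\<sigma> a * \<omega>)" using * R_K sigma_K K_commute[of "\<sigma> a" b] by (simp flip: mult.assoc)
  also have "\<dots> = b * \<omega> * a" using * R_K by (simp add: omega_K mult.assoc)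
  finally show "ls a (rs x (b * \<omega>)) = rs (rs x (b * \<omega>)) a"
    using * by (simp add: miD ls_rs[symmetric] flip: rs_mult)
qed

lemma q_R: assumes "a \<in> R" shows "q x (ls a y) = q (ls (\<sigma> a) x) y"
  using assms by (simp add: q_ls bar_K R_K sigma_K sigma_sigma)

text \<open>Moving a scalar of O_K across the form conjugates it, and pulling it out of the left
  argument conjugates it back. If both vectors lie in the same part, the value therefore commutes
  with O_K; in the mixed cases below it intertwines \<open>a\<close> with
  \<open>\<sigma> a\<close>.\<close>

lemma q_pl_pl: assumes "pl x" "pl y" shows "q x y \<in> K"
proof (rule K_center)
  fix a assume a: "a \<in> R"
  have "q x y * a = q (ls (\<sigma> a) x) y" using a assms by (simp flip: q_R plD q_rs_right)
  then show "a * q x y = q x y * a" using a assms by (simp add: plD sigma_R q_rs bar_K R_K sigma_K sigma_sigma)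
qed

lemma q_mi_mi: assumes "mi x" "mi y" shows "q x y \<in> K"
proof (rule K_center)
  fix a assume a: "a \<in> R"
  have "q x (ls (\<sigma> a) y) = q (ls a x) y" using q_R[of "\<sigma> a"] a by (simp add: sigma_R sigma_sigma R_K)
  then show "a * q x y = q x y * a"
    using a assms by (simp add: miD sigma_R q_rs q_rs_right bar_K R_K sigma_K sigma_sigma)
qed

lemma q_pl_mi: assumes "pl x" "mi y" shows "\<exists>b\<in>K. q x y = b * \<omega>"
proof (rule K_omega_twisted)
  fix a assume a: "a \<in> R"
  show "a * q x y = q x y * \<sigma> a" using q_R[of a x y] a assms
    by (simp add: plD miD sigma_R q_rs q_rs_right bar_K R_K sigma_K sigma_sigma)
qed

lemma q_mi_pl: assumes "mi x" "pl y" shows "\<exists>b\<in>K. q x y = b * \<omega>"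
proof -
  obtain b where "b \<in> K" "q y x = b * \<omega>" using q_pl_mi assms by blast
  moreover have "q x y = - bar (q y x)" by (rule q_skew)
  ultimately have "q x y = b * \<omega>" by (simp add: bar_K_omega)
  then show ?thesis using \<open>b \<in> K\<close> by blast
qed

lemma bar_q_self: "bar (q x x) = - q x x"
  using q_skew[of x x] by (metis minus_minus)

text \<open>Because \<open>W\<close> is skew-adjoint and the form is skew, the value is fixed by
  \<open>bar\<close>. As \<open>x\<close> and \<open>W x\<close> lie in opposite parts it also lies
  in \<open>K\<close> times \<open>\<omega>\<close>, which \<open>bar\<close> negates; the
  characteristic is not 2.\<close>

lemma q_W_self: assumes "pl x \<or> mi x" shows "q x (W x) = 0"
proof -
  obtain b where b: "b \<in> K" "q x (W x) = b * \<omega>" using assms q_pl_mi q_mi_pl pl_W mi_W by blast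
  have "q x (W x) = - bar (q (W x) x)" by (rule q_skew)
  also have "\<dots> = bar (q x (W x))" by (simp add: q_W bar_minus)
  also have "\<dots> = - q x (W x)" using b by (simp add: bar_K_omega)
  finally have "q x (W x) + q x (W x) = 0" by (metis add.right_inverse)
  then show ?thesis using double_eq_0 by blast
qed

lemma rel_KO_pl: "rel KO z \<Longrightarrow> pl z"
  by (auto intro!: plI simp: rel_def R_OB)

lemma rel_KP_mi: assumes "rel KP z" shows "mi z"
proof (rule miI)
  fix a assume a: "a \<in> R"
  have "inverse \<omega> * a * \<omega> = inverse \<omega> * (\<omega> * \<sigma> a)" using a R_K by (simp add: omega_K sigma_K sigma_sigma mult.assoc)
  also have "\<dots> = \<sigma> a" by (simp flip: mult.assoc)
  finally show "ls a z = rs z (\<sigma> a)" using assms a by (simp add: rel_def R_OB)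
qed

lemma rel_KO_W: "rel KO z \<Longrightarrow> W z = rs z \<omega>"
  using omega_OB by (simp add: rel_def)

lemma rel_KP_W: "rel KP z \<Longrightarrow> W z = rs z \<omega>"
  using omega_OB by (simp add: rel_def)

text \<open>Vectors on which the two actions agree pair into the centralizer of O_B. Clearing
  denominators this is the centre of B, which is F.\<close>

lemma q_KO_KO: assumes "rel KO x" "rel KO y" shows "\<exists>c. q x y = \<iota> c"
proof -
  have c: "q x y * a = a * q x y" if "a \<in> OB" for a
  proof -
    have "q x (ls a y) = q (ls (bar a) x) y" by (simp add: q_ls)
    then show ?thesis using assms that bar_OB by (simp add: rel_def q_rs q_rs_right)
  qed
  have "q x y * a = a * q x y" for a
  proof -
    obtain s where s: "s \<noteq> 0" "\<iota> s * a \<in> OB" using order(4) by blast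
    have "\<iota> s * (q x y * a) = \<iota> s * (a * q x y)"
      using c[OF s(2)] iota_commute[of s "q x y"] by (simp flip: mult.assoc)
    then show ?thesis using s by simp
  qed
  then have "q x y \<in> {z. \<forall>x. z * x = x * z}" by blast
  then show ?thesis using quaternion unfolding quaternion_division_algebra_def by blast
qed

text \<open>The value is a scalar, hence fixed by \<open>bar\<close>, while skewness makes
  \<open>bar\<close> negate it.\<close>

lemma q_KO_self: assumes "rel KO x" shows "q x x = 0"
proof -
  obtain c where "q x x = \<iota> c" using q_KO_KO assms by blast
  then have "q x x + q x x = 0" using bar_q_self[of x] by (metis bar_iota add.right_inverse)
  then show ?thesis using double_eq_0 by blast
qed

end


subsection \<open>Hyperbolic planes\<close>

text \<open>\<open>H4\<close>, \<open>H5\<close>, \<open>H6\<close> are the types of the planes M_4,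
  M_5, M_6.\<close>

datatype plane_kind = H4 | H5 | H6

context bimod
begin

text \<open>For \<open>H6\<close> these few values determine the whole Gram matrix C_6 in the basis
  \<open>e\<close>, \<open>W e\<close>, \<open>f\<close>, \<open>W f\<close>, as
  \<open>plane6_gram\<close> shows.\<close>

definition plane :: "plane_kind \<Rightarrow> 'v \<Rightarrow> 'v \<Rightarrow> bool" where
  "plane h e f \<longleftrightarrow> q e e = 0 \<and> q f f = 0 \<and>
     (case h of H4 \<Rightarrow> rel KO e \<and> rel KO f \<and> q e f = 1 | H5 \<Rightarrow> rel KP e \<and> rel KP f \<and> q e f = 1
      | H6 \<Rightarrow> rel K1 e \<and> rel K2 f \<and> q e f = 0 \<and> q e (W f) = 1)"

lemma plane_rel: assumes "plane h e f" obtains k l where "rel k e" "rel l f"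
  using assms by (cases h) (auto simp: plane_def)

lemma sub_plane: "plane h e f \<Longrightarrow> sub (Hsp e f)"
  by (metis plane_rel sub_Hsp)

lemma q_W_W: "q (W x) (W y) = - (q x y * \<iota> \<pi>)"
  by (simp add: q_W W_W q_rs_right)

lemma q_swap_1: "q x y = 1 \<Longrightarrow> q y x = -1" "q x y = -1 \<Longrightarrow> q y x = 1"
  by (metis q_skew bar_1) (metis q_skew bar_1 bar_minus minus_minus)

lemma plane6_gram:
  assumes "plane H6 e f"
  shows "q e e = 0" "q e (W e) = 0" "q e f = 0" "q e (W f) = 1"
    "q (W e) e = 0" "q (W e) (W e) = 0" "q (W e) f = -1" "q (W e) (W f) = 0"
    "q f e = 0" "q f (W e) = 1" "q f f = 0" "q f (W f) = 0"
    "q (W f) e = -1" "q (W f) (W e) = 0" "q (W f) f = 0" "q (W f) (W f) = 0"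
proof -
  have *: "q e e = 0" "q f f = 0" "q e f = 0" "q e (W f) = 1" "pl e" "mi f"
    using assms by (auto simp: plane_def pl_def mi_def)
  have fe: "q f e = 0" using * q_zero_sym by blast
  have W: "q e (W e) = 0" "q f (W f) = 0" using * q_W_self by blast+
  have ef: "q (W e) f = -1" using * by (simp add: q_W)
  have fe': "q f (W e) = 1" using ef q_swap_1 by blast
  show "q e e = 0" "q e (W e) = 0" "q e f = 0" "q e (W f) = 1"
    "q (W e) e = 0" "q (W e) (W e) = 0" "q (W e) f = -1" "q (W e) (W f) = 0"
    "q f e = 0" "q f (W e) = 1" "q f f = 0" "q f (W f) = 0"
    "q (W f) e = -1" "q (W f) (W e) = 0" "q (W f) f = 0" "q (W f) (W f) = 0"
    using * fe W ef fe' by (simp_all add: q_W_W) (simp_all add: q_W)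
qed

lemma Blk_small: assumes W: "W z = rs z \<omega>" shows "Blk z = {rs z c |c. c \<in> OB}"
proof (intro equalityI subsetI)
  fix x assume "x \<in> Blk z"
  then obtain c d where x: "x = blk z c d" "c \<in> OB" "d \<in> OB" by (auto simp: Blk_def)
  have "x = rs z (c + \<omega> * d)" by (simp add: x blk_def W rs_add_right rs_mult)
  then show "x \<in> {rs z c |c. c \<in> OB}" using x OB_closed(3,5) omega_OB by blast
next
  fix x assume "x \<in> {rs z c |c. c \<in> OB}"
  then obtain c where x: "x = rs z c" "c \<in> OB" by blast
  have "x = blk z c 0" by (simp add: x blk_def)
  then show "x \<in> Blk z" unfolding Blk_def using x OB_closed(1) by blast
qed

lemma plane45_Hsp:
  assumes "plane h e f" "h = H4 \<or> h = H5"
  shows "Hsp e f = {rs e c + rs f d |c d. c \<in> OB \<and> d \<in> OB}"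
proof -
  have "W e = rs e \<omega>" "W f = rs f \<omega>" using assms rel_KO_W rel_KP_W by (auto simp: plane_def)
  then show ?thesis unfolding Hsp_def using Blk_small[of e] Blk_small[of f] by auto
qed

lemma Hsp_perp:
  assumes "rel k e" "rel l f" "g \<in> Hsp e f"
    and "q e x = 0" "q f x = 0" "q (W e) x = 0" "q (W f) x = 0"
  shows "q g x = 0"
proof -
  obtain a b c d where "g = blk e a b + blk f c d" using assms(3) by (auto simp: Hsp_def Blk_def)
  then show ?thesis using assms by (simp add: blk_def q_add_left q_rs)
qed

text \<open>The coefficients of the projection come from the inverse Gram matrix.\<close>

lemma plane_proj:
  assumes p: "plane h e f" and int: "\<And>g. g \<in> Hsp e f \<Longrightarrow> q g x \<in> OB"
  shows "\<exists>y\<in>Hsp e f. \<forall>g\<in>Hsp e f. q g (x - y) = 0"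
proof -
  obtain k l where r: "rel k e" "rel l f" using plane_rel p by blast
  have H: "sub (Hsp e f)" "e \<in> Hsp e f" "f \<in> Hsp e f" using sub_Hsp Hsp_self r by auto
  have HW: "W e \<in> Hsp e f" "W f \<in> Hsp e f" using H sub_W by auto
  show ?thesis
  proof (cases "h = H6")
    case True
    note G = plane6_gram[OF p[unfolded True]]
    define y where "y = rs (W e) (q f x) - rs e (q (W f) x) - rs f (q (W e) x) + rs (W f) (q e x)"
    have "y \<in> Hsp e f" unfolding y_def using H HW int by (intro sub_add sub_diff sub_rs) auto
    moreover have "q g (x - y) = 0" if "g \<in> Hsp e f" for g
      by (rule Hsp_perp[OF r that]) (simp_all add: y_def q_add q_diff q_rs_right G)
    ultimately show ?thesis by blast
  next
    case False
    then have h: "h = H4 \<or> h = H5" by (cases h) auto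
    then have G: "q e e = 0" "q f f = 0" "q e f = 1" using p by (auto simp: plane_def)
    then have G': "q f e = -1" using q_swap_1 by blast
    have W: "W e = rs e \<omega>" "W f = rs f \<omega>" using p h rel_KO_W rel_KP_W by (auto simp: plane_def)
    define y where "y = rs f (q e x) - rs e (q f x)"
    have "y \<in> Hsp e f" unfolding y_def using H HW int by (intro sub_add sub_diff sub_rs) auto
    moreover have "q g (x - y) = 0" if "g \<in> Hsp e f" for g
      by (rule Hsp_perp[OF r that]) (simp_all add: y_def q_add q_diff q_rs_right q_rs W G G')
    ultimately show ?thesis by blast
  qed
qed

text \<open>Up to sign, pairing with the basis vectors of the plane reads off the coordinates of
  \<open>x\<close>.\<close>

lemma plane_nondeg:
  assumes p: "plane h e f" and x: "x \<in> Hsp e f" and perp: "\<forall>g\<in>Hsp e f. q g x = 0"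
  shows "x = 0"
proof -
  obtain k l where r: "rel k e" "rel l f" using plane_rel p by blast
  have H: "sub (Hsp e f)" "e \<in> Hsp e f" "f \<in> Hsp e f" using sub_Hsp Hsp_self r by auto
  have z: "q e x = 0" "q f x = 0" "q (W e) x = 0" "q (W f) x = 0" using perp H sub_W by auto
  show ?thesis
  proof (cases "h = H6")
    case True
    note G = plane6_gram[OF p[unfolded True]]
    obtain a b c d where "x = rs e a + rs (W e) b + (rs f c + rs (W f) d)"
      using x by (auto simp: Hsp_def Blk_def blk_def)
    then show ?thesis using z by (simp add: q_add q_rs_right G)
  next
    case False
    then have h: "h = H4 \<or> h = H5" by (cases h) auto
    then have G: "q e e = 0" "q f f = 0" "q e f = 1" using p by (auto simp: plane_def)
    then have G': "q f e = -1" using q_swap_1 by blast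
    obtain c d where "x = rs e c + rs f d" using x plane45_Hsp[OF p h] by auto
    then show ?thesis using z by (simp add: q_add q_rs_right G G')
  qed
qed

section \<open>Normalizing a plus and a minus generator to a hyperbolic plane\<close>

lemma skew_value_R: assumes "pl x \<or> mi x" "q x x \<in> OB"
  shows "q x x \<in> R" "q x x \<in> K" "\<sigma> (q x x) = - q x x"
proof -
  show K: "q x x \<in> K" using assms q_pl_pl q_mi_mi by blast
  then show "q x x \<in> R" using R_eq_K_OB assms by blast
  show "\<sigma> (q x x) = - q x x" using bar_K[OF K] bar_q_self by metis
qed

text \<open>Here \<open>x\<close> changes only within its own block, so spans are preserved.\<close>

lemma normalize_dual:
  assumes x: "pl x" and y: "mi y" and int: "q y x \<in> OB" "q y (W x) \<in> OB" and unit: "q y (W x) \<notin> P"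
  shows "\<exists>x'. pl x' \<and> x' \<in> Blk x \<and> x \<in> Blk x' \<and> q y x' = 0 \<and> q y (W x') = 1"
proof -
  define h where "h = q y (W x)"
  define p where "p = \<iota> \<pi>"
  have pc: "p * u = u * p" for u unfolding p_def by (rule iota_commute)
  have pP: "p \<in> P" unfolding p_def omega_sq[symmetric] using P_closed omega_OB by auto
  obtain c0 where c0: "c0 \<in> K" "q y x = c0 * \<omega>" using q_mi_pl x y by blast
  define c where "c = c0 * \<omega>"
  have cP: "c \<in> P" using K_omega_P c0 int by (simp add: c_def)
  have h: "h \<in> K" "h \<in> OB" "h \<notin> P" using q_mi_mi y pl_W[OF x] int unit by (auto simp: h_def)
  then have hi: "inverse h \<in> OB" "h \<noteq> 0" using unit_inverse by auto
  define g where "g = inverse h * c"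
  have gP: "g \<in> P" using hi cP P_closed by (simp add: g_def)
  have gK: "g = (inverse h * c0) * \<omega>" by (simp add: g_def c_def mult.assoc)
  \<comment> \<open>With \<open>x' = x a + (W x) b\<close> the conditions are
    \<open>c * a + h * b = 0\<close> and \<open>h * a + c * (p * b) = 1\<close>. The first gives
    \<open>b = - (g * a)\<close>, and then the second reads \<open>u * a = 1\<close>;
    \<open>u\<close> is a unit because \<open>p\<close> lies in the maximal ideal.\<close>
  define u where "u = h - p * c * g"
  \<comment> \<open>Both \<open>c\<close> and \<open>g\<close> carry one factor
    \<open>\<omega>\<close>, and the two combine to \<open>\<pi>\<close>. Hence \<open>u\<close> and
    \<open>a\<close> stay in \<open>K\<close>, which keeps \<open>x'\<close> in the plus
    part.\<close>
  have cg: "c * g \<in> K"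
  proof -
    have "c * g = c0 * (\<omega> * (inverse h * c0)) * \<omega>" by (simp add: c_def gK mult.assoc)
    also have "\<omega> * (inverse h * c0) = \<sigma> (inverse h * c0) * \<omega>"
      using h c0 by (intro omega_K) (simp add: K_closed)
    finally have "c * g = c0 * \<sigma> (inverse h * c0) * (\<omega> * \<omega>)" by (simp add: mult.assoc)
    then show ?thesis using h c0 by (simp add: omega_sq K_closed sigma_K)
  qed
  have uK: "u \<in> K" using cg h by (simp add: u_def p_def mult.assoc K_closed)
  have "p * c * g \<in> P" using pP cP gP P_closed by auto
  then have u: "u \<in> OB" "u \<notin> P" using h unit_add_P[of h "- (p * c * g)"] OB_closed(4) P_closed(6,7) by (auto simp: u_def)
  define a where "a = inverse u"
  have a: "a \<in> K" "a \<in> OB" "u * a = 1" "a \<noteq> 0" using uK u unit_inverse[of u] by (auto simp: a_def K_inverse)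
  have aP: "a \<notin> P" using P_closed(4)[of u a] P_closed(9) u a by auto
  define b where "b = - (g * a)"
  have bP: "b \<in> P" using gP a P_closed by (simp add: b_def)
  have bK: "b = (- (inverse h * c0) * \<sigma> a) * \<omega>" using a by (simp add: b_def gK omega_K mult.assoc)
  have bK': "- (inverse h * c0) * \<sigma> a \<in> K" using h c0 a by (simp add: K_closed sigma_K)
  define x' where "x' = blk x a b"
  have xx: "x' = rs x a + rs (W x) b" by (simp add: x'_def blk_def)
  have pl': "pl x'" unfolding xx bK using x a bK' by (intro pl_add pl_rs mi_rs_omega pl_W) auto
  have Wx': "W x' = rs (W x) a + rs x (p * b)"
    by (simp add: xx ls_add p_def rs_mult W_W flip: ls_rs)
  have "q y x' = c * a + h * b" using c0 by (simp add: xx q_add q_rs_right h_def c_def)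
  also have "h * b = - (c * a)" using hi by (simp add: b_def g_def flip: mult.assoc)
  finally have q1: "q y x' = 0" by simp
  have "q y (W x') = h * a + c * (p * b)" using c0 by (simp add: Wx' q_add q_rs_right h_def c_def)
  also have "c * (p * b) = - (p * c * g * a)" using pc[of c] by (simp add: b_def flip: mult.assoc)
  also have "h * a + - (p * c * g * a) = u * a" by (simp add: u_def left_diff_distrib)
  finally have q2: "q y (W x') = 1" using a by simp
  have in1: "x' \<in> Blk x" unfolding Blk_def x'_def using a bP P_closed(7) by blast
  \<comment> \<open>Inverting the change of generator: eliminating \<open>W x\<close> between
    \<open>x'\<close> and \<open>W x'\<close> leaves
    \<open>x t = x' - (W x') (inverse a * b)\<close>, and \<open>t\<close> differs from the unit
    \<open>a\<close> by an element of \<open>P\<close>.\<close>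
  define t where "t = a - p * b * inverse a * b"
  have ai: "inverse a \<in> OB" using unit_inverse a aP by blast
  have "- (p * b * inverse a * b) \<in> P" using pP bP P_closed ai by auto
  then have t: "t \<in> OB" "t \<notin> P" using a aP unit_add_P[of a "- (p * b * inverse a * b)"] OB_closed(4) P_closed(6,7)
    by (auto simp: t_def)
  then have ti: "inverse t \<in> OB" "t * inverse t = 1" using unit_inverse by auto
  have "rs x t = x' - rs (W x') (inverse a * b)"
  proof -
    have "rs (W x') (inverse a * b) = rs (W x) (a * (inverse a * b)) + rs x (p * b * (inverse a * b))"
      by (simp add: Wx' rs_add rs_mult)
    also have "a * (inverse a * b) = b" using a by (simp flip: mult.assoc)
    finally have "x' - rs (W x') (inverse a * b) = rs x a - rs x (p * b * (inverse a * b))" by (simp add: xx)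
    also have "\<dots> = rs x (a + - (p * b * (inverse a * b)))" unfolding rs_add_right rs_minus_right by simp
    finally show ?thesis by (simp add: t_def mult.assoc)
  qed
  then have "rs (rs x t) (inverse t) = blk x' (inverse t) (- (inverse a * b * inverse t))"
    by (simp add: rs_diff blk_def rs_mult rs_minus_right)
  then have "x = blk x' (inverse t) (- (inverse a * b * inverse t))" using ti by (simp flip: rs_mult)
  moreover have "- (inverse a * b * inverse t) \<in> OB" using ai bP P_closed(7) ti OB_closed(5,6) by simp
  ultimately have in2: "x \<in> Blk x'" unfolding Blk_def using ti by blast
  show ?thesis using pl' in1 in2 q1 q2 by blast
qed

text \<open>With \<open>b - \<sigma> b = - q y y\<close>, the contributions of \<open>q x x\<close> to \<open>q y' y'\<close> from the two
  correction terms cancel, so that no quadratic equation has to be solved.\<close>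

lemma normalize_isotropic:
  assumes x: "pl x" and y: "mi y" and dual: "q y x = 0" "q y (W x) = 1"
    and int: "q x x \<in> OB" "q y y \<in> OB"
  shows "\<exists>y'. mi y' \<and> q y' y' = 0 \<and> q y' (W x) \<notin> P \<and> (\<exists>u\<in>Blk x. y' = y + u)"
proof -
  define p where "p = \<iota> \<pi>"
  have pc: "p * u = u * p" for u unfolding p_def by (rule iota_commute)
  have pP: "p \<in> P" unfolding p_def omega_sq[symmetric] using P_closed omega_OB by auto
  define d where "d = q x x"
  have d: "d \<in> R" "d \<in> K" "\<sigma> d = - d" using skew_value_R x int by (auto simp: d_def)
  have d': "- q y y \<in> R" "\<sigma> (- q y y) = - (- q y y)"
    using skew_value_R[of y] y int R_diff[of 0 "q y y"] by (auto simp: sigma_minus)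
  obtain b where b: "b \<in> R" "b - \<sigma> b = - q y y" using skew_solve[OF d'] by blast
  have bK: "b \<in> K" "\<sigma> b \<in> K" using b R_K sigma_K by auto
  have bOB: "b \<in> OB" "\<sigma> b \<in> OB" using R_OB b sigma_R by auto
  \<comment> \<open>Both corrections lie in the minus part. Only the one along \<open>W x\<close>
    has a nonzero product with \<open>y\<close>, so the mixed terms contribute exactly
    \<open>b - \<sigma> b\<close>.\<close>
  define y' where "y' = y + (rs (W x) b + rs x (b * \<omega>))"
  have mi': "mi y'" unfolding y'_def using x y bK by (intro mi_add mi_rs pl_rs_omega pl_W) auto
  have G: "q x (W x) = 0" "q (W x) x = 0" "q (W x) y = -1" "q x y = 0" "q (W x) (W x) = - (d * p)"
    using q_W_self[of x] x q_zero_sym[of "W x" x] q_zero_sym[of x y] dual q_swap_1(1)[of y "W x"]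
    by (auto simp: q_W_W d_def p_def)
  have comm: "\<sigma> b * (d * p) * b = b * (d * (\<sigma> b * p))"
    by (metis K_commute K_mult bK d(2) mult.assoc pc)
  have "bar (b * \<omega>) * d * (b * \<omega>) = - (b * (\<omega> * d) * b * \<omega>)"
    using bK by (simp add: bar_K_omega mult.assoc)
  also have "\<dots> = b * (d * (\<omega> * b) * \<omega>)" using d by (simp add: omega_K mult.assoc)
  also have "\<dots> = b * (d * (\<sigma> b * p))" using bK by (simp add: omega_K p_def omega_sq mult.assoc)
  finally have cancel: "bar (b * \<omega>) * d * (b * \<omega>) = \<sigma> b * (d * p) * b" using comm by simp
  have "q y' y' = q y y + b - \<sigma> b + (bar (b * \<omega>) * d * (b * \<omega>) - \<sigma> b * (d * p) * b)"
    unfolding y'_def using bK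
    by (simp add: q_add q_add_left q_rs q_rs_right G dual bar_K flip: d_def) (simp add: algebra_simps)
  then have q0: "q y' y' = 0" using cancel b by (simp add: algebra_simps)
  \<comment> \<open>Making \<open>y\<close> isotropic spoils the normalization: this value is still
    a unit, but in general no longer 1.\<close>
  have "q y' (W x) = 1 + - (\<sigma> b * (d * p))"
    unfolding y'_def using bK by (simp add: q_add_left q_rs G dual bar_K)
  moreover have "- (\<sigma> b * (d * p)) \<in> P" using bOB pP d R_OB P_closed(4,6) by simp
  ultimately have u: "q y' (W x) \<notin> P" using unit_add_P[of 1] OB_closed(2) P_closed(9) by metis
  have "rs (W x) b + rs x (b * \<omega>) = blk x (b * \<omega>) b" by (simp add: blk_def add.commute)
  moreover have "b * \<omega> \<in> OB" using bOB omega_OB OB_closed(5) by blast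
  ultimately have "rs (W x) b + rs x (b * \<omega>) \<in> Blk x" unfolding Blk_def using bOB by blast
  then show ?thesis using mi' q0 u y'_def by blast
qed

text \<open>Once \<open>y\<close> is isotropic, so is its whole block. Adding a multiple of
  \<open>W y\<close> to \<open>x\<close> then changes \<open>q x x\<close> by
  \<open>b - \<sigma> b\<close> and leaves the pairings of \<open>x\<close> with \<open>y\<close>
  and \<open>W y\<close> untouched.\<close>

lemma normalize_plane:
  assumes x: "pl x" and y: "mi y" and dual: "q y x = 0" "q y (W x) = 1" and y0: "q y y = 0"
    and int: "q x x \<in> OB"
  shows "\<exists>x'. plane H6 x' y \<and> (\<exists>u\<in>Blk y. x' = x + u)"
proof -
  define d where "d = q x x"
  have d: "d \<in> R" "d \<in> K" "\<sigma> d = - d" using skew_value_R x int by (auto simp: d_def)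
  then have d': "- d \<in> R" "\<sigma> (- d) = - (- d)" using R_diff[of 0 d] by (auto simp: sigma_minus)
  obtain b where b: "b \<in> R" "b - \<sigma> b = - d" using skew_solve[OF d'] by blast
  have bK: "b \<in> K" using b R_K by auto
  define x' where "x' = x + rs (W y) b"
  have pl': "pl x'" unfolding x'_def using x y bK by (intro pl_add pl_rs mi_W) auto
  have G: "q x y = 0" "q y (W y) = 0" "q (W y) y = 0" "q (W y) (W y) = 0"
    using q_W_self[of y] y dual y0 q_zero_sym[of "W y" y] q_zero_sym[of x y] by (auto simp: q_W_W)
  have 1: "q (W y) x = -1" using dual by (simp add: q_W)
  then have 2: "q x (W y) = 1" using q_swap_1 by blast
  have Wx': "W x' = W x + rs y (\<iota> \<pi> * b)" by (simp add: x'_def ls_add rs_mult W_W flip: ls_rs)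
  have "q x' x' = d + (b - \<sigma> b)"
    unfolding x'_def using bK by (simp add: q_add q_add_left q_rs q_rs_right G 1 2 bar_K d_def)
  then have "q x' x' = 0" using b by simp
  moreover have "q x' y = 0" unfolding x'_def by (simp add: q_add_left q_rs G)
  moreover have "q x' (W y) = 1" unfolding x'_def by (simp add: q_add_left q_rs G 2)
  ultimately have "plane H6 x' y" using pl' y y0 by (simp add: plane_def pl_def mi_def)
  moreover have "rs (W y) b = blk y 0 b" by (simp add: blk_def)
  then have "rs (W y) b \<in> Blk y" unfolding Blk_def using b R_OB OB_closed(1) by blast
  ultimately show ?thesis using x'_def by blast
qed

text \<open>Every correction adds a vector from one of the two blocks or changes a generator inside
  its own block, and each is reversible; so the span of the pair never changes.\<close>

lemma plane6_exists:
  assumes N: "sub N" and int: "\<And>g h. g \<in> N \<Longrightarrow> h \<in> N \<Longrightarrow> q g h \<in> OB"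
    and x: "pl x" "x \<in> N" and y: "mi y" "y \<in> N" and unit: "q y (W x) \<notin> P"
  shows "\<exists>e f. plane H6 e f \<and> Hsp e f = Hsp x y"
proof -
  note rel = pl_def[THEN iffD1] mi_def[THEN iffD1]
  have Hin: "u + w \<in> Hsp a b" if "u \<in> Blk a" "w \<in> Blk b" for u w a b
    using that unfolding Hsp_def by blast
  have B0: "0 \<in> Blk a" if "pl a \<or> mi a" for a using that sub_0 sub_Blk by (auto simp: pl_def mi_def)
  have step1: "\<exists>x'. pl x' \<and> x' \<in> N \<and> q b x' = 0 \<and> q b (W x') = 1 \<and> Hsp x' b = Hsp a b"
    if a: "pl a" "a \<in> N" and b: "mi b" "b \<in> N" and u: "q b (W a) \<notin> P" for a b
  proof -
    obtain a' where a': "pl a'" "a' \<in> Blk a" "a \<in> Blk a'" "q b a' = 0" "q b (W a') = 1"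
      using normalize_dual[OF a(1) b(1) int int u] a b sub_W N by blast
    have "a' \<in> N" using a' Blk_subset[OF N a(2)] by blast
    moreover have "Hsp a' b = Hsp a b"
      using a' a b Hin[OF a'(2) B0[of b]] Hin[OF a'(3) B0[of b]] Hsp_self
      by (intro Hsp_eqI[of K1 a' K2 b a b]) (auto simp: pl_def mi_def)
    ultimately show ?thesis using a' by blast
  qed
  obtain x1 where x1: "pl x1" "x1 \<in> N" "q y x1 = 0" "q y (W x1) = 1" "Hsp x1 y = Hsp x y"
    using step1[OF x y unit] by blast
  obtain y1 u where y1: "mi y1" "q y1 y1 = 0" "q y1 (W x1) \<notin> P" "u \<in> Blk x1" "y1 = y + u"
    using normalize_isotropic[OF x1(1) y(1) x1(3,4)] int x1 y by blast
  have y1N: "y1 \<in> N" using y1 y N Blk_subset[OF N x1(2)] sub_add by blast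
  have "y = y1 + - u" using y1 by simp
  moreover have "- u \<in> Blk x1" using sub_minus[OF sub_Blk] y1 x1 pl_def by blast
  ultimately have "y \<in> Hsp x1 y1" using Hin[of "- u" x1 y1 y1] Blk_self by (simp add: add.commute)
  moreover have "y1 \<in> Hsp x1 y" using Hin[of u x1 y y] Blk_self y1 by (simp add: add.commute)
  ultimately have H1: "Hsp x1 y1 = Hsp x1 y"
    using x1 y1 y Hsp_self by (intro Hsp_eqI[of K1 x1 K2 y1 x1 y]) (auto simp: pl_def mi_def)
  \<comment> \<open>The second dualization repairs the pairing against the corrected
    \<open>y1\<close>. It only alters the plus generator, so \<open>y1\<close> remains
    isotropic.\<close>
  obtain x2 where x2: "pl x2" "x2 \<in> N" "q y1 x2 = 0" "q y1 (W x2) = 1" "Hsp x2 y1 = Hsp x1 y1"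
    using step1[OF x1(1,2) y1(1) y1N y1(3)] by blast
  obtain x3 w where x3: "plane H6 x3 y1" "w \<in> Blk y1" "x3 = x2 + w"
    using normalize_plane[OF x2(1) y1(1) x2(3,4) y1(2)] int x2 by blast
  have pl3: "pl x3" using x3 by (simp add: plane_def pl_def)
  have "x2 = x3 + - w" using x3 by simp
  moreover have "- w \<in> Blk y1" using sub_minus[OF sub_Blk] y1 x3 mi_def by blast
  ultimately have "x2 \<in> Hsp x3 y1" using Hin[of x3 x3 "- w" y1] Blk_self by metis
  moreover have "x3 \<in> Hsp x2 y1" using Hin[of x2 x2 w y1] Blk_self x3 by metis
  ultimately have "Hsp x3 y1 = Hsp x2 y1"
    using x2 y1 pl3 Hsp_self by (intro Hsp_eqI[of K1 x3 K2 y1 x2 y1]) (auto simp: pl_def mi_def)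
  then show ?thesis using x3 x2 H1 x1 by metis
qed

text \<open>The value is a scalar, so \<open>y\<close> is rescaled by a central unit and stays of
  kind \<open>KO\<close>. Isotropy comes for free from \<open>q_KO_self\<close>.\<close>

lemma plane4_exists:
  assumes x: "rel KO x" and y: "rel KO y" and int: "q x y \<in> OB" and unit: "q x y \<notin> P"
  shows "\<exists>e f. plane H4 e f \<and> Hsp e f = Hsp x y"
proof -
  obtain c where c: "q x y = \<iota> c" using q_KO_KO x y by blast
  have c0: "c \<noteq> 0" using unit c P_closed(1) by auto
  define s where "s = inverse (\<iota> c)"
  have s: "s \<in> OB" "\<iota> c * s = 1" "\<iota> c \<in> OB" using unit_inverse[of "q x y"] int unit c c0 by (auto simp: s_def)
  have sc: "s * a = a * s" for a unfolding s_def iota_inverse[symmetric] by (rule iota_commute)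
  define f where "f = rs y s"
  have f: "rel KO f" unfolding rel_def f_def
  proof
    fix a assume "a \<in> scalars KO"
    then have "ls a (rs y s) = rs (rs y a) s" using y by (simp add: rel_def flip: ls_rs)
    then show "ls a (rs y s) = rs (rs y s) (conj_kind KO a)" by (simp add: sc flip: rs_mult)
  qed
  have "q x f = 1" using c s by (simp add: f_def q_rs_right)
  then have "plane H4 x f" using x f q_KO_self by (simp add: plane_def)
  moreover have "Hsp x f = Hsp x y"
  proof (rule Hsp_eqI[OF x f x y])
    have B0: "0 \<in> Blk x" using sub_0 sub_Blk x by blast
    have "f = 0 + blk y s 0" "y = 0 + blk f (\<iota> c) 0"
      using s sc[of "\<iota> c"] by (simp_all add: f_def blk_def flip: rs_mult)
    then show "f \<in> Hsp x y" "y \<in> Hsp x f" unfolding Hsp_def Blk_def[of y] Blk_def[of f]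
      using B0 s OB_closed(1) by blast+
    show "x \<in> Hsp x y" "x \<in> Hsp x f" using Hsp_self x y f by blast+
  qed
  ultimately show ?thesis by blast
qed

end


section \<open>Decomposition into hyperbolic planes\<close>

lemma card_filter_remove2:
  assumes "finite I" "i \<in> I" "j \<in> I" "i \<noteq> j"
  shows "card {x \<in> I. p x} = card {x \<in> I - {i, j}. p x} + of_bool (p i) + of_bool (p j)"
proof -
  have "{x \<in> I. p x} = {x \<in> I - {i, j}. p x} \<union> ({x \<in> {i}. p x} \<union> {x \<in> {j}. p x})"
    using assms by auto
  also have "card \<dots> = card {x \<in> I - {i, j}. p x} + (card {x \<in> {i}. p x} + card {x \<in> {j}. p x})"
    using assms by (subst card_Un_disjoint, auto)+
  also have "{x \<in> {i}. p x} = (if p i then {i} else {})" by auto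
  also have "{x \<in> {j}. p x} = (if p j then {j} else {})" by auto
  finally show ?thesis by (cases "p i"; cases "p j") auto
qed

fun swap :: "kind \<Rightarrow> kind" where
  "swap KO = KP" | "swap KP = KO" | "swap K1 = K2" | "swap K2 = K1"

context bimod
begin

definition sumset :: "'v set \<Rightarrow> 'v set \<Rightarrow> 'v set" where
  "sumset A B = {x + y |x y. x \<in> A \<and> y \<in> B}"

lemma sumset_commute: "sumset A B = sumset B A"
  unfolding sumset_def by (intro Collect_cong) (metis add.commute)

lemma sumset_assoc: "sumset A (sumset B C) = sumset (sumset A B) C"
proof (intro equalityI subsetI)
  fix x assume "x \<in> sumset A (sumset B C)"
  then obtain a b c where "x = (a + b) + c" "a \<in> A" "b \<in> B" "c \<in> C"
    unfolding sumset_def by (auto simp: add.assoc)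
  then show "x \<in> sumset (sumset A B) C" unfolding sumset_def by blast
next
  fix x assume "x \<in> sumset (sumset A B) C"
  then obtain a b c where "x = a + (b + c)" "a \<in> A" "b \<in> B" "c \<in> C"
    unfolding sumset_def by (auto simp: add.assoc)
  then show "x \<in> sumset A (sumset B C)" unfolding sumset_def by blast
qed

section \<open>Generating systems, self-duality, and orthogonal complements of planes\<close>

definition span :: "'i set \<Rightarrow> ('i \<Rightarrow> 'v) \<Rightarrow> 'v set" where
  "span I z = {(\<Sum>i\<in>I. blk (z i) (c i) (d i)) |c d. \<forall>i\<in>I. c i \<in> OB \<and> d i \<in> OB}"

text \<open>Only independence modulo \<open>\<omega>\<close> is recorded: it is what survives orthogonal projection most easily.\<close>

definition frame :: "'v set \<Rightarrow> 'i set \<Rightarrow> ('i \<Rightarrow> kind) \<Rightarrow> ('i \<Rightarrow> 'v) \<Rightarrow> bool" where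
  "frame N I k z \<longleftrightarrow> sub N \<and> finite I \<and> (\<forall>i\<in>I. rel (k i) (z i)) \<and> N = span I z \<and>
     (\<forall>c d y. (\<forall>i\<in>I. c i \<in> OB \<and> d i \<in> OB) \<longrightarrow> y \<in> N \<longrightarrow>
        (\<Sum>i\<in>I. blk (z i) (c i) (d i)) = rs y \<omega> \<longrightarrow>
        (\<forall>i\<in>I. c i \<in> P \<and> (k i \<in> {K1, K2} \<longrightarrow> d i \<in> P)))"

text \<open>The second clause is self-duality in steps of \<open>\<omega>\<close>: if
  \<open>x\<close> pairs into the maximal ideal, then \<open>rs x (inverse \<omega>)\<close> pairs
  into O_B and therefore has to belong to the lattice.\<close>

definition perf :: "'v set \<Rightarrow> bool" where
  "perf N \<longleftrightarrow> (\<forall>x\<in>N. \<forall>y\<in>N. q x y \<in> OB) \<and>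
     (\<forall>x\<in>N. (\<forall>y\<in>N. q x y \<in> P) \<longrightarrow> (\<exists>y\<in>N. x = rs y \<omega>))"

lemma frame_sub: "frame N I k z \<Longrightarrow> sub N"
  and frame_finite: "frame N I k z \<Longrightarrow> finite I"
  and frame_rel: "frame N I k z \<Longrightarrow> i \<in> I \<Longrightarrow> rel (k i) (z i)"
  and frame_span: "frame N I k z \<Longrightarrow> N = span I z"
  unfolding frame_def by blast+

lemma frame_indep:
  assumes "frame N I k z" "\<And>i. i \<in> I \<Longrightarrow> c i \<in> OB" "\<And>i. i \<in> I \<Longrightarrow> d i \<in> OB" "y \<in> N"
    and "(\<Sum>i\<in>I. blk (z i) (c i) (d i)) = rs y \<omega>" "i \<in> I"
  shows "c i \<in> P" "k i \<in> {K1, K2} \<Longrightarrow> d i \<in> P"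
  using assms unfolding frame_def by blast+

lemma sub_sum: "sub N \<Longrightarrow> (\<And>i. i \<in> I \<Longrightarrow> f i \<in> N) \<Longrightarrow> sum f I \<in> N"
  by (induction I rule: infinite_finite_induct) (auto intro: sub_0 sub_add)

lemma span_subset: "sub N \<Longrightarrow> (\<And>i. i \<in> I \<Longrightarrow> z i \<in> N) \<Longrightarrow> span I z \<subseteq> N"
  by (auto simp: span_def intro!: sub_sum blk_in)

lemma blk_0: "blk z 0 0 = 0" by (simp add: blk_def)

lemma sum_blk_single:
  assumes "finite I" "i \<in> I"
  shows "(\<Sum>j\<in>I. blk (z j) (if j = i then a else 0) (if j = i then b else 0)) = blk (z i) a b"
proof -
  have "(\<Sum>j\<in>I. blk (z j) (if j = i then a else 0) (if j = i then b else 0)) =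
      (\<Sum>j\<in>I. if j = i then blk (z i) a b else 0)"
    by (intro sum.cong) (auto simp: blk_0)
  then show ?thesis using assms by simp
qed

lemma blk_span: assumes "finite I" "i \<in> I" "a \<in> OB" "b \<in> OB" shows "blk (z i) a b \<in> span I z"
  unfolding span_def using sum_blk_single[OF assms(1,2), of z a b, symmetric] assms(3,4) OB_closed(1)
  by (intro CollectI exI[of _ "\<lambda>j. if j = i then a else 0"] exI[of _ "\<lambda>j. if j = i then b else 0"]) auto

lemma frame_gen: assumes "frame N I k z" "i \<in> I" shows "z i \<in> N"
proof -
  have "blk (z i) 1 0 \<in> span I z" using assms OB_closed(1,2) by (intro blk_span) (auto dest: frame_finite)
  then show ?thesis using frame_span[OF assms(1)] by (simp add: blk_def)
qed

lemma q_sum_right: "q x (sum f I) = (\<Sum>i\<in>I. q x (f i))"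
  by (induction I rule: infinite_finite_induct) (auto simp: q_add)

lemma frame_perp_P:
  assumes "frame N I k z" "\<And>i. i \<in> I \<Longrightarrow> q x (z i) \<in> P" "\<And>i. i \<in> I \<Longrightarrow> q x (W (z i)) \<in> P" "y \<in> N"
  shows "q x y \<in> P"
proof -
  obtain c d where y: "y = (\<Sum>i\<in>I. blk (z i) (c i) (d i))" and cd: "\<forall>i\<in>I. c i \<in> OB \<and> d i \<in> OB"
    using frame_span[OF assms(1)] assms(4) unfolding span_def by auto
  have "q x (blk (z i) (c i) (d i)) \<in> P" if "i \<in> I" for i
    using assms(2,3) cd that P_closed(2,5) by (simp add: blk_def q_add q_rs_right)
  then show ?thesis unfolding y q_sum_right by (rule B.sum_ge)
qed

lemma frame_single:
  assumes F: "frame N I k z" and i: "i \<in> I" and y: "y \<in> N" and ab: "a \<in> OB" "b \<in> OB"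
    and eq: "blk (z i) a b = rs y \<omega>"
  shows "a \<in> P" "k i \<in> {K1, K2} \<Longrightarrow> b \<in> P"
proof -
  let ?c = "\<lambda>j. if j = i then a else 0" and ?d = "\<lambda>j. if j = i then b else 0"
  have cd: "\<And>j. ?c j \<in> OB" "\<And>j. ?d j \<in> OB" using ab OB_closed(1) by auto
  have sum: "(\<Sum>j\<in>I. blk (z j) (?c j) (?d j)) = rs y \<omega>"
    using sum_blk_single[OF frame_finite[OF F] i] eq by simp
  note ind = frame_indep[OF F, of ?c ?d, OF cd y sum i]
  show "a \<in> P" using ind(1) by simp
  show "b \<in> P" if "k i \<in> {K1, K2}" using ind(2)[OF that] by simp
qed

text \<open>Supplies the contradictions below: a generator without a partner would be divisible by
  \<open>\<omega>\<close> by self-duality.\<close>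

lemma frame_not_omega: assumes F: "frame N I k z" and i: "i \<in> I" and y: "y \<in> N"
  shows "z i \<noteq> rs y \<omega>" "k i \<in> {K1, K2} \<Longrightarrow> W (z i) \<noteq> rs y \<omega>"
  using frame_single[OF F i y, of 1 0] frame_single[OF F i y, of 0 1] OB_closed(1,2) P_closed(9)
  by (auto simp: blk_def)

lemma Hsp_blkI:
  "a \<in> OB \<Longrightarrow> b \<in> OB \<Longrightarrow> c \<in> OB \<Longrightarrow> d \<in> OB \<Longrightarrow> blk e a b + blk f c d \<in> Hsp e f"
  unfolding Hsp_def Blk_def by blast

lemma Hsp_blkE:
  assumes "g \<in> Hsp e f"
  obtains a b c d where "g = blk e a b + blk f c d" "a \<in> OB" "b \<in> OB" "c \<in> OB" "d \<in> OB"
  using assms unfolding Hsp_def Blk_def by blast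

text \<open>The frame of the orthogonal complement consists of the projections of the remaining
  generators. These have the same type as before, since the projection is a bimodule map.\<close>

lemma frame_split:
  fixes z :: "'i \<Rightarrow> 'v"
  assumes F: "frame N I k z" and pf: "perf N" and ij: "i \<in> I" "j \<in> I" "i \<noteq> j"
    and p: "plane h e f" and H: "Hsp e f = Hsp (z i) (z j)"
  defines "N' \<equiv> {x \<in> N. \<forall>g\<in>Hsp e f. q g x = 0}"
  shows "\<exists>z'. frame N' (I - {i, j}) k z'" "perf N'" "N = sumset (Hsp e f) N'" "sub N'"
proof -
  let ?H = "Hsp e f" and ?J = "I - {i, j}"
  note sN = frame_sub[OF F] and fin = frame_finite[OF F]
  have sH: "sub ?H" by (rule sub_plane[OF p])
  have HN: "?H \<subseteq> N" unfolding H using frame_gen[OF F] ij sN Hsp_subset by blast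
  have int: "q x y \<in> OB" if "x \<in> N" "y \<in> N" for x y using pf that unfolding perf_def by blast
  have "\<exists>y\<in>?H. \<forall>g\<in>?H. q g (x - y) = 0" if "x \<in> N" for x
    using plane_proj[OF p] int HN that by blast
  \<comment> \<open>\<open>pr\<close> is a mere choice of projections. Its compatibility with the
    actions is recovered from \<open>triv\<close>, which says that \<open>?H\<close> and
    \<open>N'\<close> meet only in 0.\<close>
  then obtain pr where pr: "\<And>x. x \<in> N \<Longrightarrow> pr x \<in> ?H" "\<And>x g. x \<in> N \<Longrightarrow> g \<in> ?H \<Longrightarrow> q g (x - pr x) = 0"
    by metis
  show sN': "sub N'"
    unfolding sub_def N'_def using sub_0[OF sN] sub_add[OF sN] sub_ls[OF sN] sub_rs[OF sN] sub_ls[OF sH] bar_OB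
    by (auto simp: q_add q_rs_right) (metis q_ls bar_bar)
  have dec: "x - pr x \<in> N'" if "x \<in> N" for x
    unfolding N'_def using pr(2)[OF that] sub_diff[OF sN that subsetD[OF HN pr(1)[OF that]]] by blast
  have triv: "x = 0" if "x \<in> ?H" "x \<in> N'" for x
    using plane_nondeg[OF p that(1)] that(2) unfolding N'_def by blast
  show sum: "N = sumset ?H N'"
  proof (intro equalityI subsetI)
    fix x assume "x \<in> N"
    then show "x \<in> sumset ?H N'" unfolding sumset_def using pr(1) dec
      by (intro CollectI exI[of _ "pr x"] exI[of _ "x - pr x"]) auto
  next
    fix x assume "x \<in> sumset ?H N'"
    then show "x \<in> N" unfolding sumset_def using HN sub_add[OF sN] by (auto simp: N'_def)
  qed
  show "perf N'"
    unfolding perf_def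
  proof (intro conjI ballI impI)
    fix x assume x: "x \<in> N'" and xP: "\<forall>y\<in>N'. q x y \<in> P"
    \<comment> \<open>As \<open>x\<close> is orthogonal to the plane, only the component of
      \<open>y\<close> in the complement contributes, so \<open>x\<close> pairs into
      \<open>P\<close> with all of \<open>N\<close> and the hypothesis on \<open>N\<close>
      applies.\<close>
    have "q x y \<in> P" if "y \<in> N" for y
    proof -
      have "q (pr y) x = 0" using pr(1) that x unfolding N'_def by blast
      then have "q x (pr y) = 0" by (rule q_zero_sym[THEN iffD1])
      then have "q x y = q x (y - pr y)" by (simp add: q_diff)
      then show ?thesis using xP dec that by simp
    qed
    then obtain y where y: "y \<in> N" "x = rs y \<omega>" using pf x unfolding perf_def N'_def by blast
    have "q g y = 0" if "g \<in> ?H" for g using x that y by (simp add: N'_def q_rs_right)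
    then show "\<exists>y\<in>N'. x = rs y \<omega>" using y unfolding N'_def by blast
  qed (use int in \<open>auto simp: N'_def\<close>)
  define z' where "z' a = z a - pr (z a)" for a
  have zN: "z a \<in> N" if "a \<in> I" for a using frame_gen[OF F that] .
  have z'N: "z' a \<in> N'" if "a \<in> I" for a unfolding z'_def using dec zN that by blast
  \<comment> \<open>The failure of the relation for \<open>z' a\<close> lies in \<open>N'\<close>,
    and by the relation for \<open>z a\<close> it also lies in the plane; hence it vanishes.\<close>
  have rel': "rel (k a) (z' a)" if a: "a \<in> I" for a
    unfolding rel_def
  proof
    fix s assume s: "s \<in> scalars (k a)"
    let ?t = "conj_kind (k a) s"
    have st: "s \<in> OB" "?t \<in> OB" using s scalars_OB conj_kind_OB by auto
    let ?x = "ls s (z' a) - rs (z' a) ?t"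
    have "ls s (z a) = rs (z a) ?t" using frame_rel[OF F a] s by (simp add: rel_def)
    then have "?x = rs (pr (z a)) ?t - ls s (pr (z a))" by (simp add: z'_def ls_diff rs_diff)
    then have "?x \<in> ?H" using sub_diff[OF sH] sub_ls[OF sH] sub_rs[OF sH] st pr(1)[OF zN[OF a]] by simp
    moreover have "?x \<in> N'" using sub_diff[OF sN'] sub_ls[OF sN'] sub_rs[OF sN'] st z'N[OF a] by simp
    ultimately have "?x = 0" by (rule triv)
    then show "ls s (z' a) = rs (z' a) ?t" by simp
  qed
  have blk': "(\<Sum>a\<in>?J. blk (z a) (c a) (d a)) - (\<Sum>a\<in>?J. blk (z' a) (c a) (d a)) \<in> ?H"
    if cd: "\<forall>a\<in>?J. c a \<in> OB \<and> d a \<in> OB" for c d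
  proof -
    have "(\<Sum>a\<in>?J. blk (z a) (c a) (d a)) - (\<Sum>a\<in>?J. blk (z' a) (c a) (d a)) =
        (\<Sum>a\<in>?J. blk (pr (z a)) (c a) (d a))"
      unfolding sum_subtractf[symmetric] by (intro sum.cong) (simp_all add: z'_def blk_diff_z)
    also have "\<dots> \<in> ?H" using cd pr(1) zN by (intro sub_sum[OF sH] blk_in[OF sH]) auto
    finally show ?thesis .
  qed
  have sumI: "(\<Sum>a\<in>I. f a) = (\<Sum>a\<in>?J. f a) + f i + f j" for f :: "'i \<Rightarrow> 'v"
  proof -
    have "(\<Sum>a\<in>I. f a) = f i + (f j + (\<Sum>a\<in>I - {i} - {j}. f a))"
      using fin ij by (subst sum.remove[of I i], auto, subst sum.remove[of "I - {i}" j], auto)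
    also have "I - {i} - {j} = ?J" by auto
    finally show ?thesis by (simp add: algebra_simps)
  qed
  have "N' = span ?J z'"
  proof (intro equalityI subsetI)
    fix x assume x: "x \<in> N'"
    then have "x \<in> span I z" using frame_span[OF F] unfolding N'_def by blast
    then obtain c d where xs: "x = (\<Sum>a\<in>I. blk (z a) (c a) (d a))" and cd: "\<forall>a\<in>I. c a \<in> OB \<and> d a \<in> OB"
      unfolding span_def by blast
    let ?y = "\<Sum>a\<in>?J. blk (z' a) (c a) (d a)"
    have y: "?y \<in> N'" using z'N cd by (intro sub_sum[OF sN'] blk_in[OF sN']) auto
    have 1: "blk (z i) (c i) (d i) + blk (z j) (c j) (d j) \<in> ?H"
      unfolding H using cd ij by (intro Hsp_blkI) auto
    have 2: "(\<Sum>a\<in>?J. blk (z a) (c a) (d a)) - ?y \<in> ?H" using cd by (intro blk') auto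
    have "x - ?y = ((\<Sum>a\<in>?J. blk (z a) (c a) (d a)) - ?y) + (blk (z i) (c i) (d i) + blk (z j) (c j) (d j))"
      unfolding xs sumI by (simp add: algebra_simps)
    then have "x - ?y \<in> ?H" using sub_add[OF sH 2 1] by (simp only:)
    moreover have "x - ?y \<in> N'" using sub_diff[OF sN' x y] .
    ultimately have "x - ?y = 0" by (rule triv)
    then have "x = ?y" by simp
    then show "x \<in> span ?J z'" unfolding span_def using cd by blast
  next
    fix x assume "x \<in> span ?J z'"
    then show "x \<in> N'" using span_subset[OF sN', of ?J z'] z'N by blast
  qed
  moreover have "c a \<in> P \<and> (k a \<in> {K1, K2} \<longrightarrow> d a \<in> P)"
    if cd: "\<forall>a\<in>?J. c a \<in> OB \<and> d a \<in> OB" and y: "y \<in> N'"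
      and eq: "(\<Sum>a\<in>?J. blk (z' a) (c a) (d a)) = rs y \<omega>" and a: "a \<in> ?J" for c d y a
  proof -
    obtain s t s' t' where st: "(\<Sum>a\<in>?J. blk (z a) (c a) (d a)) - rs y \<omega> = blk (z i) s t + blk (z j) s' t'"
      "s \<in> OB" "t \<in> OB" "s' \<in> OB" "t' \<in> OB"
      using blk'[OF cd] unfolding eq H by (rule Hsp_blkE)
    \<comment> \<open>A relation among the projected generators lifts to one among the original
      generators: its component in the plane is absorbed into the coefficients at \<open>i\<close>
      and \<open>j\<close>.\<close>
    define c' where "c' = c(i := - s, j := - s')"
    define d' where "d' = d(i := - t, j := - t')"
    have J: "(\<Sum>a\<in>?J. blk (z a) (c' a) (d' a)) = (\<Sum>a\<in>?J. blk (z a) (c a) (d a))"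
      by (intro sum.cong) (auto simp: c'_def d'_def)
    have "(\<Sum>a\<in>I. blk (z a) (c' a) (d' a)) = rs y \<omega>"
      unfolding sumI J using st(1) ij by (simp add: c'_def d'_def blk_minus algebra_simps)
    moreover have "\<And>a. a \<in> I \<Longrightarrow> c' a \<in> OB" "\<And>a. a \<in> I \<Longrightarrow> d' a \<in> OB"
      using cd st OB_closed(6) by (auto simp: c'_def d'_def)
    moreover have "y \<in> N" using y by (simp add: N'_def)
    ultimately have "c' a \<in> P" "k a \<in> {K1, K2} \<Longrightarrow> d' a \<in> P" using frame_indep[OF F] a by blast+
    then show ?thesis using a by (auto simp: c'_def d'_def)
  qed
  ultimately have "frame N' ?J k z'"
    unfolding frame_def using sN' fin rel' by blast
  then show "\<exists>z'. frame N' (I - {i, j}) k z'" by blast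
qed

section \<open>Partners of generators\<close>

lemma q_pl_mi_P: "pl x \<Longrightarrow> mi y \<Longrightarrow> q x y \<in> OB \<Longrightarrow> q x y \<in> P"
  using q_pl_mi[of x y] K_omega_P by auto

lemma q_mi_pl_P: "mi x \<Longrightarrow> pl y \<Longrightarrow> q x y \<in> OB \<Longrightarrow> q x y \<in> P"
  using q_mi_pl[of x y] K_omega_P by auto

lemma q_swap_P: "q x y \<in> P \<Longrightarrow> q y x \<in> P"
  unfolding q_skew[of y x] using bar_P P_closed(6) by simp

text \<open>Generators of kind \<open>KP\<close> are minus elements and pair with \<open>z i\<close>
  into \<open>P\<close>. With only small kinds left, \<open>W (z j)\<close> is \<open>z j\<close>
  times \<open>\<omega>\<close>, so pairings with it lie in \<open>P\<close> as well; a unit can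
  only come from another generator of kind \<open>KO\<close>.\<close>

lemma partner_KO:
  assumes F: "frame N I k z" and pf: "perf N" and small: "\<forall>j\<in>I. k j = KO \<or> k j = KP"
    and i: "i \<in> I" "k i = KO"
  shows "\<exists>j\<in>I. j \<noteq> i \<and> k j = KO \<and> (\<exists>e f. plane H4 e f \<and> Hsp e f = Hsp (z i) (z j))"
proof (rule ccontr)
  assume no: "\<not> ?thesis"
  have int: "q (z i) (z j) \<in> OB" if "j \<in> I" for j
    using pf frame_gen[OF F] i that unfolding perf_def by blast
  have zi: "rel KO (z i)" using frame_rel[OF F i(1)] i by simp
  have *: "q (z i) (z j) \<in> P \<and> W (z j) = rs (z j) \<omega>" if j: "j \<in> I" for j
  proof (cases "k j = KO")
    case True
    then have zj: "rel KO (z j)" using frame_rel[OF F j] by simp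
    have "q (z i) (z j) \<in> P"
    proof (rule ccontr)
      assume u: "q (z i) (z j) \<notin> P"
      then have "j \<noteq> i" using q_KO_self[OF zi] P_closed(1) by auto
      then show False using no plane4_exists[OF zi zj int[OF j] u] j True by blast
    qed
    then show ?thesis using rel_KO_W zj by blast
  next
    case False
    then have "rel KP (z j)" using small j frame_rel[OF F j] by auto
    then show ?thesis using rel_KO_pl[OF zi] rel_KP_mi rel_KP_W q_pl_mi_P int[OF j] by blast
  qed
  have "q (z i) y \<in> P" if "y \<in> N" for y
    using * P_closed(4,5,7,8) by (intro frame_perp_P[OF F _ _ that]) (auto simp: q_rs_right)
  then obtain y where "y \<in> N" "z i = rs y \<omega>" using pf frame_gen[OF F i(1)] unfolding perf_def by blast
  then show False using frame_not_omega[OF F i(1)] by blast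
qed

text \<open>The minus element \<open>W (z i)\<close> pairs into \<open>P\<close> with the plus
  generators of kinds \<open>KO\<close> and \<open>K1\<close>. For \<open>KP\<close> moving
  \<open>W\<close> across the form produces a factor \<open>\<omega>\<close>, and between images
  under \<open>W\<close> a factor \<open>\<pi>\<close> appears. Only a generator of kind
  \<open>K2\<close> can give a unit.\<close>

lemma partner_K1:
  assumes F: "frame N I k z" and pf: "perf N" and i: "i \<in> I" "k i = K1"
  shows "\<exists>j\<in>I. k j = K2 \<and> (\<exists>e f. plane H6 e f \<and> Hsp e f = Hsp (z i) (z j))"
proof (rule ccontr)
  assume no: "\<not> ?thesis"
  note sN = frame_sub[OF F]
  have int: "q x y \<in> OB" if "x \<in> N" "y \<in> N" for x y using pf that unfolding perf_def by blast
  have x: "pl (z i)" "z i \<in> N" using frame_rel[OF F i(1)] i frame_gen[OF F i(1)] by (auto simp: pl_def)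
  have Wx: "mi (W (z i))" "W (z i) \<in> N" using x pl_W sub_W[OF sN] by auto
  have "q (W (z i)) (z j) \<in> P" if j: "j \<in> I" for j
  proof -
    have zj: "rel (k j) (z j)" "z j \<in> N" using frame_rel[OF F j] frame_gen[OF F j] by auto
    show ?thesis
    proof (cases "k j")
      case KO
      then show ?thesis using zj q_mi_pl_P[OF Wx(1)] rel_KO_pl int Wx by metis
    next
      case KP
      then have "q (W (z i)) (z j) = - (q (z i) (z j) * \<omega>)"
        using zj by (simp add: q_W rel_KP_W q_rs_right)
      then show ?thesis using int[OF x(2) zj(2)] P_closed(4,6,8) by simp
    next
      case K1
      then show ?thesis using zj q_mi_pl_P[OF Wx(1)] pl_def int Wx by metis
    next
      case K2
      then have m: "mi (z j)" using zj by (simp add: mi_def)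
      have "q (z j) (W (z i)) \<in> P"
        using plane6_exists[OF sN int x m zj(2)] no j K2 by blast
      then show ?thesis by (rule q_swap_P)
    qed
  qed
  moreover have "q (W (z i)) (W (z j)) \<in> P" if j: "j \<in> I" for j
  proof -
    have "\<iota> \<pi> \<in> P" unfolding omega_sq[symmetric] using P_closed(4,8) omega_OB by blast
    then show ?thesis using int[OF x(2) frame_gen[OF F j]] P_closed(4,6) by (simp add: q_W_W)
  qed
  ultimately have "q (W (z i)) y \<in> P" if "y \<in> N" for y by (intro frame_perp_P[OF F _ _ that])
  then obtain y where "y \<in> N" "W (z i) = rs y \<omega>" using pf Wx unfolding perf_def by blast
  then show False using frame_not_omega[OF F i(1)] i by blast
qed

subsection \<open>Twisting the left action\<close>

text \<open>Conjugating the left action by \<open>\<omega>\<close> exchanges \<open>KO\<close> with \<open>KP\<close> and \<open>K1\<close> with \<open>K2\<close>.\<close>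

lemma omega_conj: "inverse \<omega> * u * \<omega> = \<omega> * u * inverse \<omega>"
proof -
  have "\<omega> * (inverse \<omega> * u * \<omega>) * \<omega> = u * (\<omega> * \<omega>)" by (simp add: mult.assoc) (simp flip: mult.assoc)
  also have "\<dots> = \<omega> * \<omega> * u" unfolding omega_sq by (rule iota_commute[symmetric])
  also have "\<dots> = \<omega> * (\<omega> * u * inverse \<omega>) * \<omega>" by (simp add: mult.assoc)
  finally show ?thesis by simp
qed

abbreviation "tls a \<equiv> ls (\<omega> * a * inverse \<omega>)"

text \<open>The form stays adjoint for the new action because conjugation by \<open>\<omega>\<close>
  commutes with \<open>bar\<close>; this uses that its square is trivial,
  \<open>\<omega> * \<omega>\<close> being central.\<close>

lemma twist_bimod: "bimod v \<iota> bar \<sigma> OB K ordB \<pi> \<omega> tls rs q"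
proof unfold_locales
  fix a b :: 'b and x y z :: 'v and c :: 'f
  show "tls a (x + y) = tls a x + tls a y" by (rule ls_add)
  show "tls (a + b) x = tls a x + tls b x" by (simp add: distrib_left distrib_right ls_add_left)
  have "\<omega> * (a * b) * inverse \<omega> = (\<omega> * a * inverse \<omega>) * (\<omega> * b * inverse \<omega>)"
    by (simp add: mult.assoc) (simp flip: mult.assoc)
  then show "tls (a * b) x = tls a (tls b x)" unfolding ls_mult[symmetric] by simp
  show "tls 1 x = x" by simp
  show "rs (tls a x) b = tls a (rs x b)" by (rule ls_rs)
  have "\<omega> * \<iota> c * inverse \<omega> = \<iota> c" using iota_commute[of c \<omega>] by (simp add: mult.assoc flip: iota_commute[of c \<omega>])
  then show "tls (\<iota> c) x = rs x (\<iota> c)" by (simp add: ls_iota)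
  have "bar (\<omega> * a * inverse \<omega>) = inverse \<omega> * bar a * \<omega>"
    by (simp add: bar_mult bar_inverse bar_omega mult.assoc)
  then show "q (tls a x) y = q x (tls (bar a) y)" by (simp only: q_ls omega_conj)
qed (simp_all only: rs_add rs_add_right rs_mult rs_1 q_add_left q_rs_right, rule q_skew)

text \<open>The partner lemmas are applied to the twisted bimodule, where the generator has kind
  \<open>KO\<close> or \<open>K1\<close>, and the result is translated back.\<close>

lemma twisted_partners:
  assumes F: "frame N I k z" and pf: "perf N" and i: "i \<in> I"
  shows "\<forall>j\<in>I. k j = KO \<or> k j = KP \<Longrightarrow> k i = KP \<Longrightarrow>
      \<exists>j\<in>I. j \<noteq> i \<and> k j = KP \<and> (\<exists>e f. plane H5 e f \<and> Hsp e f = Hsp (z i) (z j))"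
    and "k i = K2 \<Longrightarrow> \<exists>j\<in>I. k j = K1 \<and> (\<exists>e f. plane H6 e f \<and> Hsp e f = Hsp (z j) (z i))"
proof -
  interpret T: bimod v \<iota> bar \<sigma> OB K ordB \<pi> \<omega> tls rs q by (rule twist_bimod)
  let ?c = "\<lambda>a. \<omega> * a * inverse \<omega>"
  have cR: "?c a = \<sigma> a" if "a \<in> R" for a using that R_K by (simp add: omega_K mult.assoc)
  have cc: "?c (?c a) = a" for a
    unfolding omega_conj[of "?c a", symmetric] by (simp add: mult.assoc) (simp flip: mult.assoc)
  have cs: "?c a \<in> scalars (swap l)" if "a \<in> scalars l" for a l
    using that cR sigma_R by (cases l) (auto intro: omega_conj_OB)
  have ck: "conj_kind (swap l) (?c a) = conj_kind l a" if "a \<in> scalars l" for a l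
    using that cR cc[of a] by (cases l) (auto simp: sigma_sigma R_K omega_conj)
  have ss: "swap (swap l) = l" for l by (cases l) auto
  have 1: "rel (swap l) x" if "T.rel l x" for l x
    unfolding rel_def
  proof
    fix a assume a: "a \<in> scalars (swap l)"
    have "?c a \<in> scalars l" using cs[OF a] by (simp only: ss)
    then have "tls (?c a) x = rs x (conj_kind l (?c a))" using that unfolding T.rel_def by blast
    then show "ls a x = rs x (conj_kind (swap l) a)" using ck[OF a] by (simp only: cc ss)
  qed
  have 2: "T.rel (swap l) x" if "rel l x" for l x
    unfolding T.rel_def
  proof
    fix a assume a: "a \<in> scalars (swap l)"
    have "?c a \<in> scalars l" using cs[OF a] by (simp only: ss)
    then have "ls (?c a) x = rs x (conj_kind l (?c a))" using that unfolding rel_def by blast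
    then show "tls a x = rs x (conj_kind (swap l) a)" using ck[OF a] by (simp only: ss)
  qed
  \<comment> \<open>The twist fixes \<open>\<omega>\<close>, so \<open>W\<close> and with it blocks,
    planes and spans are literally the same sets; only the kinds are exchanged.\<close>
  have w: "?c \<omega> = \<omega>" by (simp add: mult.assoc)
  have blk: "T.blk = blk" by (intro ext) (simp only: T.blk_def blk_def w)
  have Blk: "T.Blk = Blk" by (intro ext) (simp only: T.Blk_def Blk_def blk)
  have Hsp: "T.Hsp = Hsp" by (intro ext) (simp only: T.Hsp_def Hsp_def Blk)
  have Tsub: "T.sub N" using frame_sub[OF F] omega_conj_OB unfolding T.sub_def sub_def by blast
  have span: "T.span I z = span I z" by (simp only: T.span_def span_def blk)
  have sw: "swap l \<in> {K1, K2} \<longleftrightarrow> l \<in> {K1, K2}" for l by (cases l) auto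
  have Trel: "\<forall>i\<in>I. T.rel (swap (k i)) (z i)" using 2 frame_rel[OF F] by blast
  have TF: "T.frame N I (\<lambda>i. swap (k i)) z"
    using F Trel Tsub unfolding T.frame_def frame_def span blk sw by blast
  show "\<exists>j\<in>I. j \<noteq> i \<and> k j = KP \<and> (\<exists>e f. plane H5 e f \<and> Hsp e f = Hsp (z i) (z j))"
    if small: "\<forall>j\<in>I. k j = KO \<or> k j = KP" and ki: "k i = KP"
  proof -
    have "\<forall>j\<in>I. swap (k j) = KO \<or> swap (k j) = KP" using small by auto
    then obtain j e f where j: "j \<in> I" "j \<noteq> i" "swap (k j) = KO" "T.plane H4 e f" "Hsp e f = Hsp (z i) (z j)"
      using T.partner_KO[OF TF pf _ i] ki unfolding Hsp by auto
    have "k j = KP" using j(3) by (cases "k j") auto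
    moreover have "plane H5 e f" using j(4) 1[of KO e] 1[of KO f] by (simp add: T.plane_def plane_def)
    ultimately show ?thesis using j by blast
  qed
  show "\<exists>j\<in>I. k j = K1 \<and> (\<exists>e f. plane H6 e f \<and> Hsp e f = Hsp (z j) (z i))" if ki: "k i = K2"
  proof -
    obtain j e f where j: "j \<in> I" "swap (k j) = K2" "T.plane H6 e f" "Hsp e f = Hsp (z i) (z j)"
      using T.partner_K1[OF TF pf i] ki unfolding Hsp by auto
    have "k j = K1" using j(2) by (cases "k j") auto
    \<comment> \<open>Untwisted, \<open>e\<close> becomes a minus and \<open>f\<close> a plus
      element, so the plane has to be read with the two vectors exchanged.\<close>
    have G: "q e e = 0" "q f f = 0" "q e f = 0" "q e (W f) = 1" "rel K2 e" "rel K1 f"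
      using j(3) 1[of K1 e] 1[of K2 f] unfolding T.plane_def w by simp_all
    have "q (W e) f = -1" using G by (simp add: q_W)
    then have "q f (W e) = 1" by (rule q_swap_1)
    moreover have "q f e = 0" using G q_zero_sym by blast
    ultimately have "plane H6 f e" using G by (simp add: plane_def)
    moreover have "Hsp a b = Hsp b a" for a b using sumset_commute[of "Blk a" "Blk b"] unfolding Hsp_def sumset_def .
    ultimately show ?thesis using j \<open>k j = K1\<close> by metis
  qed
qed

subsection \<open>Hyperbolic sums\<close>

text \<open>The list keeps the order of the planes, since it becomes the order of the blocks in
  \<open>orthogonal_sum\<close>.\<close>

inductive hyp_sum :: "'v set \<Rightarrow> plane_kind list \<Rightarrow> bool" where
  Nil: "hyp_sum {0} []"
| Cons: "hyp_sum N ps \<Longrightarrow> plane h e f \<Longrightarrow> (\<And>g x. g \<in> Hsp e f \<Longrightarrow> x \<in> N \<Longrightarrow> q g x = 0) \<Longrightarrow>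
     hyp_sum (sumset (Hsp e f) N) (h # ps)"

lemma plane_0: "plane h e f \<Longrightarrow> 0 \<in> Hsp e f"
  using sub_plane sub_0 by blast

lemma sub_sumset: assumes "sub A" "sub B" shows "sub (sumset A B)"
  unfolding sub_def
proof (intro conjI ballI)
  have "0 + 0 \<in> sumset A B" unfolding sumset_def using assms sub_0 by blast
  then show "0 \<in> sumset A B" by simp
next
  fix x y assume "x \<in> sumset A B" "y \<in> sumset A B"
  then obtain a b c d where xy: "x = a + b" "y = c + d" "a \<in> A" "c \<in> A" "b \<in> B" "d \<in> B"
    unfolding sumset_def by blast
  then have "x + y = (a + c) + (b + d)" by (simp add: algebra_simps)
  then show "x + y \<in> sumset A B" unfolding sumset_def using xy assms sub_add by blast
next
  fix x a assume "x \<in> sumset A B" and a: "a \<in> OB"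
  then obtain u w where x: "x = u + w" "u \<in> A" "w \<in> B" unfolding sumset_def by blast
  show "ls a x \<in> sumset A B" unfolding sumset_def x ls_add using x a assms sub_ls by blast
  show "rs x a \<in> sumset A B" unfolding sumset_def x rs_add using x a assms sub_rs by blast
qed

lemma hyp_sum_sub: "hyp_sum N ps \<Longrightarrow> sub N"
proof (induction rule: hyp_sum.induct)
  case Nil
  then show ?case by (simp add: sub_def)
next
  case Cons
  then show ?case using sub_sumset sub_plane by blast
qed

lemma sumset_0: "sumset A {0} = A"
  unfolding sumset_def by auto

text \<open>Needed because the planes of type \<open>H6\<close> are found first but stand last in
  the standard sum.\<close>

lemma hyp_sum_snoc:
  assumes "hyp_sum N ps" "plane h e f" "\<And>g x. g \<in> Hsp e f \<Longrightarrow> x \<in> N \<Longrightarrow> q g x = 0"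
  shows "hyp_sum (sumset (Hsp e f) N) (ps @ [h])"
  using assms
proof (induction rule: hyp_sum.induct)
  case Nil
  then show ?case using hyp_sum.Cons[OF hyp_sum.Nil, of h e f] by simp
next
  case (Cons N ps h1 e1 f1)
  have sN: "0 \<in> N" using hyp_sum_sub[OF Cons.hyps(1)] sub_0 by blast
  have H0: "0 \<in> Hsp e1 f1" using plane_0 Cons by blast
  have NN: "x \<in> sumset (Hsp e1 f1) N" if "x \<in> N" for x
    unfolding sumset_def using that H0 by (intro CollectI exI[of _ 0] exI[of _ x]) auto
  have HN: "x \<in> sumset (Hsp e1 f1) N" if "x \<in> Hsp e1 f1" for x
    unfolding sumset_def using that sN by (intro CollectI exI[of _ x] exI[of _ 0]) auto
  have "hyp_sum (sumset (Hsp e f) N) (ps @ [h])"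
    using Cons.IH Cons.prems NN by blast
  moreover have "q g x = 0" if g: "g \<in> Hsp e1 f1" and x: "x \<in> sumset (Hsp e f) N" for g x
  proof -
    obtain a b where "x = a + b" "a \<in> Hsp e f" "b \<in> N" using x unfolding sumset_def by blast
    then show ?thesis using Cons.prems(2)[of a g] HN[OF g] Cons.hyps(3)[OF g] q_zero_sym[of a g]
      by (simp add: q_add)
  qed
  ultimately have "hyp_sum (sumset (Hsp e1 f1) (sumset (Hsp e f) N)) (h1 # ps @ [h])"
    using hyp_sum.Cons Cons.hyps(2) by blast
  then show ?case using sumset_assoc sumset_commute by (metis append_Cons)
qed

text \<open>Induction on the number of generators. Planes of type \<open>H6\<close> are split off as
  long as kinds \<open>K1\<close> or \<open>K2\<close> occur, because \<open>partner_KO\<close>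
  presupposes that only \<open>KO\<close> and \<open>KP\<close> are left. Each plane removes two
  indices of equal small kind or one index each of kinds \<open>K1\<close> and \<open>K2\<close>,
  whence the parities and the equality.\<close>

theorem frame_classification:
  fixes z :: "'i \<Rightarrow> 'v"
  assumes "frame N I k z" "perf N"
  shows "even (card {i \<in> I. k i = KO}) \<and> even (card {i \<in> I. k i = KP}) \<and>
    card {i \<in> I. k i = K1} = card {i \<in> I. k i = K2} \<and>
    hyp_sum N (replicate (card {i \<in> I. k i = KO} div 2) H4 @ replicate (card {i \<in> I. k i = KP} div 2) H5 @
      replicate (card {i \<in> I. k i = K1}) H6)"
  using assms
proof (induction "card I" arbitrary: N I z rule: less_induct)
  case less
  note F = less.prems(1) and pf = less.prems(2)
  note fin = frame_finite[OF F]
  have split: "\<exists>N' z'. frame N' (I - {i, j}) k z' \<and> perf N' \<and> N = sumset (Hsp e f) N' \<and>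
      (\<forall>g x. g \<in> Hsp e f \<longrightarrow> x \<in> N' \<longrightarrow> q g x = 0) \<and> card (I - {i, j}) < card I"
    if "i \<in> I" "j \<in> I" "i \<noteq> j" "plane h e f" "Hsp e f = Hsp (z i) (z j)" for i j h e f
  proof -
    have "card (I - {i, j}) < card I" using that fin by (intro psubset_card_mono) auto
    then show ?thesis using frame_split[OF F pf that] by blast
  qed
  consider (L) "\<exists>i\<in>I. \<exists>j\<in>I. k i = K1 \<and> k j = K2 \<and> (\<exists>e f. plane H6 e f \<and> Hsp e f = Hsp (z i) (z j))"
    | (small) "\<forall>j\<in>I. k j = KO \<or> k j = KP"
  proof (cases "\<forall>j\<in>I. k j = KO \<or> k j = KP")
    case False
    then obtain i where i: "i \<in> I" "k i = K1 \<or> k i = K2" by (metis kind.exhaust)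
    then show ?thesis using partner_K1[OF F pf i(1)] twisted_partners(2)[OF F pf i(1)] that(1) by blast
  qed (use that in blast)
  then show ?case
  proof cases
    case L
    then obtain i j e f where ij: "i \<in> I" "j \<in> I" "k i = K1" "k j = K2" "plane H6 e f" "Hsp e f = Hsp (z i) (z j)"
      by blast
    then have ne: "i \<noteq> j" by auto
    obtain N' z' where N': "frame N' (I - {i, j}) k z'" "perf N'" "N = sumset (Hsp e f) N'"
      "\<forall>g x. g \<in> Hsp e f \<longrightarrow> x \<in> N' \<longrightarrow> q g x = 0" "card (I - {i, j}) < card I"
      using split[OF ij(1,2) ne ij(5,6)] by blast
    note cnt = card_filter_remove2[OF fin ij(1,2) ne, of "\<lambda>x. k x = _"]
    note IH = less.hyps[OF N'(5,1,2)]
    have "hyp_sum N ((replicate (card {x \<in> I - {i, j}. k x = KO} div 2) H4 @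
        replicate (card {x \<in> I - {i, j}. k x = KP} div 2) H5 @ replicate (card {x \<in> I - {i, j}. k x = K1}) H6) @ [H6])"
      unfolding N'(3) using IH N'(4) by (intro hyp_sum_snoc ij) auto
    then show ?thesis using IH ij cnt[of KO] cnt[of KP] cnt[of K1] cnt[of K2]
      by (simp flip: replicate_append_same)
  next
    case small
    then have 0: "{i \<in> I. k i = K1} = {}" "{i \<in> I. k i = K2} = {}" by auto
    show ?thesis
    proof (cases "\<exists>i\<in>I. k i = KO")
      case True
      then obtain i where i: "i \<in> I" "k i = KO" by blast
      obtain j e f where j: "j \<in> I" "j \<noteq> i" "k j = KO" "plane H4 e f" "Hsp e f = Hsp (z i) (z j)"
        using partner_KO[OF F pf small i] by blast
      obtain N' z' where N': "frame N' (I - {i, j}) k z'" "perf N'" "N = sumset (Hsp e f) N'"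
        "\<forall>g x. g \<in> Hsp e f \<longrightarrow> x \<in> N' \<longrightarrow> q g x = 0" "card (I - {i, j}) < card I"
        using split[OF i(1) j(1) j(2)[symmetric] j(4,5)] by blast
      note cnt = card_filter_remove2[OF fin i(1) j(1) j(2)[symmetric], of "\<lambda>x. k x = _"]
      note IH = less.hyps[OF N'(5,1,2)]
      have "hyp_sum N (H4 # (replicate (card {x \<in> I - {i, j}. k x = KO} div 2) H4 @
        replicate (card {x \<in> I - {i, j}. k x = KP} div 2) H5 @ replicate (card {x \<in> I - {i, j}. k x = K1}) H6))"
        unfolding N'(3) using IH N'(4) by (intro hyp_sum.Cons j) auto
      then show ?thesis using IH i j cnt[of KO] cnt[of KP] cnt[of K1] cnt[of K2] by simp
    next
      case noKO: False
      then have 1: "{i \<in> I. k i = KO} = {}" by auto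
      show ?thesis
      proof (cases "I = {}")
        case True
        then have "N = {0}" using frame_span[OF F] by (auto simp: span_def)
        then show ?thesis using hyp_sum.Nil True by simp
      next
        case False
        then obtain i where i: "i \<in> I" "k i = KP" using small noKO by blast
        obtain j e f where j: "j \<in> I" "j \<noteq> i" "k j = KP" "plane H5 e f" "Hsp e f = Hsp (z i) (z j)"
          using twisted_partners(1)[OF F pf i(1) small i(2)] by blast
        obtain N' z' where N': "frame N' (I - {i, j}) k z'" "perf N'" "N = sumset (Hsp e f) N'"
          "\<forall>g x. g \<in> Hsp e f \<longrightarrow> x \<in> N' \<longrightarrow> q g x = 0" "card (I - {i, j}) < card I"
          using split[OF i(1) j(1) j(2)[symmetric] j(4,5)] by blast
        note cnt = card_filter_remove2[OF fin i(1) j(1) j(2)[symmetric], of "\<lambda>x. k x = _"]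
        note IH = less.hyps[OF N'(5,1,2)]
        \<comment> \<open>The initial segment of planes \<open>H4\<close> is empty in this case, so
          a plane \<open>H5\<close> may be put in front.\<close>
        have k0: "card {x \<in> I - {i, j}. k x = KO} = 0" "card {x \<in> I. k x = KO} = 0"
          using noKO by (auto simp: card_eq_0_iff)
        have "hyp_sum N (H5 # (replicate (card {x \<in> I - {i, j}. k x = KO} div 2) H4 @
          replicate (card {x \<in> I - {i, j}. k x = KP} div 2) H5 @ replicate (card {x \<in> I - {i, j}. k x = K1}) H6))"
          unfolding N'(3) using IH N'(4) by (intro hyp_sum.Cons j) auto
        then show ?thesis using IH i j k0 cnt[of KP] cnt[of K1] cnt[of K2] by simp
      qed
    qed
  qed
qed

end


section \<open>Coordinates\<close>

lemma direct_sum_Cons: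
  "fst (direct_sum (e # es)) = fst e + fst (direct_sum es)"
  "snd (direct_sum (e # es)) a =
    four_block_mat (snd e a) (0\<^sub>m (dim_row (snd e a)) (dim_col (snd (direct_sum es) a)))
      (0\<^sub>m (dim_row (snd (direct_sum es) a)) (dim_col (snd e a))) (snd (direct_sum es) a)"
  by (simp_all add: direct_sum_def Let_def)

lemma direct_sum_Nil: "fst (direct_sum []) = 0" "snd (direct_sum []) a = 0\<^sub>m 0 0"
  by (simp_all add: direct_sum_def)

lemma vec_first_append: "a \<in> carrier_vec n \<Longrightarrow> vec_first (a @\<^sub>v b) n = a"
  by (intro eq_vecI) (auto simp: vec_first_def)

lemma vec_last_append: "b \<in> carrier_vec m \<Longrightarrow> vec_last (a @\<^sub>v b) m = b"
  by (intro eq_vecI) (auto simp: vec_last_def)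

lemma map_vec_append: "map_vec f (a @\<^sub>v b) = map_vec f a @\<^sub>v map_vec f b"
  by (intro eq_vecI) auto

lemma vec_1_eqI:
  assumes "x \<in> carrier_vec (Suc 0)" "y \<in> carrier_vec (Suc 0)" "x $ 0 = y $ 0" shows "x = y"
proof (rule eq_vecI)
  show "dim_vec x = dim_vec y" using carrier_vecD[OF assms(1)] carrier_vecD[OF assms(2)] by simp
  fix i assume "i < dim_vec y"
  then have "i = 0" using carrier_vecD[OF assms(2)] by simp
  then show "x $ i = y $ i" using assms(3) by simp
qed

lemma vec_2_eqI:
  assumes "x \<in> carrier_vec 2" "y \<in> carrier_vec 2" "x $ 0 = y $ 0" "x $ 1 = y $ 1" shows "x = y"
proof (rule eq_vecI)
  show "dim_vec x = dim_vec y" using carrier_vecD[OF assms(1)] carrier_vecD[OF assms(2)] by simp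
  fix i assume "i < dim_vec y"
  then have "i = 0 \<or> i = 1" using carrier_vecD[OF assms(2)] by linarith
  then show "x $ i = y $ i" using assms(3,4) by auto
qed

definition int_vecs :: "'b set \<Rightarrow> nat \<Rightarrow> 'b vec set" where
  "int_vecs S n = {x \<in> carrier_vec n. \<forall>i<n. x $ i \<in> S}"

lemma int_vecs_carrier: "x \<in> int_vecs S n \<Longrightarrow> x \<in> carrier_vec n"
  by (simp add: int_vecs_def)

lemma int_vecs_append: "a \<in> int_vecs S n \<Longrightarrow> b \<in> int_vecs S m \<Longrightarrow> a @\<^sub>v b \<in> int_vecs S (n + m)"
  by (auto simp: int_vecs_def)

lemma int_vecs_appendE:
  assumes "x \<in> int_vecs S (n + m)"
  obtains a b where "x = a @\<^sub>v b" "a \<in> int_vecs S n" "b \<in> int_vecs S m"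
proof
  have x: "x \<in> carrier_vec (n + m)" "\<And>i. i < n + m \<Longrightarrow> x $ i \<in> S" using assms by (auto simp: int_vecs_def)
  show "x = vec_first x n @\<^sub>v vec_last x m" using vec_first_last_append[OF x(1)] by simp
  show "vec_first x n \<in> int_vecs S n" "vec_last x m \<in> int_vecs S m"
    using x by (auto simp: int_vecs_def vec_first_def vec_last_def)
qed

lemma gram_append:
  fixes C1 :: "'b::division_ring mat"
  assumes "C1 \<in> carrier_mat n n" "C2 \<in> carrier_mat m m" "a \<in> carrier_vec n" "b \<in> carrier_vec m"
    "a' \<in> carrier_vec n" "b' \<in> carrier_vec m"
  shows "gram_pairing f (four_block_mat C1 (0\<^sub>m n m) (0\<^sub>m m n) C2) (a @\<^sub>v b) (a' @\<^sub>v b') =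
    gram_pairing f C1 a a' + gram_pairing f C2 b b'"
  unfolding gram_pairing_def mult_mat_vec_split[OF assms(1,2,5,6)] map_vec_append
  by (rule scalar_prod_append[of _ n _ m]) (use assms in auto)

context quat
begin

lemma K_coords: assumes "a \<in> K" "b \<in> K" shows "K_coords K \<omega> (a + b * \<omega>) = (a, b)"
  unfolding K_coords_def
proof (rule the_equality)
  fix c assume c: "fst c \<in> K \<and> snd c \<in> K \<and> a + b * \<omega> = fst c + snd c * \<omega>"
  then have "(snd c - b) * \<omega> = a - fst c" by (simp add: algebra_simps)
  then have "snd c - b = 0" using K_omega_disjoint[of "snd c - b"] c assms K_diff by metis
  then show "c = (a, b)" using c by (intro prod_eqI) auto
qed (use assms in auto)

fun ebd :: "kind \<Rightarrow> 'b embedding" where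
  "ebd KO = bilat_O" | "ebd KP = bilat_P \<omega>" | "ebd K1 = bilat_L1 \<iota> K \<sigma> \<pi> \<omega>" | "ebd K2 = bilat_L2 \<iota> K \<sigma> \<pi> \<omega>"

lemma phi_mat: "diag2 a b + diag2 c d * omega_mat p =
    mat_of_rows_list 2 [[a, c * p], [d, b :: 'b]]"
  by (rule eq_matI) (auto simp: diag2_def omega_mat_def mat_of_rows_list_def scalar_prod_def numeral_2_eq_2 less_Suc_eq)

lemma mult_vec_2: "x \<in> carrier_vec 2 \<Longrightarrow>
    mat_of_rows_list 2 [[a, b], [c, d]] *\<^sub>v x = vec_of_list [a * x $ 0 + b * x $ 1, c * x $ 0 + d * x $ 1 :: 'b]"
  by (rule eq_vecI) (auto simp: mat_of_rows_list_def scalar_prod_def numeral_2_eq_2 less_Suc_eq)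

lemma ebd_big:
  assumes "a \<in> R" "b \<in> R"
  shows "snd (ebd K1) (a + b * \<omega>) = mat_of_rows_list 2 [[a, b * \<iota> \<pi>], [\<sigma> b, \<sigma> a]]"
    "snd (ebd K2) (a + b * \<omega>) = mat_of_rows_list 2 [[\<sigma> a, \<sigma> b * \<iota> \<pi>], [b, a]]"
  using assms R_K by (auto simp: bilat_L1_def bilat_L2_def K_coords phi_mat)

lemma fst_ebd [simp]: "fst (ebd KO) = 1" "fst (ebd KP) = 1" "fst (ebd K1) = 2" "fst (ebd K2) = 2"
  by (simp_all add: bilat_O_def bilat_P_def bilat_L1_def bilat_L2_def)

end

context bimod
begin

text \<open>A coordinate isomorphism from integral column vectors onto \<open>N\<close>. The first
  two clauses carry the size and the integrality of the matrices through block sums.\<close>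

definition rep :: "'b embedding \<Rightarrow> 'v set \<Rightarrow> ('b vec \<Rightarrow> 'v) \<Rightarrow> bool" where
  "rep e N G \<longleftrightarrow>
     (\<forall>a\<in>OB. snd e a \<in> carrier_mat (fst e) (fst e)) \<and>
     (\<forall>a\<in>OB. \<forall>x\<in>int_vecs OB (fst e). snd e a *\<^sub>v x \<in> int_vecs OB (fst e)) \<and>
     bij_betw G (int_vecs OB (fst e)) N \<and>
     (\<forall>x\<in>int_vecs OB (fst e). \<forall>y\<in>int_vecs OB (fst e). G (x + y) = G x + G y) \<and>
     (\<forall>a\<in>OB. \<forall>x\<in>int_vecs OB (fst e).
        G (snd e a *\<^sub>v x) = ls a (G x) \<and> G (map_vec (\<lambda>c. c * a) x) = rs (G x) a)"

text \<open>Block diagonal matrices act separately on the two halves of a column, and the sum of the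
  two parametrizations is injective because \<open>A\<close> and \<open>B\<close> meet only in
  0.\<close>

lemma rep_append:
  assumes 1: "rep e A G1" and 2: "rep (direct_sum es) B G2"
    and sub: "sub A" "sub B" and disj: "\<And>x. x \<in> A \<Longrightarrow> x \<in> B \<Longrightarrow> x = 0"
  shows "rep (direct_sum (e # es)) (sumset A B)
    (\<lambda>v. G1 (vec_first v (fst e)) + G2 (vec_last v (fst (direct_sum es))))"
proof -
  define n m where "n = fst e" and "m = fst (direct_sum es)"
  define G where "G v = G1 (vec_first v n) + G2 (vec_last v m)" for v
  note 1 = 1[unfolded rep_def, folded n_def] and 2 = 2[unfolded rep_def, folded m_def]
  have fst': "fst (direct_sum (e # es)) = n + m" by (simp add: direct_sum_Cons n_def m_def)
  have snd': "snd (direct_sum (e # es)) a =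
      four_block_mat (snd e a) (0\<^sub>m n m) (0\<^sub>m m n) (snd (direct_sum es) a)" if "a \<in> OB" for a
    using 1 2 that unfolding direct_sum_Cons(2) by (metis carrier_matD)
  have G: "G (a @\<^sub>v b) = G1 a + G2 b" if "a \<in> int_vecs OB n" "b \<in> int_vecs OB m" for a b
    unfolding G_def vec_first_append[OF int_vecs_carrier[OF that(1)]] vec_last_append[OF int_vecs_carrier[OF that(2)]] ..
  have mv: "snd (direct_sum (e # es)) s *\<^sub>v (a @\<^sub>v b) = (snd e s *\<^sub>v a) @\<^sub>v (snd (direct_sum es) s *\<^sub>v b)"
    if "a \<in> int_vecs OB n" "b \<in> int_vecs OB m" "s \<in> OB" for a b s
    unfolding snd'[OF that(3)] using that 1 2 int_vecs_carrier by (intro mult_mat_vec_split) blast+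
  have G1A: "G1 a \<in> A" if "a \<in> int_vecs OB n" for a using 1 that by (auto simp: bij_betw_def)
  have G2B: "G2 b \<in> B" if "b \<in> int_vecs OB m" for b using 2 that by (auto simp: bij_betw_def)
  have rs_closed: "map_vec (\<lambda>c. c * s) a \<in> int_vecs OB k" if "a \<in> int_vecs OB k" "s \<in> OB" for a s k
    using that OB_closed(5) by (auto simp: int_vecs_def)
  show ?thesis
    unfolding rep_def fst' n_def[symmetric] m_def[symmetric] G_def[symmetric]
  proof (intro conjI ballI)
    fix a assume a: "a \<in> OB"
    show "snd (direct_sum (e # es)) a \<in> carrier_mat (n + m) (n + m)"
      unfolding snd'[OF a] using 1 2 a by (intro four_block_carrier_mat) blast+
  next
    fix a x assume a: "a \<in> OB" and x: "x \<in> int_vecs OB (n + m)"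
    then obtain s t where st: "x = s @\<^sub>v t" "s \<in> int_vecs OB n" "t \<in> int_vecs OB m"
      by (elim int_vecs_appendE)
    show "snd (direct_sum (e # es)) a *\<^sub>v x \<in> int_vecs OB (n + m)"
      unfolding st(1) mv[OF st(2,3) a] using 1 2 st a by (intro int_vecs_append) blast+
    have "G (snd (direct_sum (e # es)) a *\<^sub>v x) = G1 (snd e a *\<^sub>v s) + G2 (snd (direct_sum es) a *\<^sub>v t)"
      unfolding st(1) mv[OF st(2,3) a] using 1 2 st a by (intro G) blast+
    then show "G (snd (direct_sum (e # es)) a *\<^sub>v x) = ls a (G x)"
      using 1 2 st a by (simp add: G ls_add)
    have "G (map_vec (\<lambda>c. c * a) x) = G1 (map_vec (\<lambda>c. c * a) s) + G2 (map_vec (\<lambda>c. c * a) t)"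
      unfolding st(1) map_vec_append using rs_closed st a by (intro G)
    then show "G (map_vec (\<lambda>c. c * a) x) = rs (G x) a"
      using 1 2 st a by (simp add: G rs_add)
  next
    fix x y assume "x \<in> int_vecs OB (n + m)" "y \<in> int_vecs OB (n + m)"
    then obtain s t s' t' where st: "x = s @\<^sub>v t" "s \<in> int_vecs OB n" "t \<in> int_vecs OB m"
      "y = s' @\<^sub>v t'" "s' \<in> int_vecs OB n" "t' \<in> int_vecs OB m"
      by (metis int_vecs_appendE)
    have cl: "s + s' \<in> int_vecs OB n" "t + t' \<in> int_vecs OB m"
      using st OB_closed(3) by (auto simp: int_vecs_def)
    have "x + y = (s + s') @\<^sub>v (t + t')"
      unfolding st using st int_vecs_carrier by (intro append_vec_add) blast+
    then have "G (x + y) = G1 (s + s') + G2 (t + t')" using G[OF cl] by simp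
    then show "G (x + y) = G x + G y" using 1 2 st G by (simp add: algebra_simps)
  next
    show "bij_betw G (int_vecs OB (n + m)) (sumset A B)"
      unfolding bij_betw_def
    proof (intro conjI inj_onI equalityI subsetI)
      fix x y assume "x \<in> int_vecs OB (n + m)" "y \<in> int_vecs OB (n + m)" and eq: "G x = G y"
      then obtain s t s' t' where st: "x = s @\<^sub>v t" "s \<in> int_vecs OB n" "t \<in> int_vecs OB m"
        "y = s' @\<^sub>v t'" "s' \<in> int_vecs OB n" "t' \<in> int_vecs OB m"
        by (metis int_vecs_appendE)
      have "G1 s - G1 s' = G2 t' - G2 t" using eq st G by (simp add: algebra_simps)
      moreover have "G1 s - G1 s' \<in> A" "G2 t' - G2 t \<in> B"
        using sub_diff[OF sub(1)] sub_diff[OF sub(2)] G1A G2B st by blast+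
      ultimately have "G1 s = G1 s'" "G2 t = G2 t'" using disj by (metis eq_iff_diff_eq_0)+
      then show "x = y" using 1 2 st unfolding bij_betw_def inj_on_def by blast
    next
      fix z assume "z \<in> G ` int_vecs OB (n + m)"
      then obtain s t where st: "z = G (s @\<^sub>v t)" "s \<in> int_vecs OB n" "t \<in> int_vecs OB m"
        by (auto elim: int_vecs_appendE)
      then show "z \<in> sumset A B" unfolding sumset_def using G G1A G2B by blast
    next
      fix z assume "z \<in> sumset A B"
      then obtain a b where "z = a + b" "a \<in> A" "b \<in> B" unfolding sumset_def by blast
      moreover then obtain s t where "a = G1 s" "b = G2 t" "s \<in> int_vecs OB n" "t \<in> int_vecs OB m"
        using 1 2 unfolding bij_betw_def by blast
      ultimately show "z \<in> G ` int_vecs OB (n + m)" using G int_vecs_append by (metis imageI)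
    qed
  qed
qed

lemma rep_Nil: "rep (direct_sum []) {0} (\<lambda>v. 0)"
proof -
  have iv: "int_vecs OB 0 = {0\<^sub>v 0}" by (auto simp: int_vecs_def)
  have *: "0\<^sub>m 0 0 *\<^sub>v 0\<^sub>v 0 = (0\<^sub>v 0 :: 'b vec)" by (intro eq_vecI) auto
  show ?thesis unfolding rep_def direct_sum_Nil iv using * by (simp add: bij_betw_def)
qed

lemma rep_small:
  assumes k: "k = KO \<or> k = KP" and rel: "rel k z" and free: "\<And>c. rs z c = 0 \<Longrightarrow> c = 0"
  shows "rep (ebd k) (Blk z) (\<lambda>v. rs z (v $ 0))"
proof -
  have B: "Blk z = {rs z c |c. c \<in> OB}"
    using k rel rel_KO_W rel_KP_W by (intro Blk_small) blast
  have n: "fst (ebd k) = Suc 0" and s: "\<And>a. snd (ebd k) a = mat_of_rows_list (Suc 0) [[conj_kind k a]]"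
    using k by (auto simp: bilat_O_def bilat_P_def)
  have mv: "mat_of_rows_list (Suc 0) [[a]] *\<^sub>v x = vec_of_list [a * x $ 0]" if "x \<in> carrier_vec (Suc 0)" for a :: 'b and x
    using that by (intro eq_vecI) (auto simp: mat_of_rows_list_def scalar_prod_def)
  have sc: "scalars k = OB" using k by auto
  have iv: "x \<in> int_vecs OB (Suc 0) \<longleftrightarrow> x \<in> carrier_vec (Suc 0) \<and> x $ 0 \<in> OB" for x by (auto simp: int_vecs_def)
  show ?thesis unfolding rep_def n s B
  proof (intro conjI ballI)
    fix a x assume a: "a \<in> OB" and x: "x \<in> int_vecs OB (Suc 0)"
    have c: "conj_kind k a \<in> OB" using conj_kind_OB[of a k] sc a by simp
    have x': "x \<in> carrier_vec (Suc 0)" "x $ 0 \<in> OB" using x unfolding iv by auto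
    show "mat_of_rows_list (Suc 0) [[conj_kind k a]] *\<^sub>v x \<in> int_vecs OB (Suc 0)"
      unfolding mv[OF x'(1)] iv using OB_closed(5)[OF c x'(2)] by (simp add: carrier_dim_vec)
    have lz: "ls a z = rs z (conj_kind k a)" using rel a sc by (simp add: rel_def)
    show "rs z ((mat_of_rows_list (Suc 0) [[conj_kind k a]] *\<^sub>v x) $ 0) = ls a (rs z (x $ 0))"
      unfolding mv[OF x'(1)] ls_rs[symmetric] lz by (simp add: rs_mult)
    have "map_vec (\<lambda>c. c * a) x $ 0 = x $ 0 * a"
      using carrier_vecD[OF x'(1)] by (subst index_map_vec) simp_all
    then show "rs z (map_vec (\<lambda>c. c * a) x $ 0) = rs (rs z (x $ 0)) a" by (simp only: rs_mult)
  next
    show "bij_betw (\<lambda>v. rs z (v $ 0)) (int_vecs OB (Suc 0)) {rs z c |c. c \<in> OB}"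
      unfolding bij_betw_def
    proof (intro conjI inj_onI equalityI subsetI)
      fix x y assume *: "x \<in> int_vecs OB (Suc 0)" "y \<in> int_vecs OB (Suc 0)" "rs z (x $ 0) = rs z (y $ 0)"
      then have "rs z (x $ 0 - y $ 0) = 0" using rs_add_right[of z "x $ 0 - y $ 0" "y $ 0"] by simp
      then have "x $ 0 = y $ 0" using free[of "x $ 0 - y $ 0"] by simp
      then show "x = y" using *(1,2) unfolding iv by (intro vec_1_eqI) simp_all
    next
      fix x assume "x \<in> {rs z c |c. c \<in> OB}"
      then obtain c where "x = rs z c" "c \<in> OB" by blast
      then show "x \<in> (\<lambda>v. rs z (v $ 0)) ` int_vecs OB (Suc 0)"
        by (intro image_eqI[of _ _ "vec_of_list [c]"]) (simp_all add: iv carrier_dim_vec)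
    next
      fix x assume "x \<in> (\<lambda>v. rs z (v $ 0)) ` int_vecs OB (Suc 0)"
      then obtain w where w: "x = rs z (w $ 0)" "w \<in> int_vecs OB (Suc 0)" by (rule imageE)
      have "w $ 0 \<in> OB" using w(2) unfolding iv by simp
      then show "x \<in> {rs z c |c. c \<in> OB}" using w(1) by (intro CollectI exI conjI)
    qed
  next
    fix x y assume "x \<in> int_vecs OB (Suc 0)" and y: "y \<in> int_vecs OB (Suc 0)"
    have "dim_vec y = Suc 0" using y unfolding iv by (blast dest: carrier_vecD)
    then have "(x + y) $ 0 = x $ 0 + y $ 0" by (subst index_add_vec(1)) simp_all
    then show "rs z ((x + y) $ 0) = rs z (x $ 0) + rs z (y $ 0)" by (simp only: rs_add_right)
  next
    fix a
    show "mat_of_rows_list (Suc 0) [[conj_kind k a]] \<in> carrier_mat (Suc 0) (Suc 0)"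
      by (simp add: mat_of_rows_list_def)
  qed
qed

text \<open>In the basis \<open>z\<close>, \<open>W z\<close> the left action has exactly the
  matrices of the embeddings: scalars of O_K get conjugated when they pass \<open>\<omega>\<close>,
  and \<open>\<omega> * \<omega>\<close> yields the entry with \<open>\<pi>\<close>.\<close>

lemma rep_big:
  assumes k: "k = K1 \<or> k = K2" and rel: "rel k z" and free: "\<And>c d. blk z c d = 0 \<Longrightarrow> c = 0 \<and> d = 0"
  shows "rep (ebd k) (Blk z) (\<lambda>v. blk z (v $ 0) (v $ 1))"
proof -
  have n: "fst (ebd k) = 2" using k fst_ebd(3,4) by blast
  have sc: "scalars k = R" using k by auto
  have s: "snd (ebd k) (a + b * \<omega>) =
      mat_of_rows_list 2 [[conj_kind k a, conj_kind k b * \<iota> \<pi>], [conj_kind k (\<sigma> b), conj_kind k (\<sigma> a)]]"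
    if "a \<in> R" "b \<in> R" for a b
    using k that ebd_big[OF that] by (auto simp del: ebd.simps simp: sigma_sigma R_K)
  have iv: "x \<in> int_vecs OB 2 \<longleftrightarrow> x \<in> carrier_vec 2 \<and> x $ 0 \<in> OB \<and> x $ 1 \<in> OB" for x
    by (auto simp: int_vecs_def less_2_cases_iff)
  have p: "\<iota> \<pi> \<in> OB" unfolding omega_sq[symmetric] using OB_closed(5) omega_OB by blast
  show ?thesis unfolding rep_def n
  proof (intro conjI ballI)
    fix a assume "a \<in> OB"
    then obtain a0 b0 where ab: "a = a0 + b0 * \<omega>" "a0 \<in> R" "b0 \<in> R" using OB_eq by auto
    show "snd (ebd k) a \<in> carrier_mat 2 2" unfolding ab(1) s[OF ab(2,3)] by (simp add: mat_of_rows_list_def numeral_2_eq_2)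
  next
    fix a x assume aO: "a \<in> OB" and x: "x \<in> int_vecs OB 2"
    then obtain a0 b0 where ab: "a = a0 + b0 * \<omega>" "a0 \<in> R" "b0 \<in> R" using OB_eq by auto
    note sR = sigma_R[OF ab(2)] sigma_R[OF ab(3)]
    have cO: "conj_kind k a0 \<in> OB" "conj_kind k b0 \<in> OB" "conj_kind k (\<sigma> a0) \<in> OB" "conj_kind k (\<sigma> b0) \<in> OB"
      using conj_kind_OB ab sR sc by auto
    have x': "x \<in> carrier_vec 2" using x by (simp add: iv)
    have xO: "x $ 0 \<in> OB" "x $ 1 \<in> OB" using x unfolding iv by simp_all
    have "conj_kind k a0 * x $ 0 + conj_kind k b0 * \<iota> \<pi> * x $ 1 \<in> OB"
      "conj_kind k (\<sigma> b0) * x $ 0 + conj_kind k (\<sigma> a0) * x $ 1 \<in> OB"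
      by (intro OB_closed(3,5) cO xO p)+
    then show "snd (ebd k) a *\<^sub>v x \<in> int_vecs OB 2"
      unfolding ab(1) s[OF ab(2,3)] mult_vec_2[OF x'] iv by (simp add: carrier_dim_vec)
    have om: "c * \<omega> = \<omega> * \<sigma> c" if "c \<in> R" for c using that R_K by (simp add: omega_K sigma_K sigma_sigma)
    have z: "ls c z = rs z (conj_kind k c)" if "c \<in> R" for c using rel that sc by (simp add: rel_def)
    have lz: "ls a z = rs z (conj_kind k a0) + rs (W z) (conj_kind k (\<sigma> b0))"
      unfolding ab(1) ls_add_left om[OF ab(3)] ls_mult using ab sR by (simp add: z ls_rs)
    have "a * \<omega> = b0 * \<iota> \<pi> + \<omega> * \<sigma> a0"
      unfolding ab(1) om[OF ab(2), symmetric] omega_sq[symmetric] by (simp add: algebra_simps)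
    then have lWz: "ls a (W z) = rs z (conj_kind k b0 * \<iota> \<pi>) + rs (W z) (conj_kind k (\<sigma> a0))"
      unfolding ls_mult[symmetric] using ab sR by (simp add: ls_add_left ls_mult ls_iota z ls_rs[symmetric] rs_mult)
    have "(snd (ebd k) a *\<^sub>v x) $ 0 = conj_kind k a0 * x $ 0 + conj_kind k b0 * \<iota> \<pi> * x $ 1"
      "(snd (ebd k) a *\<^sub>v x) $ 1 = conj_kind k (\<sigma> b0) * x $ 0 + conj_kind k (\<sigma> a0) * x $ 1"
      unfolding ab(1) s[OF ab(2,3)] mult_vec_2[OF x'] by simp_all
    then show "blk z ((snd (ebd k) a *\<^sub>v x) $ 0) ((snd (ebd k) a *\<^sub>v x) $ 1) = ls a (blk z (x $ 0) (x $ 1))"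
      by (simp only: blk_def ls_add ls_rs[symmetric] lz lWz rs_add rs_add_right rs_mult add.assoc add.left_commute)
    have "map_vec (\<lambda>c. c * a) x $ 0 = x $ 0 * a" "map_vec (\<lambda>c. c * a) x $ 1 = x $ 1 * a"
      using carrier_vecD[OF x'] by (subst index_map_vec, simp_all)+
    then show "blk z (map_vec (\<lambda>c. c * a) x $ 0) (map_vec (\<lambda>c. c * a) x $ 1) = rs (blk z (x $ 0) (x $ 1)) a"
      by (simp only: blk_def rs_mult rs_add)
  next
    fix x y assume "x \<in> int_vecs OB 2" and y: "y \<in> int_vecs OB 2"
    have "dim_vec y = 2" using y unfolding iv by (blast dest: carrier_vecD)
    then have "(x + y) $ 0 = x $ 0 + y $ 0" "(x + y) $ 1 = x $ 1 + y $ 1"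
      by (subst index_add_vec(1), simp_all)+
    then show "blk z ((x + y) $ 0) ((x + y) $ 1) = blk z (x $ 0) (x $ 1) + blk z (y $ 0) (y $ 1)"
      by (simp only: blk_add)
  next
    show "bij_betw (\<lambda>v. blk z (v $ 0) (v $ 1)) (int_vecs OB 2) (Blk z)"
      unfolding bij_betw_def
    proof (intro conjI inj_onI equalityI subsetI)
      fix x y assume *: "x \<in> int_vecs OB 2" "y \<in> int_vecs OB 2" "blk z (x $ 0) (x $ 1) = blk z (y $ 0) (y $ 1)"
      then have "blk z (x $ 0 - y $ 0) (x $ 1 - y $ 1) = 0"
        using blk_add[of z "x $ 0 - y $ 0" "y $ 0" "x $ 1 - y $ 1" "y $ 1"] by simp
      then have "x $ 0 = y $ 0" "x $ 1 = y $ 1" using free[of "x $ 0 - y $ 0" "x $ 1 - y $ 1"] by simp_all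
      then show "x = y" using *(1,2) unfolding iv by (intro vec_2_eqI) simp_all
    next
      fix x assume "x \<in> Blk z"
      then obtain c d where "x = blk z c d" "c \<in> OB" "d \<in> OB" unfolding Blk_def by blast
      then show "x \<in> (\<lambda>v. blk z (v $ 0) (v $ 1)) ` int_vecs OB 2"
        by (intro image_eqI[of _ _ "vec_of_list [c, d]"]) (simp_all add: iv carrier_dim_vec)
    next
      fix x assume "x \<in> (\<lambda>v. blk z (v $ 0) (v $ 1)) ` int_vecs OB 2"
      then obtain w where w: "x = blk z (w $ 0) (w $ 1)" "w \<in> int_vecs OB 2" by (rule imageE)
      have "w $ 0 \<in> OB" "w $ 1 \<in> OB" using w(2) unfolding iv by simp_all
      then show "x \<in> Blk z" unfolding Blk_def using w(1) by (intro CollectI exI conjI)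
    qed
  qed
qed

end


subsection \<open>Coordinates of orthogonal sums of planes\<close>

lemma gram_2:
  fixes x y :: "'b::division_ring vec"
  assumes "x \<in> carrier_vec 2" "y \<in> carrier_vec 2"
  shows "gram_pairing f (mat_of_rows_list 2 [[0, 1], [-1, 0]]) x y = f (x $ 0) * y $ 1 - f (x $ 1) * y $ 0"
  using carrier_vecD[OF assms(1)] carrier_vecD[OF assms(2)]
  by (simp add: gram_pairing_def scalar_prod_def mat_of_rows_list_def numeral_2_eq_2)

lemma gram_4:
  fixes x y :: "'b::division_ring vec"
  assumes "x \<in> carrier_vec 4" "y \<in> carrier_vec 4"
  shows "gram_pairing f (mat_of_rows_list 4 [[0, 0, 0, 1], [0, 0, -1, 0], [0, 1, 0, 0], [-1, 0, 0, 0]]) x y =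
    f (x $ 0) * y $ 3 - f (x $ 1) * y $ 2 + f (x $ 2) * y $ 1 - f (x $ 3) * y $ 0"
  using carrier_vecD[OF assms(1)] carrier_vecD[OF assms(2)]
  by (simp add: gram_pairing_def scalar_prod_def mat_of_rows_list_def eval_nat_numeral)

lemma orthogonal_sum_Cons:
  "fst (orthogonal_sum (m # ms)) = direct_sum (fst m # map fst ms)"
  "snd (orthogonal_sum (m # ms)) =
    four_block_mat (snd m) (0\<^sub>m (dim_row (snd m)) (dim_col (snd (orthogonal_sum ms))))
      (0\<^sub>m (dim_row (snd (orthogonal_sum ms))) (dim_col (snd m))) (snd (orthogonal_sum ms))"
  by (simp_all add: orthogonal_sum_def Let_def)

context bimod
begin

fun bM :: "plane_kind \<Rightarrow> 'b gram_bilattice" where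
  "bM H4 = bilat_M4" | "bM H5 = bilat_M5 \<omega>" | "bM H6 = bilat_M6 \<iota> K \<sigma> \<pi> \<omega>"

definition gram_rep :: "'b gram_bilattice \<Rightarrow> 'v set \<Rightarrow> ('b vec \<Rightarrow> 'v) \<Rightarrow> bool" where
  "gram_rep m N G \<longleftrightarrow> rep (fst m) N G \<and> snd m \<in> carrier_mat (fst (fst m)) (fst (fst m)) \<and>
     (\<forall>x\<in>int_vecs OB (fst (fst m)). \<forall>y\<in>int_vecs OB (fst (fst m)). q (G x) (G y) = gram_pairing bar (snd m) x y)"

lemma plane_pm: assumes "plane h e f" shows "pl e \<or> mi e" "pl f \<or> mi f"
  using assms by (cases h; auto simp: plane_def pl_def[symmetric] mi_def[symmetric] dest: rel_KO_pl rel_KP_mi)+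

text \<open>With \<open>q_W_self\<close> an isotropic generator spans a totally isotropic
  block.\<close>

lemma isotropic_Blk:
  assumes "pl e \<or> mi e" "q e e = 0" "x \<in> Blk e"
  shows "q e x = 0" "q (W e) x = 0"
proof -
  have "q e (W e) = 0" "q (W e) e = 0" using q_W_self[OF assms(1)] q_zero_sym[of "W e" e] by auto
  moreover obtain c d where "x = blk e c d" using assms(3) by (auto simp: Blk_def)
  ultimately show "q e x = 0" "q (W e) x = 0" using assms(2) by (simp_all add: blk_def q_add q_rs_right q_W_W)
qed

lemma plane_isotropic: assumes "plane h e f" shows "q e e = 0" "q f f = 0"
  using assms by (auto simp: plane_def)

text \<open>A common vector is orthogonal to both isotropic blocks, hence to the whole
  plane.\<close>

lemma plane_disjoint: assumes p: "plane h e f" and x: "x \<in> Blk e" "x \<in> Blk f" shows "x = 0"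
proof -
  obtain k l where r: "rel k e" "rel l f" using plane_rel p by blast
  have "0 \<in> Blk f" using r sub_0 sub_Blk by blast
  then have "x + 0 \<in> Hsp e f" unfolding Hsp_def using x(1) by blast
  moreover have "q g x = 0" if "g \<in> Hsp e f" for g
    using isotropic_Blk[OF plane_pm(1)[OF p] plane_isotropic(1)[OF p] x(1)]
      isotropic_Blk[OF plane_pm(2)[OF p] plane_isotropic(2)[OF p] x(2)]
    by (intro Hsp_perp[OF r that])
  ultimately show ?thesis using plane_nondeg[OF p, of x] by simp
qed

lemma Hsp_sumset: "Hsp e f = sumset (Blk e) (sumset (Blk f) {0})"
  unfolding sumset_0 by (simp add: Hsp_def sumset_def)

text \<open>The trailing 0 and the doubled selection of entries come from the empty list at which
  \<open>direct_sum\<close> ends.\<close>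

lemma rep_pair:
  assumes p: "plane h e f" and 1: "rep a (Blk e) G1" and 2: "rep b (Blk f) G2"
  shows "rep (direct_sum [a, b]) (Hsp e f)
    (\<lambda>v. G1 (vec_first v (fst a)) + (G2 (vec_first (vec_last v (fst (direct_sum [b]))) (fst b)) + 0))"
proof -
  obtain k l where r: "rel k e" "rel l f" using plane_rel p by blast
  have s0: "sub {0}" by (simp add: sub_def)
  have s: "sub (Blk e)" "sub (Blk f)" using r sub_Blk by blast+
  note rb = rep_append[OF 2 rep_Nil s(2) s0]
  show ?thesis unfolding Hsp_sumset
    by (rule rep_append[OF 1 rb s(1)])
      (use s(2) plane_disjoint[OF p] in \<open>auto simp: sumset_0\<close>)
qed

lemma plane_gram_rep: assumes p: "plane h e f" shows "\<exists>G. gram_rep (bM h) (Hsp e f) G"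
proof (cases "h = H6")
  case True
  note G = plane6_gram[OF p[unfolded True]]
  have r: "rel K1 e" "rel K2 f" using p True by (auto simp: plane_def)
  \<comment> \<open>Coefficients along \<open>e\<close> are recovered by pairing with the block of
    \<open>f\<close>, and conversely.\<close>
  have fe: "c = 0 \<and> d = 0" if z: "blk e c d = 0" for c d
  proof -
    have "q f (blk e c d) = d" "q (W f) (blk e c d) = - c" by (simp_all add: blk_def q_add q_rs_right G)
    then show ?thesis using z by simp
  qed
  have ff: "c = 0 \<and> d = 0" if z: "blk f c d = 0" for c d
  proof -
    have "q e (blk f c d) = d" "q (W e) (blk f c d) = - c" by (simp_all add: blk_def q_add q_rs_right G)
    then show ?thesis using z by simp
  qed
  have R1: "rep (ebd K1) (Blk e) (\<lambda>v. blk e (v $ 0) (v $ 1))" by (rule rep_big) (use r fe in auto)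
  have R2: "rep (ebd K2) (Blk f) (\<lambda>v. blk f (v $ 0) (v $ 1))" by (rule rep_big) (use r ff in auto)
  define GG where "GG v = blk e (vec_first v 2 $ 0) (vec_first v 2 $ 1) +
    (blk f (vec_first (vec_last v 2) 2 $ 0) (vec_first (vec_last v 2) 2 $ 1) + 0)" for v
  have f2: "fst (direct_sum [ebd K2]) = 2" "fst (direct_sum [ebd K1, ebd K2]) = 4"
    by (simp_all add: direct_sum_Cons direct_sum_Nil del: ebd.simps)
  have R: "rep (direct_sum [ebd K1, ebd K2]) (Hsp e f) GG"
    using rep_pair[OF p R1 R2] unfolding f2 fst_ebd GG_def .
  have GG: "GG x = blk e (x $ 0) (x $ 1) + blk f (x $ 2) (x $ 3)" if "x \<in> carrier_vec 4" for x
    using carrier_vecD[OF that] by (simp add: GG_def vec_first_def vec_last_def eval_nat_numeral)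
  have bm: "bM h = (direct_sum [ebd K1, ebd K2],
      mat_of_rows_list 4 [[0, 0, 0, 1], [0, 0, -1, 0], [0, 1, 0, 0], [-1, 0, 0, 0]])"
    by (simp add: True bilat_M6_def)
  have "q (GG x) (GG y) =
      gram_pairing bar (mat_of_rows_list 4 [[0, 0, 0, 1], [0, 0, -1, 0], [0, 1, 0, 0], [-1, 0, 0, 0]]) x y"
    if "x \<in> carrier_vec 4" "y \<in> carrier_vec 4" for x y
    unfolding GG[OF that(1)] GG[OF that(2)] gram_4[OF that]
    by (simp add: blk_def q_add q_add_left q_rs q_rs_right G)
  moreover have "mat_of_rows_list 4 [[0, 0, 0, 1], [0, 0, -1, 0], [0, 1, 0, 0], [-1, 0, 0, 0 :: 'b]] \<in> carrier_mat 4 4"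
    by (simp add: mat_of_rows_list_def eval_nat_numeral)
  ultimately have "gram_rep (bM h) (Hsp e f) GG"
    unfolding gram_rep_def bm fst_conv snd_conv f2 using R int_vecs_carrier by blast
  then show ?thesis by blast
next
  case False
  then have h: "h = H4 \<or> h = H5" by (cases h) auto
  define k where "k = (if h = H4 then KO else KP)"
  have k: "k = KO \<or> k = KP" by (auto simp: k_def)
  have G: "q e e = 0" "q f f = 0" "q e f = 1" and r: "rel k e" "rel k f"
    using p h by (auto simp: plane_def k_def)
  then have G': "q f e = -1" using q_swap_1 by blast
  have fe: "c = 0" if z: "rs e c = 0" for c
  proof -
    have "q f (rs e c) = - c" by (simp add: q_rs_right G')
    then show ?thesis using z by simp
  qed
  have ff: "c = 0" if z: "rs f c = 0" for c
  proof -
    have "q e (rs f c) = c" by (simp add: q_rs_right G)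
    then show ?thesis using z by simp
  qed
  note R1 = rep_small[OF k r(1) fe] and R2 = rep_small[OF k r(2) ff]
  define GG where "GG v = rs e (vec_first v 1 $ 0) + (rs f (vec_first (vec_last v 1) 1 $ 0) + 0)" for v
  have f1: "fst (ebd k) = 1" using k fst_ebd(1,2) by blast
  have f2: "fst (direct_sum [ebd k]) = 1" "fst (direct_sum [ebd k, ebd k]) = 2"
    by (simp_all add: direct_sum_Cons direct_sum_Nil f1 del: ebd.simps)
  have R: "rep (direct_sum [ebd k, ebd k]) (Hsp e f) GG"
    using rep_pair[OF p R1 R2] unfolding f2 f1 GG_def .
  have GG: "GG x = rs e (x $ 0) + rs f (x $ 1)" if "x \<in> carrier_vec 2" for x
    using carrier_vecD[OF that] by (simp add: GG_def vec_first_def vec_last_def)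
  have bm: "bM h = (direct_sum [ebd k, ebd k], mat_of_rows_list 2 [[0, 1], [-1, 0]])"
    using h by (auto simp: k_def bilat_M4_def bilat_M5_def)
  have "q (GG x) (GG y) = gram_pairing bar (mat_of_rows_list 2 [[0, 1], [-1, 0]]) x y"
    if "x \<in> carrier_vec 2" "y \<in> carrier_vec 2" for x y
    unfolding GG[OF that(1)] GG[OF that(2)] gram_2[OF that]
    by (simp add: q_add q_add_left q_rs q_rs_right G G')
  moreover have "mat_of_rows_list 2 [[0, 1], [-1, 0 :: 'b]] \<in> carrier_mat 2 2"
    by (simp add: mat_of_rows_list_def numeral_2_eq_2)
  ultimately have "gram_rep (bM h) (Hsp e f) GG"
    unfolding gram_rep_def bm fst_conv snd_conv f2 using R int_vecs_carrier by blast
  then show ?thesis by blast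
qed

lemma gram_rep_append:
  assumes 1: "gram_rep m A G1" and 2: "gram_rep (orthogonal_sum ms) B G2"
    and sub: "sub A" "sub B" and perp: "\<And>x y. x \<in> A \<Longrightarrow> y \<in> B \<Longrightarrow> q x y = 0"
    and disj: "\<And>x. x \<in> A \<Longrightarrow> x \<in> B \<Longrightarrow> x = 0"
  shows "\<exists>G. gram_rep (orthogonal_sum (m # ms)) (sumset A B) G"
proof -
  define n l where "n = fst (fst m)" and "l = fst (fst (orthogonal_sum ms))"
  have ds: "direct_sum (map fst ms) = fst (orthogonal_sum ms)" by (simp add: orthogonal_sum_def)
  have r: "rep (fst m) A G1" "rep (direct_sum (map fst ms)) B G2"
    using 1 2 unfolding gram_rep_def ds by blast+
  define G where "G v = G1 (vec_first v n) + G2 (vec_last v l)" for v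
  have C: "snd m \<in> carrier_mat n n" "snd (orthogonal_sum ms) \<in> carrier_mat l l"
    using 1 2 unfolding gram_rep_def n_def l_def by blast+
  have R: "rep (fst (orthogonal_sum (m # ms))) (sumset A B) G"
    using rep_append[OF r sub disj] unfolding orthogonal_sum_Cons G_def n_def l_def ds .
  have f: "fst (fst (orthogonal_sum (m # ms))) = n + l"
    unfolding orthogonal_sum_Cons direct_sum_Cons ds n_def l_def ..
  have s: "snd (orthogonal_sum (m # ms)) =
      four_block_mat (snd m) (0\<^sub>m n l) (0\<^sub>m l n) (snd (orthogonal_sum ms))"
    unfolding orthogonal_sum_Cons using C by (metis carrier_matD)
  have G: "G (a @\<^sub>v b) = G1 a + G2 b" if "a \<in> int_vecs OB n" "b \<in> int_vecs OB l" for a b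
    unfolding G_def vec_first_append[OF int_vecs_carrier[OF that(1)]] vec_last_append[OF int_vecs_carrier[OF that(2)]] ..
  have G1A: "G1 a \<in> A" if "a \<in> int_vecs OB n" for a
    using r(1) that unfolding rep_def n_def bij_betw_def by blast
  have G2B: "G2 b \<in> B" if "b \<in> int_vecs OB l" for b
    using r(2) that unfolding rep_def l_def ds bij_betw_def by blast
  have q1: "q (G1 a) (G1 a') = gram_pairing bar (snd m) a a'" if "a \<in> int_vecs OB n" "a' \<in> int_vecs OB n" for a a'
    using 1 that unfolding gram_rep_def n_def by blast
  have q2: "q (G2 a) (G2 a') = gram_pairing bar (snd (orthogonal_sum ms)) a a'"
    if "a \<in> int_vecs OB l" "a' \<in> int_vecs OB l" for a a'
    using 2 that unfolding gram_rep_def l_def by blast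
  have "q (G x) (G y) = gram_pairing bar (snd (orthogonal_sum (m # ms))) x y"
    if xy: "x \<in> int_vecs OB (n + l)" "y \<in> int_vecs OB (n + l)" for x y
  proof -
    obtain a b where x: "x = a @\<^sub>v b" "a \<in> int_vecs OB n" "b \<in> int_vecs OB l" using xy(1) by (rule int_vecs_appendE)
    obtain a' b' where y: "y = a' @\<^sub>v b'" "a' \<in> int_vecs OB n" "b' \<in> int_vecs OB l" using xy(2) by (rule int_vecs_appendE)
    have "q (G1 a) (G2 b') = 0" "q (G2 b) (G1 a') = 0"
      using perp[OF G1A[OF x(2)] G2B[OF y(3)]] perp[OF G1A[OF y(2)] G2B[OF x(3)]] q_zero_sym by blast+
    then have "q (G x) (G y) = gram_pairing bar (snd m) a a' + gram_pairing bar (snd (orthogonal_sum ms)) b b'"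
      using G x y q1 q2 by (simp add: q_add q_add_left)
    also have "\<dots> = gram_pairing bar (snd (orthogonal_sum (m # ms))) x y"
      unfolding s x(1) y(1) using x y C int_vecs_carrier by (intro gram_append[symmetric]) blast+
    finally show ?thesis .
  qed
  moreover have "snd (orthogonal_sum (m # ms)) \<in> carrier_mat (n + l) (n + l)"
    unfolding s using C by (rule four_block_carrier_mat)
  ultimately have "gram_rep (orthogonal_sum (m # ms)) (sumset A B) G"
    unfolding gram_rep_def f using R by blast
  then show ?thesis by blast
qed

lemma hyp_sum_gram_rep: "hyp_sum N ps \<Longrightarrow> \<exists>G. gram_rep (orthogonal_sum (map bM ps)) N G"
proof (induction rule: hyp_sum.induct)
  case Nil
  have "gram_rep (orthogonal_sum []) {0} (\<lambda>v. 0)"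
    using rep_Nil by (simp add: gram_rep_def orthogonal_sum_def direct_sum_Nil gram_pairing_def scalar_prod_def)
  then show ?case by auto
next
  case (Cons N ps h e f)
  obtain G1 where G1: "gram_rep (bM h) (Hsp e f) G1" using plane_gram_rep Cons by blast
  obtain G2 where G2: "gram_rep (orthogonal_sum (map bM ps)) N G2" using Cons.IH by blast
  have "x = 0" if "x \<in> Hsp e f" "x \<in> N" for x
    using plane_nondeg[OF Cons.hyps(2) that(1)] Cons.hyps(3) that(2) by blast
  then show ?case using gram_rep_append[OF G1 G2] sub_plane hyp_sum_sub Cons.hyps by auto
qed

subsection \<open>Hyperbolic sums are self-dual\<close>

lemma plane_integral: assumes p: "plane h e f" and xy: "x \<in> Hsp e f" "y \<in> Hsp e f" shows "q x y \<in> OB"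
proof (cases "h = H6")
  case True
  note G = plane6_gram[OF p[unfolded True]]
  obtain a b c d where x: "x = blk e a b + blk f c d" "a \<in> OB" "b \<in> OB" "c \<in> OB" "d \<in> OB" using xy(1) by (rule Hsp_blkE)
  obtain a' b' c' d' where y: "y = blk e a' b' + blk f c' d'" "a' \<in> OB" "b' \<in> OB" "c' \<in> OB" "d' \<in> OB"
    using xy(2) by (rule Hsp_blkE)
  have "q x y = bar a * d' - bar b * c' + bar c * b' - bar d * a'"
    unfolding x(1) y(1) by (simp add: blk_def q_add q_add_left q_rs q_rs_right G)
  then show ?thesis using x y by (simp add: OB_closed bar_OB)
next
  case False
  then have h: "h = H4 \<or> h = H5" by (cases h) auto
  then have G: "q e e = 0" "q f f = 0" "q e f = 1" using p by (auto simp: plane_def)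
  then have G': "q f e = -1" using q_swap_1 by blast
  obtain c d where x: "x = rs e c + rs f d" "c \<in> OB" "d \<in> OB" using xy(1) plane45_Hsp[OF p h] by auto
  obtain c' d' where y: "y = rs e c' + rs f d'" "c' \<in> OB" "d' \<in> OB" using xy(2) plane45_Hsp[OF p h] by auto
  have "q x y = bar c * d' - bar d * c'"
    unfolding x(1) y(1) by (simp add: q_add q_add_left q_rs q_rs_right G G')
  then show ?thesis using x y by (simp add: OB_closed bar_OB)
qed

text \<open>For \<open>a = 0\<close> this is nondegeneracy, for \<open>a \<noteq> 0\<close> self-duality.\<close>

lemma plane_divide:
  assumes p: "plane h e f" and x: "x \<in> Hsp e f" and div: "\<And>y. y \<in> Hsp e f \<Longrightarrow> \<exists>t\<in>OB. q x y = \<iota> a * t"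
  shows "\<exists>y\<in>Hsp e f. x = rs y (\<iota> a)"
proof -
  obtain k l where r: "rel k e" "rel l f" using plane_rel p by blast
  have H: "sub (Hsp e f)" "e \<in> Hsp e f" "f \<in> Hsp e f" using sub_Hsp Hsp_self r by auto
  have HW: "W e \<in> Hsp e f" "W f \<in> Hsp e f" using H sub_W by auto
  have sw: "\<exists>t\<in>OB. q y x = t * \<iota> a" if "y \<in> Hsp e f" for y
  proof -
    obtain t where "t \<in> OB" "q x y = \<iota> a * t" using div[OF \<open>y \<in> Hsp e f\<close>] by blast
    moreover have "q y x = - bar (q x y)" by (rule q_skew)
    ultimately have "q y x = (- bar t) * \<iota> a" "- bar t \<in> OB" by (simp_all add: bar_mult bar_OB OB_closed)
    then show ?thesis by blast
  qed
  show ?thesis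
  proof (cases "h = H6")
    case True
    note G = plane6_gram[OF p[unfolded True]]
    obtain c1 c2 c3 c4 where x: "x = blk e c1 c2 + blk f c3 c4" using x by (rule Hsp_blkE)
    have "q e x = c4" "q (W e) x = - c3" "q f x = c2" "q (W f) x = - c1"
      unfolding x by (simp_all add: blk_def q_add q_rs_right G)
    moreover obtain t1 t2 t3 t4 where "t1 \<in> OB" "t2 \<in> OB" "t3 \<in> OB" "t4 \<in> OB"
      "q e x = t4 * \<iota> a" "q (W e) x = t3 * \<iota> a" "q f x = t2 * \<iota> a" "q (W f) x = t1 * \<iota> a"
      using sw H HW by metis
    ultimately have c: "c1 = (- t1) * \<iota> a" "c2 = t2 * \<iota> a" "c3 = (- t3) * \<iota> a" "c4 = t4 * \<iota> a"
      by (metis minus_minus mult_minus_left)+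
    have "x = rs (blk e (- t1) t2 + blk f (- t3) t4) (\<iota> a)"
      unfolding x c by (simp only: blk_def rs_add rs_mult)
    moreover have "blk e (- t1) t2 + blk f (- t3) t4 \<in> Hsp e f"
      using \<open>t1 \<in> OB\<close> \<open>t2 \<in> OB\<close> \<open>t3 \<in> OB\<close> \<open>t4 \<in> OB\<close> by (intro Hsp_blkI) (auto simp: OB_closed)
    ultimately show ?thesis by blast
  next
    case False
    then have h: "h = H4 \<or> h = H5" by (cases h) auto
    then have G: "q e e = 0" "q f f = 0" "q e f = 1" using p by (auto simp: plane_def)
    then have G': "q f e = -1" using q_swap_1 by blast
    obtain c d where x: "x = rs e c + rs f d" using x plane45_Hsp[OF p h] by auto
    have "q e x = d" "q f x = - c" unfolding x by (simp_all add: q_add q_rs_right G G')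
    moreover obtain t1 t2 where "t1 \<in> OB" "t2 \<in> OB" "q e x = t2 * \<iota> a" "q f x = t1 * \<iota> a" using sw H by metis
    ultimately have c: "c = (- t1) * \<iota> a" "d = t2 * \<iota> a" by (metis minus_minus mult_minus_left)+
    have "x = rs (rs e (- t1) + rs f t2) (\<iota> a)" unfolding x c by (simp only: rs_add rs_mult)
    moreover have "rs e (- t1) + rs f t2 \<in> Hsp e f"
      unfolding plane45_Hsp[OF p h] using \<open>t1 \<in> OB\<close> \<open>t2 \<in> OB\<close> OB_closed(6) by blast
    ultimately show ?thesis by blast
  qed
qed

lemma hyp_sum_integral: "hyp_sum N ps \<Longrightarrow> x \<in> N \<Longrightarrow> y \<in> N \<Longrightarrow> q x y \<in> OB"
proof (induction arbitrary: x y rule: hyp_sum.induct)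
  case (Cons N ps h e f)
  obtain g n where x: "x = g + n" "g \<in> Hsp e f" "n \<in> N" using Cons.prems(1) unfolding sumset_def by blast
  obtain g' n' where y: "y = g' + n'" "g' \<in> Hsp e f" "n' \<in> N" using Cons.prems(2) unfolding sumset_def by blast
  have "q g n' = 0" "q n g' = 0" using Cons.hyps(3) x y q_zero_sym by blast+
  then have "q x y = q g g' + q n n'" unfolding x(1) y(1) by (simp add: q_add q_add_left)
  then show ?case using plane_integral[OF Cons.hyps(2)] Cons.IH x y OB_closed(3) by simp
qed (simp add: OB_closed)

text \<open>By orthogonality each component of \<open>x\<close> can be tested inside its own plane,
  where \<open>plane_divide\<close> applies.\<close>

lemma hyp_sum_divide:
  "hyp_sum N ps \<Longrightarrow> x \<in> N \<Longrightarrow> (\<And>y. y \<in> N \<Longrightarrow> \<exists>t\<in>OB. q x y = \<iota> a * t) \<Longrightarrow> \<exists>y\<in>N. x = rs y (\<iota> a)"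
proof (induction arbitrary: x rule: hyp_sum.induct)
  case (Cons N ps h e f)
  obtain g n where x: "x = g + n" "g \<in> Hsp e f" "n \<in> N" using Cons.prems(1) unfolding sumset_def by blast
  have 0: "0 \<in> N" "0 \<in> Hsp e f" using hyp_sum_sub sub_0 plane_0 Cons.hyps by blast+
  have "\<exists>t\<in>OB. q g y = \<iota> a * t" if y: "y \<in> Hsp e f" for y
  proof -
    have "q n y = 0" using Cons.hyps(3)[OF y x(3)] q_zero_sym by blast
    then have "q x y = q g y" unfolding x(1) by (simp add: q_add_left)
    moreover have "y + 0 \<in> sumset (Hsp e f) N" unfolding sumset_def using y 0 by blast
    ultimately show ?thesis using Cons.prems(2)[of y] by simp
  qed
  then obtain g' where g': "g' \<in> Hsp e f" "g = rs g' (\<iota> a)" using plane_divide[OF Cons.hyps(2) x(2)] by blast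
  have "\<exists>t\<in>OB. q n y = \<iota> a * t" if y: "y \<in> N" for y
  proof -
    have "q g y = 0" using Cons.hyps(3)[OF x(2) y] .
    then have "q x y = q n y" unfolding x(1) by (simp add: q_add_left)
    moreover have "0 + y \<in> sumset (Hsp e f) N" unfolding sumset_def using y 0 by blast
    ultimately show ?thesis using Cons.prems(2)[of y] by simp
  qed
  then obtain n' where n': "n' \<in> N" "n = rs n' (\<iota> a)" using Cons.IH[OF x(3)] by blast
  have "x = rs (g' + n') (\<iota> a)" using x g' n' by (simp add: rs_add)
  then show ?case unfolding sumset_def using g' n' by blast
qed auto

end


section \<open>A model of the standard bilattices\<close>

text \<open>The ambient bimodule consists of all functions \<open>f\<close>, where \<open>f i\<close> holds the coordinates in the
  \<open>i\<close>-th summand, of kind \<open>Kd i\<close>; the second coordinate is idle for \<open>KO\<close> and \<open>KP\<close>.\<close>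

context quat
begin

definition "ka \<alpha> = fst (K_coords K \<omega> \<alpha>)"
definition "kb \<alpha> = snd (K_coords K \<omega> \<alpha>)"

lemma ka_kb: "a \<in> K \<Longrightarrow> b \<in> K \<Longrightarrow> ka (a + b * \<omega>) = a" "a \<in> K \<Longrightarrow> b \<in> K \<Longrightarrow> kb (a + b * \<omega>) = b"
  by (simp_all add: ka_def kb_def K_coords)

lemma ka_kb_K: "ka x \<in> K" "kb x \<in> K" "x = ka x + kb x * \<omega>"
proof -
  obtain a b where "a \<in> K" "b \<in> K" "x = a + b * \<omega>" using B_decomp by blast
  then show "ka x \<in> K" "kb x \<in> K" "x = ka x + kb x * \<omega>" using ka_kb by auto
qed

lemma kc_add: "ka (x + y) = ka x + ka y" "kb (x + y) = kb x + kb y"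
proof -
  have "x + y = (ka x + ka y) + (kb x + kb y) * \<omega>"
    by (subst ka_kb_K(3)[of x], subst ka_kb_K(3)[of y]) (simp add: algebra_simps)
  then show "ka (x + y) = ka x + ka y" "kb (x + y) = kb x + kb y"
    using ka_kb[of "ka x + ka y" "kb x + kb y"] ka_kb_K K_add by simp_all
qed

lemma kc_mult:
  "ka (x * y) = ka x * ka y + kb x * \<sigma> (kb y) * \<iota> \<pi>" "kb (x * y) = ka x * kb y + kb x * \<sigma> (ka y)"
proof -
  have "kb x * \<omega> * (kb y * \<omega>) = kb x * (\<omega> * kb y) * \<omega>" by (simp add: mult.assoc)
  also have "\<dots> = kb x * \<sigma> (kb y) * (\<omega> * \<omega>)" by (simp add: omega_K ka_kb_K mult.assoc)
  finally have 1: "kb x * \<omega> * (kb y * \<omega>) = kb x * \<sigma> (kb y) * \<iota> \<pi>" by (simp add: omega_sq)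
  have 2: "kb x * \<omega> * ka y = kb x * \<sigma> (ka y) * \<omega>" by (simp add: omega_K ka_kb_K mult.assoc)
  have "x * y = (ka x + kb x * \<omega>) * (ka y + kb y * \<omega>)" using ka_kb_K(3) by metis
  also have "\<dots> = ka x * ka y + kb x * \<omega> * ka y + (ka x * (kb y * \<omega>) + kb x * \<omega> * (kb y * \<omega>))"
    by (simp only: distrib_left distrib_right)
  also have "\<dots> = (ka x * ka y + kb x * \<sigma> (kb y) * \<iota> \<pi>) + (ka x * kb y + kb x * \<sigma> (ka y)) * \<omega>"
    unfolding 1 2 by (simp add: algebra_simps)
  finally show "ka (x * y) = ka x * ka y + kb x * \<sigma> (kb y) * \<iota> \<pi>" "kb (x * y) = ka x * kb y + kb x * \<sigma> (ka y)"
    using ka_kb[of "ka x * ka y + kb x * \<sigma> (kb y) * \<iota> \<pi>" "ka x * kb y + kb x * \<sigma> (ka y)"]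
      ka_kb_K K_add K_mult sigma_K by simp_all
qed

lemma kc_K: "x \<in> K \<Longrightarrow> ka x = x" "x \<in> K \<Longrightarrow> kb x = 0" "ka \<omega> = 0" "kb \<omega> = 1"
  using ka_kb[of x 0] ka_kb[of 0 1] by simp_all

lemma kc_bar: "ka (bar x) = \<sigma> (ka x)" "kb (bar x) = - kb x"
proof -
  have "bar x = bar (ka x + kb x * \<omega>)" using ka_kb_K(3) by metis
  also have "\<dots> = \<sigma> (ka x) + (- kb x) * \<omega>" by (simp add: bar_add bar_K bar_K_omega ka_kb_K)
  finally show "ka (bar x) = \<sigma> (ka x)" "kb (bar x) = - kb x"
    using ka_kb[of "\<sigma> (ka x)" "- kb x"] ka_kb_K sigma_K K_minus by simp_all
qed

lemma kc_R: assumes "x \<in> OB" shows "ka x \<in> R" "kb x \<in> R"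
proof -
  obtain a b where "x = a + b * \<omega>" "a \<in> R" "b \<in> R" using assms OB_eq by auto
  then show "ka x \<in> R" "kb x \<in> R" using ka_kb R_K by simp_all
qed

lemma pi_OB: "\<iota> \<pi> \<in> OB"
  unfolding omega_sq[symmetric] using OB_closed(5) omega_OB by blast

text \<open>For \<open>K1\<close> and \<open>K2\<close> these are the matrices of the two
  embeddings, with \<open>\<alpha>\<close> now ranging over all of B. \<open>KO\<close> and
  \<open>KP\<close> also act on the idle coordinate, so that the module laws hold on all
  functions.\<close>

fun act :: "kind \<Rightarrow> 'b \<Rightarrow> 'b \<times> 'b \<Rightarrow> 'b \<times> 'b" where
  "act KO \<alpha> x = (\<alpha> * fst x, \<alpha> * snd x)"
| "act KP \<alpha> x = (inverse \<omega> * \<alpha> * \<omega> * fst x, inverse \<omega> * \<alpha> * \<omega> * snd x)"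
| "act K1 \<alpha> x = (ka \<alpha> * fst x + kb \<alpha> * \<iota> \<pi> * snd x, \<sigma> (kb \<alpha>) * fst x + \<sigma> (ka \<alpha>) * snd x)"
| "act K2 \<alpha> x = (\<sigma> (ka \<alpha>) * fst x + \<sigma> (kb \<alpha>) * \<iota> \<pi> * snd x, kb \<alpha> * fst x + ka \<alpha> * snd x)"

definition scale :: "'b \<times> 'b \<Rightarrow> 'b \<Rightarrow> 'b \<times> 'b" where
  "scale x \<beta> = (fst x * \<beta>, snd x * \<beta>)"

lemma act_add: "act k \<alpha> (x + y) = act k \<alpha> x + act k \<alpha> y"
  by (cases k) (simp_all add: distrib_left)

lemma act_add_left: "act k (\<alpha> + \<beta>) x = act k \<alpha> x + act k \<beta> x"
  by (cases k) (simp_all add: distrib_left distrib_right kc_add sigma_add ka_kb_K)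

lemma act_1: "act k 1 x = x"
  by (cases k) (simp_all add: kc_K)

lemma act_scale: "scale (act k \<alpha> x) \<beta> = act k \<alpha> (scale x \<beta>)"
  by (cases k) (simp_all add: scale_def distrib_right mult.assoc)

lemma act_iota: "act k (\<iota> c) x = scale x (\<iota> c)"
proof -
  have "inverse \<omega> * \<iota> c * \<omega> = \<iota> c"
    using iota_commute[of c \<omega>] by (simp add: mult.assoc) (simp flip: mult.assoc)
  then show ?thesis by (cases k) (simp_all add: scale_def kc_K iota_commute[of c "fst x"] iota_commute[of c "snd x"])
qed

lemma act_mult: "act k (\<alpha> * \<beta>) x = act k \<alpha> (act k \<beta> x)"
proof -
  define p where "p = \<iota> \<pi>"
  have p: "p \<in> K" "\<sigma> p = p" by (simp_all add: p_def)
  have pc: "p * (u * w) = u * (p * w)" for u w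
    unfolding p_def using iota_commute[of \<pi> u] by (simp flip: mult.assoc)
  note K = ka_kb_K[of \<alpha>] ka_kb_K[of \<beta>]
  note sK = sigma_K[OF K(1)] sigma_K[OF K(2)] sigma_K[OF K(4)] sigma_K[OF K(5)]
  have s: "\<sigma> (ka \<alpha> * ka \<beta> + kb \<alpha> * \<sigma> (kb \<beta>) * p) = \<sigma> (ka \<alpha>) * \<sigma> (ka \<beta>) + \<sigma> (kb \<alpha>) * kb \<beta> * p"
    "\<sigma> (ka \<alpha> * kb \<beta> + kb \<alpha> * \<sigma> (ka \<beta>)) = \<sigma> (ka \<alpha>) * \<sigma> (kb \<beta>) + \<sigma> (kb \<alpha>) * ka \<beta>"
    using K sK p by (simp_all add: sigma_add sigma_mult sigma_sigma K_mult)
  \<comment> \<open>\<open>1\<close> and \<open>2\<close> are the two rows of the matrix product for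
    arbitrary entries. \<open>K2\<close> is the conjugate of \<open>K1\<close>, so both cases are
    instances.\<close>
  have 1: "(a * a' + b * c' * p) * y + (a * b' + b * d') * p * z = a * (a' * y + b' * p * z) + b * p * (c' * y + d' * z)"
    for a a' b b' c' d' y z
    by (simp add: distrib_left distrib_right mult.assoc pc[of c'] pc[of d'] add.assoc add.left_commute)
  have 2: "(a * b' + b * d') * y + (a * a' + b * c' * p) * z = b * (d' * y + c' * p * z) + a * (b' * y + a' * z)"
    for a a' b b' c' d' y z
    by (simp add: distrib_left distrib_right mult.assoc add.assoc add.left_commute)
  have w: "\<omega> * (inverse \<omega> * u) = u" for u by (simp flip: mult.assoc)
  show ?thesis
  proof (cases k)
    case KP
    then show ?thesis by (simp add: mult.assoc w)
  next
    case K1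
    then show ?thesis unfolding K1 act.simps kc_mult fst_conv snd_conv p_def[symmetric] by (simp only: s 1 2)
  next
    case K2
    then show ?thesis unfolding K2 act.simps kc_mult fst_conv snd_conv p_def[symmetric] by (simp only: s 1 2)
  qed (simp add: mult.assoc)
qed

definition lsm :: "(nat \<Rightarrow> kind) \<Rightarrow> 'b \<Rightarrow> (nat \<Rightarrow> 'b \<times> 'b) \<Rightarrow> nat \<Rightarrow> 'b \<times> 'b" where
  "lsm Kd \<alpha> f = (\<lambda>i. act (Kd i) \<alpha> (f i))"

definition rsm :: "(nat \<Rightarrow> 'b \<times> 'b) \<Rightarrow> 'b \<Rightarrow> nat \<Rightarrow> 'b \<times> 'b" where
  "rsm f \<beta> = (\<lambda>i. scale (f i) \<beta>)"

definition Mlat :: "(nat \<Rightarrow> kind) \<Rightarrow> nat set \<Rightarrow> (nat \<Rightarrow> 'b \<times> 'b) set" where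
  "Mlat Kd I = {f. \<forall>i. fst (f i) \<in> OB \<and> snd (f i) \<in> OB \<and> (Kd i \<notin> {K1, K2} \<longrightarrow> snd (f i) = 0) \<and> (i \<notin> I \<longrightarrow> f i = 0)}"

lemma act_OB: assumes "\<alpha> \<in> OB" "fst x \<in> OB" "snd x \<in> OB" shows "fst (act k \<alpha> x) \<in> OB" "snd (act k \<alpha> x) \<in> OB"
proof -
  have "ka \<alpha> \<in> OB" "kb \<alpha> \<in> OB" "\<sigma> (ka \<alpha>) \<in> OB" "\<sigma> (kb \<alpha>) \<in> OB"
    using kc_R[OF assms(1)] sigma_R R_OB by auto
  then show "fst (act k \<alpha> x) \<in> OB" "snd (act k \<alpha> x) \<in> OB"
    using assms pi_OB omega_conj_OB[OF assms(1)] by (cases k; simp add: OB_closed)+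
qed

lemma act_small: "k \<notin> {K1, K2} \<Longrightarrow> snd x = 0 \<Longrightarrow> snd (act k \<alpha> x) = 0" and act_0: "act k \<alpha> 0 = 0"
  by (cases k; simp add: zero_prod_def)+

lemma scale_0: "scale 0 \<beta> = 0" and scale_1: "scale x 1 = x"
  and scale_mult: "scale x (\<alpha> * \<beta>) = scale (scale x \<alpha>) \<beta>"
  and scale_add: "scale (x + y) \<beta> = scale x \<beta> + scale y \<beta>"
  and scale_add_right: "scale x (\<alpha> + \<beta>) = scale x \<alpha> + scale x \<beta>"
  by (simp_all add: scale_def zero_prod_def mult.assoc distrib_left distrib_right)

lemma Mlat_ls: "f \<in> Mlat Kd I \<Longrightarrow> \<alpha> \<in> OB \<Longrightarrow> lsm Kd \<alpha> f \<in> Mlat Kd I"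
  using act_OB[of \<alpha>] act_small act_0 by (auto simp: Mlat_def lsm_def)

lemma Mlat_rs: "f \<in> Mlat Kd I \<Longrightarrow> \<alpha> \<in> OB \<Longrightarrow> rsm f \<alpha> \<in> Mlat Kd I"
  using scale_0 by (auto simp: Mlat_def rsm_def OB_closed) (auto simp: scale_def OB_closed)

lemma Mlat_add: "f \<in> Mlat Kd I \<Longrightarrow> g \<in> Mlat Kd I \<Longrightarrow> f + g \<in> Mlat Kd I"
  by (auto simp: Mlat_def OB_closed)

lemma model_bimod:
  assumes "\<And>x y z. q (x + y) z = q x z + q y z" "\<And>x y b. q x (rsm y b) = q x y * b"
    "\<And>x y. q y x = - bar (q x y)" "\<And>a x y. q (lsm Kd a x) y = q x (lsm Kd (bar a) y)"
  shows "bimod v \<iota> bar \<sigma> OB K ordB \<pi> \<omega> (lsm Kd) rsm q"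
proof unfold_locales
  fix a b x y c
  show "lsm Kd a (x + y) = lsm Kd a x + lsm Kd a y" by (simp add: fun_eq_iff lsm_def act_add)
  show "lsm Kd (a + b) x = lsm Kd a x + lsm Kd b x" by (simp add: fun_eq_iff lsm_def act_add_left)
  show "lsm Kd (a * b) x = lsm Kd a (lsm Kd b x)" by (simp add: fun_eq_iff lsm_def act_mult)
  show "lsm Kd 1 x = x" by (simp add: fun_eq_iff lsm_def act_1)
  show "rsm (x + y) a = rsm x a + rsm y a" by (simp add: fun_eq_iff rsm_def scale_add)
  show "rsm x (a + b) = rsm x a + rsm x b" by (simp add: fun_eq_iff rsm_def scale_add_right)
  show "rsm x (a * b) = rsm (rsm x a) b" by (simp add: fun_eq_iff rsm_def scale_mult)
  show "rsm x 1 = x" by (simp add: fun_eq_iff rsm_def scale_1)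
  show "rsm (lsm Kd a x) b = lsm Kd a (rsm x b)" by (simp add: fun_eq_iff lsm_def rsm_def act_scale)
  show "lsm Kd (\<iota> c) x = rsm x (\<iota> c)" by (simp add: fun_eq_iff lsm_def rsm_def act_iota)
qed (rule assms)+

end

locale model = quat v \<iota> bar \<sigma> OB K ordB \<pi> \<omega>
  for v :: "'f::field \<Rightarrow> int" and \<iota> :: "'f \<Rightarrow> 'b::division_ring" and bar \<sigma> OB K ordB \<pi> \<omega> +
  fixes Kd :: "nat \<Rightarrow> kind" and q :: "(nat \<Rightarrow> 'b \<times> 'b) \<Rightarrow> (nat \<Rightarrow> 'b \<times> 'b) \<Rightarrow> 'b"
  assumes model_add: "q (x + y) z = q x z + q y z" and model_rs: "q x (rsm y b) = q x y * b"
    and model_skew: "q y x = - bar (q x y)" and model_ls: "q (lsm Kd a x) y = q x (lsm Kd (bar a) y)"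

sublocale model \<subseteq> bimod v \<iota> bar \<sigma> OB K ordB \<pi> \<omega> "lsm Kd" rsm q
  by (rule model_bimod) (rule model_add model_rs model_skew model_ls)+

context model
begin

section \<open>Unit vectors and the standard frame of the model\<close>

definition E :: "nat \<Rightarrow> 'b \<Rightarrow> 'b \<Rightarrow> nat \<Rightarrow> 'b \<times> 'b" where
  "E i c d = (\<lambda>j. if j = i then (c, d) else 0)"

lemma E_ls: "lsm Kd a (E i c d) = E i (fst (act (Kd i) a (c, d))) (snd (act (Kd i) a (c, d)))"
  by (simp add: fun_eq_iff lsm_def E_def act_0)

lemma E_rs: "rsm (E i c d) b = E i (c * b) (d * b)"
  by (simp add: fun_eq_iff rsm_def E_def scale_0) (simp add: scale_def)

lemma E_add: "E i c d + E i c' d' = E i (c + c') (d + d')"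
  by (simp add: fun_eq_iff E_def)

lemma E_W: "Kd i \<in> {K1, K2} \<Longrightarrow> W (E i 1 0) = E i 0 1" "Kd i \<notin> {K1, K2} \<Longrightarrow> W (E i 1 0) = E i \<omega> 0"
  by (cases "Kd i"; simp add: E_ls kc_K)+

lemma E_blk: "Kd i \<in> {K1, K2} \<Longrightarrow> blk (E i 1 0) c d = E i c d"
  "Kd i \<notin> {K1, K2} \<Longrightarrow> blk (E i 1 0) c d = E i (c + \<omega> * d) 0"
  by (simp_all add: blk_def E_W E_rs E_add)

lemma E_rel: "rel (Kd i) (E i 1 0)"
  unfolding rel_def by (cases "Kd i") (auto simp: E_ls E_rs kc_K R_K)

lemma sub_Mlat: "sub (Mlat Kd I)"
  unfolding sub_def using Mlat_add Mlat_ls Mlat_rs by (auto simp: OB_closed Mlat_def[of _ I, THEN eq_refl, THEN subsetD] )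
     (simp add: Mlat_def OB_closed)

lemma E_Mlat: "i \<in> I \<Longrightarrow> c \<in> OB \<Longrightarrow> d \<in> OB \<Longrightarrow> (Kd i \<notin> {K1, K2} \<Longrightarrow> d = 0) \<Longrightarrow> E i c d \<in> Mlat Kd I"
  by (auto simp: Mlat_def E_def OB_closed)

lemma Mlat_single: "f \<in> Mlat Kd {i} \<Longrightarrow> f = E i (fst (f i)) (snd (f i))"
  by (auto simp: Mlat_def E_def fun_eq_iff)

lemma Blk_E: "Blk (E i 1 0) = Mlat Kd {i}"
proof (intro equalityI subsetI)
  fix f assume "f \<in> Blk (E i 1 0)"
  moreover have "E i 1 0 \<in> Mlat Kd {i}" by (rule E_Mlat) (auto simp: OB_closed)
  ultimately show "f \<in> Mlat Kd {i}" using Blk_subset[OF sub_Mlat] by blast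
next
  fix f assume f: "f \<in> Mlat Kd {i}"
  then have c: "fst (f i) \<in> OB" "snd (f i) \<in> OB" "Kd i \<notin> {K1, K2} \<Longrightarrow> snd (f i) = 0" by (auto simp: Mlat_def)
  have "f = blk (E i 1 0) (fst (f i)) (snd (f i))"
    using Mlat_single[OF f] E_blk[of i] c(3) by (cases "Kd i \<in> {K1, K2}") auto
  then show "f \<in> Blk (E i 1 0)" unfolding Blk_def using c by blast
qed

lemma sumset_Mlat: assumes "I \<inter> J = {}" shows "sumset (Mlat Kd I) (Mlat Kd J) = Mlat Kd (I \<union> J)"
proof (intro equalityI subsetI)
  fix f assume "f \<in> sumset (Mlat Kd I) (Mlat Kd J)"
  then obtain g h where fgh: "f = g + h" "g \<in> Mlat Kd I" "h \<in> Mlat Kd J" unfolding sumset_def by blast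
  have "g \<in> Mlat Kd (I \<union> J)" "h \<in> Mlat Kd (I \<union> J)" using fgh by (auto simp: Mlat_def)
  then show "f \<in> Mlat Kd (I \<union> J)" unfolding fgh(1) by (rule Mlat_add)
next
  fix f assume f: "f \<in> Mlat Kd (I \<union> J)"
  define g where "g i = (if i \<in> I then f i else 0)" for i
  define h where "h i = (if i \<in> I then 0 else f i)" for i
  have "g \<in> Mlat Kd I" "h \<in> Mlat Kd J" using f by (auto simp: Mlat_def g_def h_def OB_closed)
  moreover have "f = g + h" by (auto simp: fun_eq_iff g_def h_def)
  ultimately show "f \<in> sumset (Mlat Kd I) (Mlat Kd J)" unfolding sumset_def by blast
qed

lemma rep_single: "\<exists>G. rep (ebd (Kd i)) (Mlat Kd {i}) G"
proof (cases "Kd i \<in> {K1, K2}")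
  case True
  have "rep (ebd (Kd i)) (Blk (E i 1 0)) (\<lambda>v. blk (E i 1 0) (v $ 0) (v $ 1))"
  proof (rule rep_big)
    show "Kd i = K1 \<or> Kd i = K2" using True by simp
    fix c d assume "blk (E i 1 0) c d = 0"
    then have "E i c d i = 0" unfolding E_blk(1)[OF True] by simp
    then show "c = 0 \<and> d = 0" by (simp add: E_def zero_prod_def)
  qed (rule E_rel)
  then show ?thesis unfolding Blk_E by blast
next
  case False
  have "rep (ebd (Kd i)) (Blk (E i 1 0)) (\<lambda>v. rsm (E i 1 0) (v $ 0))"
  proof (rule rep_small)
    show "Kd i = KO \<or> Kd i = KP" using False by (cases "Kd i") auto
    fix c assume "rsm (E i 1 0) c = 0"
    then have "E i c 0 i = 0" unfolding E_rs by simp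
    then show "c = 0" by (simp add: E_def zero_prod_def)
  qed (rule E_rel)
  then show ?thesis unfolding Blk_E by blast
qed

lemma rep_interval: "\<exists>G. rep (direct_sum (map (\<lambda>i. ebd (Kd i)) [m..<m + n])) (Mlat Kd {m..<m + n}) G"
proof (induction n arbitrary: m)
  case 0
  have "Mlat Kd {} = {0}" by (auto simp: Mlat_def OB_closed fun_eq_iff)
  then show ?case using rep_Nil by auto
next
  case (Suc n)
  have l: "[m..<m + Suc n] = m # [Suc m..<Suc m + n]" by (simp add: upt_rec)
  have I: "{m..<m + Suc n} = {m} \<union> {Suc m..<Suc m + n}" by auto
  obtain G1 where G1: "rep (ebd (Kd m)) (Mlat Kd {m}) G1" using rep_single by blast
  obtain G2 where G2: "rep (direct_sum (map (\<lambda>i. ebd (Kd i)) [Suc m..<Suc m + n])) (Mlat Kd {Suc m..<Suc m + n}) G2"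
    using Suc[of "Suc m"] by blast
  have "x = 0" if "x \<in> Mlat Kd {m}" "x \<in> Mlat Kd {Suc m..<Suc m + n}" for x
    using that by (auto simp: Mlat_def fun_eq_iff) (metis Suc_n_not_le_n)+
  then show ?case
    using rep_append[OF G1 G2 sub_Mlat sub_Mlat] unfolding l I list.map
    by (subst sumset_Mlat[symmetric]) auto
qed

lemma sum_E: assumes "finite I" "f \<in> Mlat Kd I" shows "f = (\<Sum>i\<in>I. E i (fst (f i)) (snd (f i)))"
  using assms
proof (induction I arbitrary: f rule: finite_induct)
  case empty
  then show ?case by (auto simp: Mlat_def fun_eq_iff)
next
  case (insert i I)
  have "f \<in> sumset (Mlat Kd {i}) (Mlat Kd I)" using insert by (subst sumset_Mlat) auto
  then obtain g h where gh: "f = g + h" "g \<in> Mlat Kd {i}" "h \<in> Mlat Kd I" unfolding sumset_def by blast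
  have "f i = g i" using gh insert(2) by (auto simp: Mlat_def)
  moreover have "f j = h j" if "j \<in> I" for j using gh insert(2) that by (auto simp: Mlat_def)
  ultimately show ?case using gh insert Mlat_single[OF gh(2)] by simp
qed

lemma sum_fun_apply: "(\<Sum>i\<in>I. f i) j = (\<Sum>i\<in>I. f i j)" for f :: "nat \<Rightarrow> nat \<Rightarrow> 'b \<times> 'b"
  by (induction I rule: infinite_finite_induct) auto

lemma frame_Mlat: assumes fin: "finite I" shows "frame (Mlat Kd I) I Kd (\<lambda>i. E i 1 0)"
proof -
  have "Mlat Kd I = span I (\<lambda>i. E i 1 0)"
  proof (intro equalityI subsetI)
    fix f assume f: "f \<in> Mlat Kd I"
    have c: "fst (f i) \<in> OB" "snd (f i) \<in> OB" "Kd i \<notin> {K1, K2} \<Longrightarrow> snd (f i) = 0" for i using f by (auto simp: Mlat_def)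
    have "E i (fst (f i)) (snd (f i)) = blk (E i 1 0) (fst (f i)) (snd (f i))" for i
      using E_blk[of i] c(3)[of i] by (cases "Kd i \<in> {K1, K2}") auto
    then have "f = (\<Sum>i\<in>I. blk (E i 1 0) (fst (f i)) (snd (f i)))" using sum_E[OF fin f] by simp
    then show "f \<in> span I (\<lambda>i. E i 1 0)" unfolding span_def using c(1,2)
      by (intro CollectI exI[of _ "\<lambda>i. fst (f i)"] exI[of _ "\<lambda>i. snd (f i)"]) blast
  next
    fix f assume "f \<in> span I (\<lambda>i. E i 1 0)"
    moreover have "E i 1 0 \<in> Mlat Kd I" if "i \<in> I" for i using that by (intro E_Mlat) (auto simp: OB_closed)
    ultimately show "f \<in> Mlat Kd I" using span_subset[OF sub_Mlat, of I "\<lambda>i. E i 1 0"] by blast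
  qed
  moreover have "c i \<in> P \<and> (Kd i \<in> {K1, K2} \<longrightarrow> d i \<in> P)"
    if cd: "\<forall>i\<in>I. c i \<in> OB \<and> d i \<in> OB" and y: "y \<in> Mlat Kd I"
      and eq: "(\<Sum>i\<in>I. blk (E i 1 0) (c i) (d i)) = rsm y \<omega>" and i: "i \<in> I" for c d y i
  proof -
    have "blk (E j 1 0) (c j) (d j) i = 0" if "j \<noteq> i" for j
      using E_blk[of j] that by (cases "Kd j \<in> {K1, K2}") (auto simp: E_def)
    then have "(\<Sum>j\<in>I. blk (E j 1 0) (c j) (d j) i) = blk (E i 1 0) (c i) (d i) i"
      using fin i by (subst sum.remove[of I i]) auto
    then have e: "blk (E i 1 0) (c i) (d i) i = scale (y i) \<omega>"
      using fun_cong[OF eq, of i] by (simp add: sum_fun_apply rsm_def)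
    have yP: "fst (y i) * \<omega> \<in> P" "snd (y i) * \<omega> \<in> P" using y P_closed(4,8) by (auto simp: Mlat_def)
    show ?thesis
    proof (cases "Kd i \<in> {K1, K2}")
      case True
      then show ?thesis using e E_blk(1)[OF True] yP by (simp add: E_def scale_def)
    next
      case False
      \<comment> \<open>For the small kinds the coordinate only determines
        \<open>c i + \<omega> * d i\<close>, and the second summand lies in \<open>P\<close>
        anyway.\<close>
      then have "c i + \<omega> * d i \<in> P" using e E_blk(2)[OF False] yP by (simp add: E_def scale_def)
      moreover have "\<omega> * d i \<in> P" using cd i P_closed(5,8) by blast
      ultimately have "c i + \<omega> * d i - \<omega> * d i \<in> P" by (rule P_closed(3))
      then show ?thesis using False by simp
    qed
  qed
  ultimately show ?thesis unfolding frame_def using sub_Mlat fin E_rel by blast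
qed

end


subsection \<open>Extending a form from the lattice to the ambient bimodule\<close>

context quat
begin

lemma eventually_scale_OB: "\<forall>\<^sub>F n in sequentially. \<iota> (\<pi> ^ n) * x \<in> OB"
proof (cases "x = 0")
  case False
  have "\<iota> (\<pi> ^ n) * x \<in> OB" if "n \<ge> nat (- ordB x)" for n
  proof -
    have "ordB (\<iota> (\<pi> ^ n) * x) = 2 * int n + ordB x"
      using False pi B.val_mult[of "\<iota> (\<pi> ^ n)" x] ram(2)[of "\<pi> ^ n"] ram_2 by (simp add: F.val_power)
    then show ?thesis using that by (auto simp: OB_ge val_ge_def)
  qed
  then show ?thesis using eventually_sequentially by blast
qed (simp add: OB_closed)

text \<open>The extension is forced: arguments are multiplied by a power of \<open>\<pi>\<close>
  that moves them into the lattice, and the value is divided by its square. The rest of the proof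
  shows independence of the power, and that the identities extend to scalars with
  denominators.\<close>

lemma extend_form:
  assumes fin: "finite I"
    and add: "\<And>x y z. x \<in> Mlat Kd I \<Longrightarrow> y \<in> Mlat Kd I \<Longrightarrow> z \<in> Mlat Kd I \<Longrightarrow> q0 (x + y) z = q0 x z + q0 y z"
    and rs: "\<And>x y b. x \<in> Mlat Kd I \<Longrightarrow> y \<in> Mlat Kd I \<Longrightarrow> b \<in> OB \<Longrightarrow> q0 x (rsm y b) = q0 x y * b"
    and skew: "\<And>x y. x \<in> Mlat Kd I \<Longrightarrow> y \<in> Mlat Kd I \<Longrightarrow> q0 y x = - bar (q0 x y)"
    and ls: "\<And>x y a. x \<in> Mlat Kd I \<Longrightarrow> y \<in> Mlat Kd I \<Longrightarrow> a \<in> OB \<Longrightarrow>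
      q0 (lsm Kd a x) y = q0 x (lsm Kd (bar a) y)"
  shows "\<exists>q. model v \<iota> bar \<sigma> OB K ordB \<pi> \<omega> Kd q \<and> (\<forall>x\<in>Mlat Kd I. \<forall>y\<in>Mlat Kd I. q x y = q0 x y)"
proof -
  let ?M = "Mlat Kd I"
  \<comment> \<open>A projection of the ambient bimodule onto the functions supported on
    \<open>I\<close> without idle coordinates. It commutes with both actions, so the extended form
    may vanish on its kernel.\<close>
  define tr where "tr f = (\<lambda>i. if i \<in> I then (fst (f i), if Kd i \<in> {K1, K2} then snd (f i) else 0) else 0)"
    for f :: "nat \<Rightarrow> 'b \<times> 'b"
  define X where "X n f = rsm (tr f) (\<iota> (\<pi> ^ n))" for n f
  define ok where "ok n f \<longleftrightarrow> X n f \<in> ?M" for n f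
  \<comment> \<open>The form has degree 1 in each argument, so the scaling factor appears
    twice.\<close>
  define Q where "Q n f g = \<iota> (inverse (\<pi> ^ n * \<pi> ^ n)) * q0 (X n f) (X n g)" for n f g
  define q where "q f g = Q (SOME n. ok n f \<and> ok n g) f g" for f g
  have piO: "\<iota> (\<pi> ^ n) \<in> OB" for n
  proof -
    have "v (\<pi> ^ n) \<ge> 0" using F.val_power[of \<pi> n] pi by simp
    then have "\<pi> ^ n \<in> val_ring v" by (simp add: val_ring_def)
    then show ?thesis using iota_ge by (simp add: OB_ge)
  qed
  have rs_rs: "rsm (rsm f a) b = rsm f (a * b)" for f a b by (simp add: rsm_def scale_mult)
  have ls_rs': "rsm (lsm Kd a f) b = lsm Kd a (rsm f b)" for f a b by (simp add: lsm_def rsm_def act_scale)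
  have ls_c: "lsm Kd (\<iota> c * a) f = rsm (lsm Kd a f) (\<iota> c)" for f a c
    by (simp add: fun_eq_iff lsm_def rsm_def act_mult act_iota)
  have rs_left: "q0 (rsm x a) y = bar a * q0 x y" if "x \<in> ?M" "y \<in> ?M" "a \<in> OB" for x y a
  proof -
    have "q0 (rsm x a) y = - bar (q0 y (rsm x a))" using that Mlat_rs by (intro skew) auto
    also have "\<dots> = bar a * - bar (q0 y x)" using that by (simp add: rs bar_mult)
    also have "- bar (q0 y x) = q0 x y" using that skew[of y x] by simp
    finally show ?thesis .
  qed
  have tr_add: "tr (f + g) = tr f + tr g" for f g by (simp add: fun_eq_iff tr_def)
  have tr_rs: "tr (rsm f b) = rsm (tr f) b" for f b
    by (simp add: fun_eq_iff tr_def rsm_def scale_0) (simp add: scale_def)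
  have tr_ls: "tr (lsm Kd a f) = lsm Kd a (tr f)" for f a
  proof
    fix i
    show "tr (lsm Kd a f) i = lsm Kd a (tr f) i"
      by (cases "Kd i"; cases "i \<in> I") (simp_all add: tr_def lsm_def act_0)
  qed
  have tr_M: "tr f = f" if "f \<in> ?M" for f using that by (auto simp: fun_eq_iff tr_def Mlat_def prod_eq_iff)
  have X_add: "X (n + m) f = rsm (X n f) (\<iota> (\<pi> ^ m))" for n m f
    by (simp add: X_def rs_rs power_add iota_mult)
  have ok_add: "ok (n + m) f" if "ok n f" for n m f
    using that piO Mlat_rs unfolding ok_def X_add by blast
  have ev: "\<forall>\<^sub>F n in sequentially. ok n f" for f
  proof -
    have "\<forall>\<^sub>F n in sequentially. \<forall>i\<in>I. fst (f i) * \<iota> (\<pi> ^ n) \<in> OB \<and> snd (f i) * \<iota> (\<pi> ^ n) \<in> OB"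
      unfolding iota_commute[symmetric] using fin eventually_scale_OB
      by (intro eventually_ball_finite ballI eventually_conj) auto
    then show ?thesis
    proof (rule eventually_mono)
      fix n assume n: "\<forall>i\<in>I. fst (f i) * \<iota> (\<pi> ^ n) \<in> OB \<and> snd (f i) * \<iota> (\<pi> ^ n) \<in> OB"
      show "ok n f" unfolding ok_def Mlat_def X_def
        using n by (auto simp: rsm_def tr_def scale_0 OB_closed) (auto simp: scale_def OB_closed)
    qed
  qed
  have c_out: "\<iota> (inverse (\<pi> ^ (n + m) * \<pi> ^ (n + m))) * (\<iota> (\<pi> ^ m * \<pi> ^ m) * u) = \<iota> (inverse (\<pi> ^ n * \<pi> ^ n)) * u" for n m u
  proof -
    have "inverse (\<pi> ^ (n + m) * \<pi> ^ (n + m)) * (\<pi> ^ m * \<pi> ^ m) = inverse (\<pi> ^ n * \<pi> ^ n)"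
      using pi by (simp add: power_add field_simps)
    then show ?thesis by (metis iota_mult mult.assoc)
  qed
  have cc: "\<iota> c * u * \<iota> c = \<iota> (c * c) * u" for c u
    by (metis iota_commute iota_mult mult.assoc)
  have Q_add: "Q (n + m) f g = Q n f g" if "ok n f" "ok n g" for n m f g
  proof -
    have M: "X n f \<in> ?M" "X n g \<in> ?M" using that by (auto simp: ok_def)
    have "q0 (X (n + m) f) (X (n + m) g) = \<iota> (\<pi> ^ m) * q0 (X n f) (X n g) * \<iota> (\<pi> ^ m)"
      unfolding X_add using M piO Mlat_rs by (simp add: rs rs_left)
    then show ?thesis unfolding Q_def cc using c_out by metis
  qed
  have q_eq: "q f g = Q n f g" if "ok n f" "ok n g" for n f g
  proof -
    define N where "N = (SOME n. ok n f \<and> ok n g)"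
    have N: "ok N f \<and> ok N g" unfolding N_def using that by (intro someI[of "\<lambda>n. ok n f \<and> ok n g"] conjI)
    have "Q N f g = Q (N + n) f g" using Q_add N by simp
    also have "\<dots> = Q n f g" using Q_add[OF that, of N] by (simp add: add.commute)
    finally show ?thesis by (simp add: q_def N_def)
  qed
  have ex: "\<exists>n. ok n f \<and> ok n g \<and> ok n h" for f g h
  proof -
    have "\<forall>\<^sub>F n in sequentially. ok n f \<and> ok n g \<and> ok n h" using ev by (intro eventually_conj)
    then show ?thesis by (rule eventually_happens'[OF sequentially_bot])
  qed
  have "model v \<iota> bar \<sigma> OB K ordB \<pi> \<omega> Kd q"
  proof unfold_locales
    fix x y z :: "nat \<Rightarrow> 'b \<times> 'b" and a b :: 'b
    obtain n where n: "ok n x" "ok n y" "ok n z" using ex by blast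
    have M: "X n x \<in> ?M" "X n y \<in> ?M" "X n z \<in> ?M" using n by (auto simp: ok_def)
    have Xa: "X n (x + y) = X n x + X n y"
      by (simp add: X_def tr_add) (simp add: fun_eq_iff rsm_def scale_add)
    have "ok n (x + y)" unfolding ok_def Xa using M Mlat_add by blast
    then have "q (x + y) z = Q n (x + y) z" using n q_eq by blast
    also have "\<dots> = Q n x z + Q n y z" unfolding Q_def Xa using M by (simp add: add distrib_left)
    finally show "q (x + y) z = q x z + q y z" using n q_eq by simp
    have "q y x = Q n y x" using n q_eq by blast
    also have "\<dots> = - bar (Q n x y)"
      unfolding Q_def using skew[OF M(1,2)] by (simp add: bar_mult iota_commute[of _ "bar _"])
    finally show "q y x = - bar (q x y)" using n q_eq by simp
    \<comment> \<open>The scalars \<open>a\<close> and \<open>b\<close> have denominators as well; a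
      further power of \<open>\<pi>\<close> makes both integral, so that the laws for
      \<open>q0\<close> apply.\<close>
    obtain m where m: "\<iota> (\<pi> ^ m) * b \<in> OB" "\<iota> (\<pi> ^ m) * a \<in> OB"
      using eventually_happens'[OF sequentially_bot
        eventually_conj[OF eventually_scale_OB[of b] eventually_scale_OB[of a]]] by blast
    define C where "C = \<iota> (\<pi> ^ m)"
    have C: "C \<in> OB" "bar C = C" and Cc: "C * u = u * C" for u
      using piO by (auto simp: C_def iota_commute)
    have Cab: "C * b \<in> OB" "C * a \<in> OB" using m by (auto simp: C_def)
    have CC: "C * u * C = \<iota> (\<pi> ^ m * \<pi> ^ m) * u" for u unfolding C_def by (rule cc)
    have Xx: "X (n + m) x = rsm (X n x) C" and Xy: "X (n + m) y = rsm (X n y) C" by (simp_all add: X_add C_def)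
    have Xb: "X (n + m) (rsm y b) = rsm (X n y) (C * b)"
    proof -
      have "b * \<iota> (\<pi> ^ (n + m)) = \<iota> (\<pi> ^ n) * (C * b)"
        unfolding iota_commute[symmetric] by (simp add: C_def power_add iota_mult mult.assoc)
      then show ?thesis by (simp add: X_def tr_rs rs_rs)
    qed
    have "ok (n + m) (rsm y b)" unfolding ok_def Xb using M Cab Mlat_rs by blast
    then have "q x (rsm y b) = Q (n + m) x (rsm y b)" using n ok_add q_eq by blast
    also have "q0 (X (n + m) x) (X (n + m) (rsm y b)) = \<iota> (\<pi> ^ m * \<pi> ^ m) * (q0 (X n x) (X n y) * b)"
      unfolding Xx Xb using M Cab C Mlat_rs by (simp add: rs rs_left CC[symmetric] mult.assoc) (metis Cc mult.assoc)
    then have "Q (n + m) x (rsm y b) = Q n x y * b"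
      unfolding Q_def by (simp only: c_out mult.assoc)
    finally show "q x (rsm y b) = q x y * b" using n q_eq by simp
    have Xl: "X (n + m) (lsm Kd s z) = lsm Kd (C * s) (X n z)" for s z
      by (simp add: X_def tr_ls ls_rs' C_def ls_c rs_rs power_add iota_mult)
    have Cb: "C * bar a = bar (C * a)" using C Cc by (simp add: bar_mult)
    have CbO: "C * bar a \<in> OB" unfolding Cb using Cab bar_OB by blast
    have okl: "ok (n + m) (lsm Kd a x)" "ok (n + m) (lsm Kd (bar a) y)"
      unfolding ok_def Xl using M Cab CbO Mlat_ls by blast+
    have "q0 (X (n + m) (lsm Kd a x)) (X (n + m) y) = q0 (X n x) (lsm Kd (C * bar a) (rsm (X n y) C))"
      unfolding Xl Xy Cb using M Cab C Mlat_rs by (intro ls) auto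
    also have "\<dots> = q0 (X n x) (lsm Kd (C * bar a) (X n y)) * C"
      unfolding ls_rs'[symmetric] using M CbO C Mlat_ls by (intro rs) auto
    also have "\<dots> = q0 (X (n + m) x) (X (n + m) (lsm Kd (bar a) y))"
      unfolding Xx Xl using M CbO C Mlat_ls by (simp add: rs_left Cc)
    finally have "Q (n + m) (lsm Kd a x) y = Q (n + m) x (lsm Kd (bar a) y)" by (simp add: Q_def)
    then show "q (lsm Kd a x) y = q x (lsm Kd (bar a) y)" using n ok_add okl q_eq by metis
  qed
  moreover have "q x y = q0 x y" if "x \<in> ?M" "y \<in> ?M" for x y
  proof -
    have X0: "X 0 f = f" if "f \<in> ?M" for f
      using tr_M[OF that] by (simp add: X_def rsm_def scale_1)
    have "q x y = Q 0 x y" using that X0 by (intro q_eq) (auto simp: ok_def)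
    then show ?thesis using X0 that by (simp add: Q_def)
  qed
  ultimately show ?thesis by blast
qed

subsection \<open>Explicit hyperbolic forms\<close>

text \<open>The pairing with Gram matrix C_4, C_5 or C_6 on two summands, \<open>x\<close> and
  \<open>x'\<close> being the coordinates of one vector in these summands. Pairs are always listed
  with the summand of kind \<open>K1\<close> first, so \<open>K2\<close> gets the value 0.\<close>

fun pf :: "kind \<Rightarrow> 'b \<times> 'b \<Rightarrow> 'b \<times> 'b \<Rightarrow> 'b \<times> 'b \<Rightarrow> 'b \<times> 'b \<Rightarrow> 'b" where
  "pf KO x x' y y' = bar (fst x) * fst y' - bar (fst x') * fst y"
| "pf KP x x' y y' = bar (fst x) * fst y' - bar (fst x') * fst y"
| "pf K1 x x' y y' = bar (fst x) * snd y' - bar (snd x) * fst y' + bar (fst x') * snd y - bar (snd x') * fst y"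
| "pf K2 x x' y y' = 0"

fun partner :: "kind \<Rightarrow> kind" where
  "partner KO = KO" | "partner KP = KP" | "partner K1 = K2" | "partner K2 = K1"

fun plane_of :: "kind \<Rightarrow> plane_kind" where
  "plane_of KO = H4" | "plane_of KP = H5" | "plane_of K1 = H6" | "plane_of K2 = H6"

lemma pf_add: "pf k (x + z) (x' + z') y y' = pf k x x' y y' + pf k z z' y y'"
  by (cases k) (simp_all add: bar_add distrib_right algebra_simps)

lemma pf_scale: "pf k x x' (scale y b) (scale y' b) = pf k x x' y y' * b"
  by (cases k) (simp_all add: scale_def left_diff_distrib distrib_right mult.assoc)

lemma pf_skew: "pf k y y' x x' = - bar (pf k x x' y y')"
  by (cases k) (simp_all add: bar_diff bar_add bar_mult)

lemma pf_0: "pf k 0 0 y y' = 0" "pf k x x' 0 0 = 0"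
  by (cases k; simp)+

text \<open>For \<open>KP\<close> this rests on conjugation by \<open>\<omega>\<close> commuting
  with \<open>bar\<close>. For \<open>K1\<close> it is a comparison of matrix entries, using that
  \<open>bar\<close> acts on \<open>K\<close> as \<open>\<sigma>\<close> and negates the coordinate
  along \<open>\<omega>\<close>.\<close>

lemma pf_act: "pf k (act k a x) (act (partner k) a x') y y' = pf k x x' (act k (bar a) y) (act (partner k) (bar a) y')"
proof (cases k)
  case KP
  have "bar (inverse \<omega> * a * \<omega>) = \<omega> * bar a * inverse \<omega>"
    by (simp add: bar_mult bar_inverse bar_omega mult.assoc)
  also have "\<dots> = inverse \<omega> * bar a * \<omega>"
  proof -
    have "\<omega> * (inverse \<omega> * bar a * \<omega>) * \<omega> = bar a * (\<omega> * \<omega>)" by (simp add: mult.assoc) (simp flip: mult.assoc)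
    also have "\<dots> = \<omega> * \<omega> * bar a" unfolding omega_sq by (rule iota_commute[symmetric])
    also have "\<dots> = \<omega> * (\<omega> * bar a * inverse \<omega>) * \<omega>" by (simp add: mult.assoc)
    finally show ?thesis by simp
  qed
  finally have b: "bar (inverse \<omega> * a * \<omega>) = inverse \<omega> * bar a * \<omega>" .
  have b': "bar (inverse \<omega> * a * \<omega> * u) = bar u * (inverse \<omega> * bar a * \<omega>)" for u
    unfolding bar_mult[of "inverse \<omega> * a * \<omega>"] b ..
  show ?thesis unfolding KP partner.simps pf.simps act.simps fst_conv b' by (simp only: mult.assoc)
next
  case K1
  define p where "p = \<iota> \<pi>"
  have p: "bar p = p" and pc: "p * (u * w) = u * (p * w)" and pc0: "p * u = u * p" for u w
    unfolding p_def using iota_commute[of \<pi> u] by (simp_all flip: mult.assoc)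
  note K = ka_kb_K[of a]
  have b: "bar (ka a) = \<sigma> (ka a)" "bar (kb a) = \<sigma> (kb a)" "bar (\<sigma> (ka a)) = ka a" "bar (\<sigma> (kb a)) = kb a"
    using K by (simp_all add: bar_K sigma_K sigma_sigma)
  have s: "\<sigma> (\<sigma> (ka a)) = ka a" "\<sigma> (- kb a) = - \<sigma> (kb a)" using K by (simp_all add: sigma_sigma sigma_minus)
  show ?thesis unfolding K1
    by (simp add: kc_bar b s bar_add bar_mult p distrib_left distrib_right right_diff_distrib left_diff_distrib
        mult.assoc pc0 flip: p_def)
qed (simp_all add: bar_mult mult.assoc)

definition pair_form :: "(nat \<Rightarrow> kind) \<Rightarrow> (nat \<times> nat) set \<Rightarrow> (nat \<Rightarrow> 'b \<times> 'b) \<Rightarrow> (nat \<Rightarrow> 'b \<times> 'b) \<Rightarrow> 'b" where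
  "pair_form Kd S f g = (\<Sum>(i, j)\<in>S. pf (Kd i) (f i) (f j) (g i) (g j))"

lemma pair_form_model:
  assumes "\<And>i j. (i, j) \<in> S \<Longrightarrow> Kd j = partner (Kd i)"
  shows "model v \<iota> bar \<sigma> OB K ordB \<pi> \<omega> Kd (pair_form Kd S)"
proof unfold_locales
  fix x y z :: "nat \<Rightarrow> 'b \<times> 'b" and a b :: 'b
  show "pair_form Kd S (x + y) z = pair_form Kd S x z + pair_form Kd S y z"
    unfolding pair_form_def sum.distrib[symmetric] by (intro sum.cong) (auto simp: pf_add)
  show "pair_form Kd S x (rsm y b) = pair_form Kd S x y * b"
    unfolding pair_form_def sum_distrib_right by (intro sum.cong) (auto simp: pf_scale rsm_def)
  have bar_sum: "bar (sum f T) = (\<Sum>i\<in>T. bar (f i))" for f :: "nat \<times> nat \<Rightarrow> 'b" and T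
    by (induction T rule: infinite_finite_induct) (auto simp: bar_add)
  show "pair_form Kd S y x = - bar (pair_form Kd S x y)"
    unfolding pair_form_def bar_sum sum_negf[symmetric] by (intro sum.cong refl) (clarsimp, rule pf_skew)
  show "pair_form Kd S (lsm Kd a x) y = pair_form Kd S x (lsm Kd (bar a) y)"
    unfolding pair_form_def by (intro sum.cong refl) (clarsimp simp: lsm_def assms pf_act)
qed

end

lemma (in model) pair_form_hyp_sum:
  assumes q: "q = pair_form Kd S" and fin: "finite S" and part: "\<And>i j. (i, j) \<in> S \<Longrightarrow> Kd j = partner (Kd i) \<and> i \<noteq> j \<and> Kd i \<noteq> K2"
    and disj: "\<And>i j i' j'. (i, j) \<in> S \<Longrightarrow> (i', j') \<in> S \<Longrightarrow> (i, j) \<noteq> (i', j') \<Longrightarrow> {i, j} \<inter> {i', j'} = {}"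
    and l: "set l \<subseteq> S" "distinct l"
  shows "hyp_sum (Mlat Kd (\<Union>(i, j)\<in>set l. {i, j})) (map (\<lambda>(i, j). plane_of (Kd i)) l)"
proof -
  \<comment> \<open>The pairs are disjoint, so on a vector supported on one of them only the
    corresponding summand of the form survives.\<close>
  have val: "q f g = pf (Kd i) (f i) (f j) (g i) (g j)"
    if ij: "(i, j) \<in> S" and f: "f \<in> Mlat Kd {i, j}" for f g i j
  proof -
    have "pf (Kd i') (f i') (f j') (g i') (g j') = 0" if "(i', j') \<in> S" "(i', j') \<noteq> (i, j)" for i' j'
    proof -
      have "{i, j} \<inter> {i', j'} = {}" by (rule disj[OF ij that(1)]) (use that in blast)
      then have "f i' = 0" "f j' = 0" using f by (auto simp: Mlat_def)
      then show ?thesis by (simp add: pf_0)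
    qed
    then show ?thesis unfolding q pair_form_def using fin ij
      by (subst sum.remove[OF fin ij]) (auto intro!: sum.neutral)
  qed
  show ?thesis using l
  proof (induction l)
    case Nil
    have "Mlat Kd {} = {0}" by (auto simp: Mlat_def OB_closed fun_eq_iff)
    then show ?case using hyp_sum.Nil by simp
  next
    case (Cons p l)
    obtain i j where p: "p = (i, j)" by (cases p)
    have ij: "(i, j) \<in> S" using Cons.prems p by simp
    let ?U = "\<Union>(i, j)\<in>set l. {i, j}"
    let ?e = "E i 1 0" and ?f = "E j 1 0"
    have ne: "i \<noteq> j" "Kd j = partner (Kd i)" "Kd i \<noteq> K2" using part ij by auto
    have U: "i \<notin> ?U" "j \<notin> ?U"
    proof -
      have "{i, j} \<inter> {i', j'} = {}" if "(i', j') \<in> set l" for i' j'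
        using Cons.prems that p by (intro disj[OF ij]) auto
      then show "i \<notin> ?U" "j \<notin> ?U" by auto
    qed
    have H: "Hsp ?e ?f = Mlat Kd {i, j}"
      using sumset_Mlat[of "{i}" "{j}"] ne(1) unfolding Hsp_def sumset_def Blk_E
      by (simp add: insert_commute)
    have M: "E i c d \<in> Mlat Kd {i, j}" "E j c d \<in> Mlat Kd {i, j}"
      if "c \<in> OB" "d \<in> OB" "Kd i \<notin> {K1, K2} \<Longrightarrow> d = 0" for c d
      using that ne by (auto intro!: E_Mlat) (cases "Kd i"; simp)
    have pl: "plane (plane_of (Kd i)) ?e ?f"
    proof -
      have "rel (Kd i) ?e" "rel (Kd j) ?f" by (rule E_rel)+
      moreover have "q ?e ?e = 0" "q ?f ?f = 0"
        using val[OF ij M(1), of 1 0 ?e] val[OF ij M(2), of 1 0 ?f] ne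
        by (cases "Kd i"; simp add: OB_closed E_def)+
      moreover have "Kd i \<noteq> K1 \<Longrightarrow> q ?e ?f = 1" "Kd i = K1 \<Longrightarrow> q ?e ?f = 0"
        using val[OF ij M(1), of 1 0 ?f] ne by (cases "Kd i"; simp add: OB_closed E_def)+
      moreover have "q ?e (lsm Kd \<omega> ?f) = 1" if "Kd i = K1"
      proof -
        have "lsm Kd \<omega> ?f = E j 0 1" using that ne by (intro E_W) simp
        then show ?thesis using val[OF ij M(1), of 1 0 "E j 0 1"] ne that by (simp add: OB_closed E_def)
      qed
      ultimately show ?thesis using ne unfolding plane_def by (cases "Kd i") auto
    qed
    have "hyp_sum (sumset (Hsp ?e ?f) (Mlat Kd ?U)) (plane_of (Kd i) # map (\<lambda>(i, j). plane_of (Kd i)) l)"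
    proof (rule hyp_sum.Cons[OF _ pl])
      show "hyp_sum (Mlat Kd ?U) (map (\<lambda>(i, j). plane_of (Kd i)) l)" using Cons by simp
      fix g x assume g: "g \<in> Hsp ?e ?f" and x: "x \<in> Mlat Kd ?U"
      have "x i = 0" "x j = 0" using x U unfolding Mlat_def by blast+
      then show "q g x = 0" using val[OF ij] g unfolding H by (simp add: pf_0)
    qed
    moreover have "sumset (Hsp ?e ?f) (Mlat Kd ?U) = Mlat Kd ({i, j} \<union> ?U)"
      unfolding H using U by (intro sumset_Mlat) auto
    ultimately show ?case by (simp add: p)
  qed
qed


section \<open>Isomorphisms of bilattices\<close>

text \<open>Just the closure properties that make the inverse of an isomorphism an isomorphism;
  column vectors satisfy them before they are shown to form a bimodule.\<close>

definition closed_ops :: "'b set \<Rightarrow> ('b, 'l) bimodule \<Rightarrow> bool" where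
  "closed_ops S L \<longleftrightarrow> (\<forall>x\<in>carrier L. \<forall>y\<in>carrier L. x \<oplus>\<^bsub>L\<^esub> y \<in> carrier L) \<and>
     (\<forall>a\<in>S. \<forall>x\<in>carrier L. lsmult L a x \<in> carrier L \<and> rsmult L x a \<in> carrier L)"

lemma bimodule_closed: assumes "is_bimodule S L" shows "closed_ops S L"
proof -
  interpret abelian_group L using assms by (simp add: is_bimodule_def)
  show ?thesis using assms a_closed unfolding closed_ops_def is_bimodule_def by blast
qed

lemma bimodule_isoD:
  assumes "bimodule_iso S L M f"
  shows "bij_betw f (carrier L) (carrier M)" "x \<in> carrier L \<Longrightarrow> f x \<in> carrier M"
    "x \<in> carrier L \<Longrightarrow> y \<in> carrier L \<Longrightarrow> f (x \<oplus>\<^bsub>L\<^esub> y) = f x \<oplus>\<^bsub>M\<^esub> f y"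
    "a \<in> S \<Longrightarrow> x \<in> carrier L \<Longrightarrow> f (lsmult L a x) = lsmult M a (f x)"
    "a \<in> S \<Longrightarrow> x \<in> carrier L \<Longrightarrow> f (rsmult L x a) = rsmult M (f x) a"
    "x \<in> carrier L \<Longrightarrow> y \<in> carrier L \<Longrightarrow> f x = f y \<Longrightarrow> x = y"
  using assms unfolding bimodule_iso_def bij_betw_def inj_on_def by blast+

lemma bimodule_iso_trans:
  assumes f: "bimodule_iso S L M f" and g: "bimodule_iso S M N g"
  shows "bimodule_iso S L N (\<lambda>x. g (f x))"
  using bij_betw_trans[OF bimodule_isoD(1)[OF f] bimodule_isoD(1)[OF g]] bimodule_isoD(2-5)[OF f] bimodule_isoD(3-5)[OF g]
  by (simp add: bimodule_iso_def comp_def)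

lemma bimodule_iso_inv:
  assumes f: "bimodule_iso S L M f" and cl: "closed_ops S L"
  shows "bimodule_iso S M L (inv_into (carrier L) f)"
proof -
  let ?g = "inv_into (carrier L) f"
  note b = bimodule_isoD(1)[OF f]
  have g: "?g y \<in> carrier L" "f (?g y) = y" if "y \<in> carrier M" for y
    using bij_betwE[OF bij_betw_inv_into[OF b]] bij_betw_inv_into_right[OF b] that by auto
  have eq: "?g y = x" if "x \<in> carrier L" "f x = y" for x y
    using bij_betw_inv_into_left[OF b that(1)] that(2) by simp
  show ?thesis unfolding bimodule_iso_def
  proof (intro conjI ballI)
    show "bij_betw ?g (carrier M) (carrier L)" by (rule bij_betw_inv_into[OF b])
    fix x y assume "x \<in> carrier M" "y \<in> carrier M"
    then show "?g (x \<oplus>\<^bsub>M\<^esub> y) = ?g x \<oplus>\<^bsub>L\<^esub> ?g y"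
      using g cl bimodule_isoD(3)[OF f] unfolding closed_ops_def by (intro eq) auto
  next
    fix a x assume "a \<in> S" "x \<in> carrier M"
    then show "?g (lsmult M a x) = lsmult L a (?g x)" "?g (rsmult M x a) = rsmult L (?g x) a"
      using g cl bimodule_isoD(4,5)[OF f] unfolding closed_ops_def by (auto intro!: eq)
  qed
qed

lemma embedding_bilattice_simps [simp]:
  "carrier (embedding_bilattice S e) = int_vecs S (fst e)"
  "x \<oplus>\<^bsub>embedding_bilattice S e\<^esub> y = x + y" "\<zero>\<^bsub>embedding_bilattice S e\<^esub> = 0\<^sub>v (fst e)"
  "lsmult (embedding_bilattice S e) a x = snd e a *\<^sub>v x"
  "rsmult (embedding_bilattice S e) x a = map_vec (\<lambda>c. c * a) x"
  by (simp_all add: embedding_bilattice_def int_vecs_def)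

context quat
begin

definition mrec :: "(nat \<Rightarrow> kind) \<Rightarrow> (nat \<Rightarrow> 'b \<times> 'b) set \<Rightarrow> ('b, nat \<Rightarrow> 'b \<times> 'b) bimodule" where
  "mrec Kd N = \<lparr>carrier = N, mult = undefined, one = undefined, zero = 0, add = (+),
     lsmult = lsm Kd, rsmult = rsm\<rparr>"

lemma mrec_simps [simp]:
  "carrier (mrec Kd N) = N" "x \<oplus>\<^bsub>mrec Kd N\<^esub> y = x + y" "lsmult (mrec Kd N) = lsm Kd" "rsmult (mrec Kd N) = rsm"
  by (simp_all add: mrec_def)

end

lemma (in model) rep_iso:
  assumes "rep e N G"
  shows "bimodule_iso OB (embedding_bilattice OB e) (mrec Kd N) G" "closed_ops OB (embedding_bilattice OB e)"
proof -
  show "bimodule_iso OB (embedding_bilattice OB e) (mrec Kd N) G"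
    using assms unfolding rep_def bimodule_iso_def by simp
  have "x + y \<in> int_vecs OB n" if "x \<in> int_vecs OB n" "y \<in> int_vecs OB n" for x y n
    using that OB_closed(3) by (auto simp: int_vecs_def)
  moreover have "map_vec (\<lambda>c. c * a) x \<in> int_vecs OB n" if "x \<in> int_vecs OB n" "a \<in> OB" for x a n
    using that OB_closed(5) by (auto simp: int_vecs_def)
  ultimately show "closed_ops OB (embedding_bilattice OB e)"
    using assms unfolding rep_def closed_ops_def by simp
qed

context quat
begin

definition Kstd :: "nat \<Rightarrow> nat \<Rightarrow> nat \<Rightarrow> nat \<Rightarrow> kind" where
  "Kstd r1 r2 t1 i = (if i < r1 then KO else if i < r1 + r2 then KP else if i < r1 + r2 + t1 then K1 else K2)"

lemma standard_embedding_Kstd: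
  "standard_embedding \<iota> K \<sigma> \<pi> \<omega> r1 r2 t1 t2 =
    direct_sum (map (\<lambda>i. ebd (Kstd r1 r2 t1 i)) [0..<0 + (r1 + r2 + t1 + t2)])"
  unfolding standard_embedding_def
  by (intro arg_cong[of _ _ direct_sum] nth_equalityI) (auto simp: nth_append Kstd_def)

lemma standard_rep:
  "\<exists>G. bimodule_iso OB (embedding_bilattice OB (standard_embedding \<iota> K \<sigma> \<pi> \<omega> r1 r2 t1 t2))
      (mrec (Kstd r1 r2 t1) (Mlat (Kstd r1 r2 t1) {0..<r1 + r2 + t1 + t2})) G \<and>
    closed_ops OB (embedding_bilattice OB (standard_embedding \<iota> K \<sigma> \<pi> \<omega> r1 r2 t1 t2))"
proof -
  \<comment> \<open>The empty set of pairs gives the zero form, which opens the lemmas about the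
    bimodule structure.\<close>
  interpret Z: model v \<iota> bar \<sigma> OB K ordB \<pi> \<omega> "Kstd r1 r2 t1" "pair_form (Kstd r1 r2 t1) {}"
    by (rule pair_form_model) simp
  obtain G where G: "Z.rep (standard_embedding \<iota> K \<sigma> \<pi> \<omega> r1 r2 t1 t2)
      (Mlat (Kstd r1 r2 t1) {0..<0 + (r1 + r2 + t1 + t2)}) G"
    unfolding standard_embedding_Kstd using Z.rep_interval by blast
  show ?thesis using Z.rep_iso[OF G] unfolding add_0_left by blast
qed

text \<open>The bimodule identities and torsion-freeness are verified in the model and pulled back
  along the injective map \<open>G\<close>.\<close>

lemma bilattice_transport:
  assumes iso: "bimodule_iso OB (embedding_bilattice OB e) (mrec Kd (Mlat Kd I)) G"
    and cl: "closed_ops OB (embedding_bilattice OB e)" and fin: "finite I"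
  shows "bilattice v \<iota> OB (embedding_bilattice OB e)"
proof -
  let ?L = "embedding_bilattice OB e" and ?M = "Mlat Kd I"
  interpret Z: model v \<iota> bar \<sigma> OB K ordB \<pi> \<omega> Kd "pair_form Kd {}"
    by (rule pair_form_model) simp
  note G = bimodule_isoD[OF iso, unfolded mrec_simps]
  have cl': "\<And>x y. x \<in> carrier ?L \<Longrightarrow> y \<in> carrier ?L \<Longrightarrow> x \<oplus>\<^bsub>?L\<^esub> y \<in> carrier ?L"
    "\<And>x a. x \<in> carrier ?L \<Longrightarrow> a \<in> OB \<Longrightarrow> lsmult ?L a x \<in> carrier ?L"
    "\<And>x a. x \<in> carrier ?L \<Longrightarrow> a \<in> OB \<Longrightarrow> rsmult ?L x a \<in> carrier ?L"
    using cl unfolding closed_ops_def by blast+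
  have zero: "\<zero>\<^bsub>?L\<^esub> \<in> carrier ?L" by (simp add: int_vecs_def OB_closed)
  interpret L: abelian_group ?L
  proof (rule abelian_groupI)
    fix x assume x: "x \<in> carrier ?L"
    then have "- x \<in> carrier ?L" "- x \<oplus>\<^bsub>?L\<^esub> x = \<zero>\<^bsub>?L\<^esub>" by (auto simp: int_vecs_def OB_closed)
    then show "\<exists>y\<in>carrier ?L. y \<oplus>\<^bsub>?L\<^esub> x = \<zero>\<^bsub>?L\<^esub>" by blast
  qed (use cl' zero in \<open>auto simp: int_vecs_def OB_closed comm_add_vec intro!: assoc_add_vec\<close>)
  have G0: "G \<zero>\<^bsub>?L\<^esub> = 0" using G(3)[OF zero zero] L.l_zero[OF zero] by simp
  have bim: "is_bimodule OB ?L"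
    unfolding is_bimodule_def
  proof (intro conjI ballI)
    show "abelian_group ?L" by unfold_locales
  next
    fix a x assume "a \<in> OB" "x \<in> carrier ?L"
    then show "lsmult ?L a x \<in> carrier ?L" "rsmult ?L x a \<in> carrier ?L" by (simp_all only: cl')
  next
    fix a x y assume *: "a \<in> OB" "x \<in> carrier ?L" "y \<in> carrier ?L"
    show "lsmult ?L a (x \<oplus>\<^bsub>?L\<^esub> y) = lsmult ?L a x \<oplus>\<^bsub>?L\<^esub> lsmult ?L a y"
      by (rule G(6)) (use * in \<open>simp_all only: cl' G(3-5) Z.ls_add L.a_closed\<close>)
    show "rsmult ?L (x \<oplus>\<^bsub>?L\<^esub> y) a = rsmult ?L x a \<oplus>\<^bsub>?L\<^esub> rsmult ?L y a"
      by (rule G(6)) (use * in \<open>simp_all only: cl' G(3-5) Z.rs_add L.a_closed\<close>)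
  next
    fix a b x assume *: "a \<in> OB" "b \<in> OB" "x \<in> carrier ?L"
    have ab: "a + b \<in> OB" "a * b \<in> OB" using * OB_closed by auto
    show "lsmult ?L (a + b) x = lsmult ?L a x \<oplus>\<^bsub>?L\<^esub> lsmult ?L b x"
      by (rule G(6)) (use * ab in \<open>simp_all only: cl' G(3-5) Z.ls_add_left L.a_closed\<close>)
    show "rsmult ?L x (a + b) = rsmult ?L x a \<oplus>\<^bsub>?L\<^esub> rsmult ?L x b"
      by (rule G(6)) (use * ab in \<open>simp_all only: cl' G(3-5) Z.rs_add_right L.a_closed\<close>)
    show "lsmult ?L (a * b) x = lsmult ?L a (lsmult ?L b x)"
      by (rule G(6)) (use * ab in \<open>simp_all only: cl' G(3-5) Z.ls_mult\<close>)
    show "rsmult ?L x (a * b) = rsmult ?L (rsmult ?L x a) b"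
      by (rule G(6)) (use * ab in \<open>simp_all only: cl' G(3-5) Z.rs_mult\<close>)
    show "rsmult ?L (lsmult ?L a x) b = lsmult ?L a (rsmult ?L x b)"
      by (rule G(6)) (use * ab in \<open>simp_all only: cl' G(3-5) Z.ls_rs\<close>)
  next
    fix x assume *: "x \<in> carrier ?L"
    show "lsmult ?L 1 x = x" by (rule G(6)) (use * OB_closed(2) in \<open>simp_all only: cl' G(3-5) Z.ls_1\<close>)
    show "rsmult ?L x 1 = x" by (rule G(6)) (use * OB_closed(2) in \<open>simp_all only: cl' G(3-5) Z.rs_1\<close>)
  qed
  have gen: "\<exists>S. finite S \<and> S \<subseteq> carrier ?L \<and> (\<forall>N. is_subbimodule OB ?L N \<longrightarrow> S \<subseteq> N \<longrightarrow> N = carrier ?L)"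
  proof (intro exI conjI allI impI)
    \<comment> \<open>The preimages of the first basis vectors generate: the second ones arise from
      them through the left action of \<open>\<omega>\<close>.\<close>
    let ?S = "inv_into (carrier ?L) G ` (\<lambda>i. Z.E i 1 0) ` I"
    have EM: "Z.E i 1 0 \<in> ?M" if "i \<in> I" for i using that by (intro Z.E_Mlat) (auto simp: OB_closed)
    note b = G(1)
    show "finite ?S" using fin by simp
    show "?S \<subseteq> carrier ?L" using EM bij_betwE[OF bij_betw_inv_into[OF b]] by auto
    fix N assume N: "is_subbimodule OB ?L N" and SN: "?S \<subseteq> N"
    have NL: "N \<subseteq> carrier ?L" "\<zero>\<^bsub>?L\<^esub> \<in> N" "\<And>x y. x \<in> N \<Longrightarrow> y \<in> N \<Longrightarrow> x \<ominus>\<^bsub>?L\<^esub> y \<in> N"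
      "\<And>a x. a \<in> OB \<Longrightarrow> x \<in> N \<Longrightarrow> lsmult ?L a x \<in> N" "\<And>a x. a \<in> OB \<Longrightarrow> x \<in> N \<Longrightarrow> rsmult ?L x a \<in> N"
      using N unfolding is_subbimodule_def by blast+
    have plus: "x \<oplus>\<^bsub>?L\<^esub> y \<in> N" if xy: "x \<in> N" "y \<in> N" for x y
    proof -
      have c: "x \<in> carrier ?L" "y \<in> carrier ?L" using xy NL(1) by blast+
      have "\<zero>\<^bsub>?L\<^esub> \<ominus>\<^bsub>?L\<^esub> y = \<ominus>\<^bsub>?L\<^esub> y" unfolding a_minus_def using c by (intro L.l_zero L.a_inv_closed)
      then have "\<ominus>\<^bsub>?L\<^esub> y \<in> N" using NL(3)[OF NL(2) xy(2)] by simp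
      then have "x \<ominus>\<^bsub>?L\<^esub> (\<ominus>\<^bsub>?L\<^esub> y) \<in> N" using NL(3) xy by blast
      then show ?thesis unfolding a_minus_def using c by (simp only: L.minus_minus)
    qed
    have "Z.sub (G ` N)"
      unfolding Z.sub_def
    proof (intro conjI ballI)
      show "0 \<in> G ` N" using NL(2) G0 by force
      fix x y assume "x \<in> G ` N" "y \<in> G ` N"
      then obtain a b where "x = G a" "y = G b" "a \<in> N" "b \<in> N" by blast
      then show "x + y \<in> G ` N" using G(3)[of a b] plus[of a b] NL(1) by (metis imageI subsetD)
    next
      fix x s assume "x \<in> G ` N" "s \<in> OB"
      then obtain a where "x = G a" "a \<in> N" "s \<in> OB" by blast
      then show "lsm Kd s x \<in> G ` N" "rsm x s \<in> G ` N"
        using G(4,5)[of s a] NL(4,5)[of s a] NL(1) by (metis imageI subsetD)+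
    qed
    moreover have "Z.E i 1 0 \<in> G ` N" if "i \<in> I" for i
      using SN bij_betw_inv_into_right[OF b EM[OF that]] that by (metis (no_types, lifting) image_eqI subsetD)
    ultimately have "Z.span I (\<lambda>i. Z.E i 1 0) \<subseteq> G ` N" by (intro Z.span_subset)
    then have "?M \<subseteq> G ` N" using Z.frame_span[OF Z.frame_Mlat[OF fin]] by simp
    then have MN: "?M \<subseteq> G ` N" .
    have "x \<in> N" if x: "x \<in> carrier ?L" for x
    proof -
      obtain y where y: "G x = G y" "y \<in> N" using subsetD[OF MN G(2)[OF x]] by (rule imageE)
      then have "x = y" using x NL(1) by (intro G(6)) blast+
      then show ?thesis using y(2) by simp
    qed
    then show "N = carrier ?L" using NL(1) by blast
  qed
  have tf: "lsmult ?L (\<iota> a) x = rsmult ?L x (\<iota> a)" "lsmult ?L (\<iota> a) x = \<zero>\<^bsub>?L\<^esub> \<longrightarrow> a = 0 \<or> x = \<zero>\<^bsub>?L\<^esub>"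
    if a: "a \<in> val_ring v" and x: "x \<in> carrier ?L" for a x
  proof -
    have aO: "\<iota> a \<in> OB" using a iota_ge by (simp add: OB_ge)
    show "lsmult ?L (\<iota> a) x = rsmult ?L x (\<iota> a)"
      by (rule G(6)) (use aO x in \<open>simp_all only: cl' G(4,5) Z.ls_iota\<close>)
    show "lsmult ?L (\<iota> a) x = \<zero>\<^bsub>?L\<^esub> \<longrightarrow> a = 0 \<or> x = \<zero>\<^bsub>?L\<^esub>"
    proof
      assume "lsmult ?L (\<iota> a) x = \<zero>\<^bsub>?L\<^esub>"
      then have "rsm (G x) (\<iota> a) = 0" using G(4)[OF aO x] G0 by (simp only: Z.ls_iota)
      then have "a = 0 \<or> G x = 0" by (simp add: fun_eq_iff rsm_def scale_def zero_prod_def prod_eq_iff) (metis prod.collapse)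
      then show "a = 0 \<or> x = \<zero>\<^bsub>?L\<^esub>" using G(6)[OF x zero] G0 by metis
    qed
  qed
  show ?thesis unfolding bilattice_def using bim gen tf by blast
qed

lemma standard_structural:
  "structural_invariant v \<iota> OB K \<sigma> \<pi> \<omega>
    (embedding_bilattice OB (standard_embedding \<iota> K \<sigma> \<pi> \<omega> r1 r2 t1 t2)) r1 r2 t1 t2"
proof -
  let ?L = "embedding_bilattice OB (standard_embedding \<iota> K \<sigma> \<pi> \<omega> r1 r2 t1 t2)"
  obtain G where "bimodule_iso OB ?L (mrec (Kstd r1 r2 t1) (Mlat (Kstd r1 r2 t1) {0..<r1 + r2 + t1 + t2})) G"
    "closed_ops OB ?L" using standard_rep by blast
  then have "bilattice v \<iota> OB ?L" by (rule bilattice_transport) simp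
  moreover have "bimodule_iso OB ?L ?L (\<lambda>x. x)" by (simp add: bimodule_iso_def bij_betw_def)
  ultimately show ?thesis unfolding structural_invariant_def by blast
qed

lemma structural_model:
  assumes "structural_invariant v \<iota> OB K \<sigma> \<pi> \<omega> L r1 r2 t1 t2"
  shows "\<exists>\<psi>. bimodule_iso OB L (mrec (Kstd r1 r2 t1) (Mlat (Kstd r1 r2 t1) {0..<r1 + r2 + t1 + t2})) \<psi>"
  using assms standard_rep[of r1 r2 t1 t2] bimodule_iso_trans unfolding structural_invariant_def by blast

end


section \<open>Hermitian pairings on bilattices\<close>

locale bilat = quat v \<iota> bar \<sigma> OB K ordB \<pi> \<omega>
  for v :: "'f::field \<Rightarrow> int" and \<iota> :: "'f \<Rightarrow> 'b::division_ring" and bar \<sigma> OB K ordB \<pi> \<omega> +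
  fixes L :: "('b, 'l) bimodule" and Kd :: "nat \<Rightarrow> kind" and I :: "nat set" and \<psi> :: "'l \<Rightarrow> nat \<Rightarrow> 'b \<times> 'b"
    and star :: "'b \<Rightarrow> 'b" and u :: 'b
  assumes bim: "is_bimodule OB L" and finite_I: "finite I"
    and iso: "bimodule_iso OB L (mrec Kd (Mlat Kd I)) \<psi>"
    and u: "u \<noteq> 0" "ordB u = 0" "bar u = - u" and star: "star \<alpha> = u * bar \<alpha> * inverse u"
begin

abbreviation "M \<equiv> Mlat Kd I"

definition "\<phi> = inv_into (carrier L) \<psi>"

lemmas psi = bimodule_isoD[OF iso, unfolded mrec_simps]

lemma phi_iso: "bimodule_iso OB (mrec Kd M) L \<phi>"
  unfolding \<phi>_def by (rule bimodule_iso_inv[OF iso bimodule_closed[OF bim]])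

lemmas phi = bimodule_isoD[OF phi_iso, unfolded mrec_simps]

lemma psi_phi: "f \<in> M \<Longrightarrow> \<psi> (\<phi> f) = f" and phi_psi: "x \<in> carrier L \<Longrightarrow> \<phi> (\<psi> x) = x"
  unfolding \<phi>_def using bij_betw_inv_into_right[OF psi(1)] bij_betw_inv_into_left[OF psi(1)] by auto

lemma L_closed: "x \<in> carrier L \<Longrightarrow> y \<in> carrier L \<Longrightarrow> x \<oplus>\<^bsub>L\<^esub> y \<in> carrier L"
  "x \<in> carrier L \<Longrightarrow> a \<in> OB \<Longrightarrow> lsmult L a x \<in> carrier L"
  "x \<in> carrier L \<Longrightarrow> a \<in> OB \<Longrightarrow> rsmult L x a \<in> carrier L"
  using bimodule_closed[OF bim] unfolding closed_ops_def by blast+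

lemma zero_L: "\<zero>\<^bsub>L\<^esub> \<in> carrier L" "\<psi> \<zero>\<^bsub>L\<^esub> = 0"
proof -
  interpret abelian_group L using bim by (simp add: is_bimodule_def)
  show z: "\<zero>\<^bsub>L\<^esub> \<in> carrier L" by simp
  show "\<psi> \<zero>\<^bsub>L\<^esub> = 0" using psi(3)[OF z z] by simp
qed

lemma u_OB: "u \<in> OB" "inverse u \<in> OB" "bar (inverse u) = - inverse u"
  using u B.val_inverse[of u] by (simp_all add: OB_ge val_ge_def bar_inverse)

lemma iota_OB: "a \<in> val_ring v \<Longrightarrow> \<iota> a \<in> OB"
  using iota_ge by (simp add: OB_ge)

lemma one_val_ring: "(1::'f) \<in> val_ring v - {0}"
  by (simp add: val_ring_def)

lemma lsm_mult: "lsm Kd (a * b) f = lsm Kd a (lsm Kd b f)" and lsm_1: "lsm Kd 1 f = f"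
  and lsm_iota: "lsm Kd (\<iota> c) f = rsm f (\<iota> c)" and rsm_mult: "rsm f (a * b) = rsm (rsm f a) b" and rsm_1: "rsm f 1 = f"
  and lsm_rsm: "rsm (lsm Kd a f) b = lsm Kd a (rsm f b)"
  by (simp_all add: fun_eq_iff lsm_def rsm_def act_mult act_1 act_iota scale_mult scale_1 act_scale)

subsection \<open>The localization\<close>

text \<open>Sends the fraction \<open>(x, a)\<close> to the vector \<open>\<psi> x\<close> divided
  by \<open>a\<close>. The classes that make up L \<otimes> F are the fibres of this map, described
  by \<open>cl\<close> below.\<close>

definition frac_val :: "'l \<Rightarrow> 'f \<Rightarrow> nat \<Rightarrow> 'b \<times> 'b" where
  "frac_val x a = rsm (\<psi> x) (inverse (\<iota> a))"

definition cl :: "'l \<Rightarrow> 'f \<Rightarrow> ('l \<times> 'f) set" where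
  "cl x a = {(y, b). y \<in> carrier L \<and> b \<in> val_ring v - {0} \<and> frac_val y b = frac_val x a}"

lemma frac_rel_iff:
  assumes x: "x \<in> carrier L" "a \<in> val_ring v - {0}" and y: "y \<in> carrier L" "b \<in> val_ring v - {0}"
  shows "lsmult L (\<iota> b) x = lsmult L (\<iota> a) y \<longleftrightarrow> frac_val x a = frac_val y b"
proof -
  have ab: "\<iota> a \<in> OB" "\<iota> b \<in> OB" "\<iota> a \<noteq> 0" "\<iota> b \<noteq> 0" using x y iota_OB by auto
  have c: "inverse (\<iota> b) * z = z * inverse (\<iota> b)" for z using iota_commute[of "inverse b" z] by (simp add: iota_inverse)
  have "lsmult L (\<iota> b) x = lsmult L (\<iota> a) y \<longleftrightarrow> \<psi> (lsmult L (\<iota> b) x) = \<psi> (lsmult L (\<iota> a) y)"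
    using psi(6)[OF L_closed(2)[OF x(1) ab(2)] L_closed(2)[OF y(1) ab(1)]] by auto
  also have "\<dots> \<longleftrightarrow> rsm (\<psi> x) (\<iota> b) = rsm (\<psi> y) (\<iota> a)" using psi(4) x y ab by (simp add: lsm_iota)
  also have "\<dots> \<longleftrightarrow> frac_val x a = frac_val y b"
  proof
    assume "rsm (\<psi> x) (\<iota> b) = rsm (\<psi> y) (\<iota> a)"
    then have "rsm (rsm (\<psi> x) (\<iota> b)) (inverse (\<iota> b) * inverse (\<iota> a)) = rsm (rsm (\<psi> y) (\<iota> a)) (inverse (\<iota> a) * inverse (\<iota> b))"
      by (simp add: c)
    then show "frac_val x a = frac_val y b"
      unfolding rsm_mult[symmetric] frac_val_def using ab by (simp flip: mult.assoc)
  next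
    assume "frac_val x a = frac_val y b"
    then have "rsm (frac_val x a) (\<iota> a * \<iota> b) = rsm (frac_val y b) (\<iota> b * \<iota> a)" using iota_commute[of a "\<iota> b"] by simp
    then show "rsm (\<psi> x) (\<iota> b) = rsm (\<psi> y) (\<iota> a)"
      unfolding rsm_mult[symmetric] frac_val_def using ab by (simp flip: mult.assoc)
  qed
  finally show ?thesis .
qed

lemma frac_class: assumes "x \<in> carrier L" "a \<in> val_ring v - {0}" shows "frac_rel v \<iota> L `` {(x, a)} = cl x a"
proof (intro equalityI subsetI)
  fix z assume "z \<in> frac_rel v \<iota> L `` {(x, a)}"
  then show "z \<in> cl x a" using frac_rel_iff[OF assms] unfolding frac_rel_def cl_def by auto
next
  fix z assume "z \<in> cl x a"
  then show "z \<in> frac_rel v \<iota> L `` {(x, a)}" using frac_rel_iff[OF assms] assms unfolding frac_rel_def cl_def by auto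
qed

lemma frac_spaceE:
  assumes "X \<in> frac_space v \<iota> L"
  obtains x a where "x \<in> carrier L" "a \<in> val_ring v - {0}" "X = cl x a"
proof -
  obtain z where z: "z \<in> carrier L \<times> (val_ring v - {0})" "X = frac_rel v \<iota> L `` {z}"
    using assms unfolding frac_space_def by (rule quotientE)
  obtain x a where xa: "z = (x, a)" "x \<in> carrier L" "a \<in> val_ring v - {0}" using z(1) by (rule SigmaE)
  have "X = cl x a" unfolding z(2) xa(1) by (rule frac_class[OF xa(2,3)])
  then show thesis by (rule that[OF xa(2,3)])
qed

lemma cl_frac_space: assumes "x \<in> carrier L" "a \<in> val_ring v - {0}" shows "cl x a \<in> frac_space v \<iota> L"
  unfolding frac_space_def frac_class[OF assms, symmetric] using assms by (intro quotientI) auto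

lemma frac_of_cl: "x \<in> carrier L \<Longrightarrow> frac_of v \<iota> L x = cl x 1"
  unfolding frac_of_def using frac_class one_val_ring by blast

lemma cl_self: "x \<in> carrier L \<Longrightarrow> a \<in> val_ring v - {0} \<Longrightarrow> (x, a) \<in> cl x a"
  by (simp add: cl_def)

lemma frac_val_1: "frac_val x 1 = \<psi> x"
  by (simp add: frac_val_def rsm_1)

lemma cl_eqI: "frac_val x a = frac_val y b \<Longrightarrow> cl x a = cl y b"
  by (simp add: cl_def)

end

text \<open>Solved for \<open>q\<close>, the assumption says that \<open>q\<close> corresponds on L
  to the twisted pairing of \<open>p\<close> by \<open>u\<close>.\<close>

locale form = bilat v \<iota> bar \<sigma> OB K ordB \<pi> \<omega> L Kd I \<psi> star u + model v \<iota> bar \<sigma> OB K ordB \<pi> \<omega> Kd q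
  for v :: "'f::field \<Rightarrow> int" and \<iota> :: "'f \<Rightarrow> 'b::division_ring" and bar \<sigma> OB K ordB \<pi> \<omega>
    and L :: "('b, 'l) bimodule" and Kd I \<psi> star u q +
  fixes p :: "'l \<Rightarrow> 'l \<Rightarrow> 'b"
  assumes pq: "x \<in> carrier L \<Longrightarrow> y \<in> carrier L \<Longrightarrow> p x y = q (\<psi> x) (lsm Kd (inverse u) (\<psi> y))"
begin

lemma frac_pairing_cl:
  assumes x: "x \<in> carrier L" "a \<in> val_ring v - {0}" and y: "y \<in> carrier L" "b \<in> val_ring v - {0}"
  shows "frac_pairing \<iota> p (cl x a) (cl y b) = q (frac_val x a) (lsm Kd (inverse u) (frac_val y b))"
  unfolding frac_pairing_def
proof (rule the_equality)
  have *: "\<iota> (inverse (a * b)) * p x y = q (frac_val x a) (lsm Kd (inverse u) (frac_val y b))"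
    if "x \<in> carrier L" "y \<in> carrier L" for x y a b
  proof -
    have "q (frac_val x a) (lsm Kd (inverse u) (frac_val y b)) = \<iota> (inverse a) * (p x y * \<iota> (inverse b))"
      unfolding frac_val_def iota_inverse[symmetric] using that
      by (simp add: lsm_rsm[symmetric] q_rs q_rs_right pq mult.assoc)
    also have "p x y * \<iota> (inverse b) = \<iota> (inverse b) * p x y" by (rule iota_commute[symmetric])
    finally show ?thesis by (simp add: iota_mult mult.assoc)
  qed
  show "\<forall>(x', a')\<in>cl x a. \<forall>(y', b')\<in>cl y b.
      q (frac_val x a) (lsm Kd (inverse u) (frac_val y b)) = \<iota> (inverse (a' * b')) * p x' y'"
    using * by (auto simp: cl_def)
  fix c assume "\<forall>(x', a')\<in>cl x a. \<forall>(y', b')\<in>cl y b. c = \<iota> (inverse (a' * b')) * p x' y'"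
  then have "c = \<iota> (inverse (a * b)) * p x y" using cl_self x y by blast
  then show "c = q (frac_val x a) (lsm Kd (inverse u) (frac_val y b))" using * x y by simp
qed

lemma lsm_u: "lsm Kd (inverse u) (lsm Kd u f) = f" "lsm Kd u (lsm Kd (inverse u) f) = f"
  using u by (simp_all add: lsm_1 flip: lsm_mult)

lemma perfect_perf: assumes pf: "perfect_pairing v \<iota> OB L p" shows "perf M"
proof -
  have dual: "X \<in> frac_of v \<iota> L ` carrier L \<longleftrightarrow>
      X \<in> frac_space v \<iota> L \<and> (\<forall>y\<in>carrier L. frac_pairing \<iota> p X (frac_of v \<iota> L y) \<in> OB)" for X
    using pf unfolding perfect_pairing_def by blast
  have p_OB: "p x y \<in> OB" if "x \<in> carrier L" "y \<in> carrier L" for x y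
  proof -
    have "frac_pairing \<iota> p (frac_of v \<iota> L x) (frac_of v \<iota> L y) \<in> OB" using dual that by blast
    then show ?thesis using that one_val_ring by (simp add: frac_of_cl frac_pairing_cl frac_val_1 pq)
  qed
  show ?thesis unfolding perf_def
  proof (intro conjI ballI impI)
    fix f g assume fg: "f \<in> M" "g \<in> M"
    have L: "\<phi> f \<in> carrier L" "\<phi> (lsm Kd u g) \<in> carrier L" using fg phi(2) Mlat_ls u_OB by auto
    have "p (\<phi> f) (\<phi> (lsm Kd u g)) = q f g"
      using pq[OF L] fg Mlat_ls u_OB by (simp add: psi_phi lsm_u)
    then show "q f g \<in> OB" using p_OB[OF L] by simp
  next
    fix f assume f: "f \<in> M" and fP: "\<forall>g\<in>M. q f g \<in> P"
    \<comment> \<open>The vector to be tested is \<open>f\<close> divided by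
      \<open>\<omega>\<close>. As a fraction with denominator in O_F it is
      \<open>rsm f \<omega>\<close> over \<open>\<pi>\<close>.\<close>
    define x where "x = \<phi> (rsm f \<omega>)"
    have x: "x \<in> carrier L" "\<psi> x = rsm f \<omega>" using phi(2) psi_phi Mlat_rs[OF f omega_OB] by (auto simp: x_def)
    have pi': "\<pi> \<in> val_ring v - {0}" using pi by (simp add: val_ring_def)
    have wi: "\<omega> * inverse (\<iota> \<pi>) = inverse \<omega>"
      unfolding omega_sq[symmetric] by (simp add: nonzero_inverse_mult_distrib flip: mult.assoc)
    have val: "frac_val x \<pi> = rsm f (inverse \<omega>)" by (simp add: frac_val_def x(2) wi flip: rsm_mult)
    have "cl x \<pi> \<in> frac_of v \<iota> L ` carrier L"
      unfolding dual
    proof (intro conjI ballI)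
      show "cl x \<pi> \<in> frac_space v \<iota> L" by (rule cl_frac_space[OF x(1) pi'])
      fix y assume y: "y \<in> carrier L"
      let ?g = "lsm Kd (inverse u) (\<psi> y)"
      have "?g \<in> M" using psi(2)[OF y] Mlat_ls u_OB by blast
      then obtain t where t: "t \<in> OB" "q f ?g = t * \<omega>" using fP P_right by blast
      have "frac_pairing \<iota> p (cl x \<pi>) (frac_of v \<iota> L y) = q (rsm f (inverse \<omega>)) ?g"
        using frac_pairing_cl[OF x(1) pi' y one_val_ring] y by (simp add: frac_of_cl val frac_val_1)
      \<comment> \<open>The factor \<open>\<omega>\<close> of the value and the inverse pulled out
        on the left combine to a conjugation, which preserves O_B.\<close>
      also have "\<dots> = - (inverse \<omega> * t * \<omega>)" by (simp add: q_rs t bar_inverse bar_omega mult.assoc)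
      finally show "frac_pairing \<iota> p (cl x \<pi>) (frac_of v \<iota> L y) \<in> OB"
        using omega_conj_OB(2)[OF t(1)] OB_closed(6) by simp
    qed
    then obtain y where y: "y \<in> carrier L" "cl x \<pi> = cl y 1" by (auto simp: frac_of_cl)
    then have "(x, \<pi>) \<in> cl y 1" using cl_self[OF x(1) pi'] by simp
    then have "rsm f (inverse \<omega>) = \<psi> y" using val by (simp add: cl_def frac_val_1)
    then have "rsm (rsm f (inverse \<omega>)) \<omega> = rsm (\<psi> y) \<omega>" by simp
    then have "f = rsm (\<psi> y) \<omega>" by (simp add: rsm_1 flip: rsm_mult)
    then show "\<exists>g\<in>M. f = rsm g \<omega>" using psi(2)[OF y(1)] by blast
  qed
qed

text \<open>\<open>hyp_sum_divide\<close> is used twice: with divisor 0 it gives non-degeneracy,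
  with the denominator of a fraction it gives self-duality.\<close>

lemma hyp_sum_perfect:
  assumes h: "hyp_sum M ps" shows "perfect_hermitian_pairing v \<iota> bar OB star L p"
proof -
  note int = hyp_sum_integral[OF h] and div = hyp_sum_divide[OF h]
  have psi_iota: "\<psi> (lsmult L (\<iota> a) x) = rsm (\<psi> x) (\<iota> a)" if "a \<in> val_ring v" "x \<in> carrier L" for a x
    using psi(4)[OF iota_OB[OF that(1)] that(2)] by (simp add: lsm_iota)
  \<comment> \<open>As \<open>u\<close> is a unit of O_B, the vectors
    \<open>lsm Kd (inverse u) (\<psi> y)\<close> run through the whole lattice.\<close>
  have test: "\<exists>t\<in>OB. q f g = \<iota> a * t"
    if f: "\<And>y. y \<in> carrier L \<Longrightarrow> \<exists>t\<in>OB. q f (lsm Kd (inverse u) (\<psi> y)) = \<iota> a * t" and g: "g \<in> M" for f g a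
  proof -
    have "lsm Kd u g \<in> M" using g Mlat_ls u_OB by blast
    then have "\<phi> (lsm Kd u g) \<in> carrier L" "\<psi> (\<phi> (lsm Kd u g)) = lsm Kd u g" using phi(2) psi_phi by auto
    then show ?thesis using f[of "\<phi> (lsm Kd u g)"] by (simp add: lsm_u)
  qed
  have herm: "hermitian_pairing v \<iota> bar OB star L p"
    unfolding hermitian_pairing_def
  proof (intro conjI ballI impI)
    fix x y z assume *: "x \<in> carrier L" "y \<in> carrier L" "z \<in> carrier L"
    show "p (x \<oplus>\<^bsub>L\<^esub> y) z = p x z + p y z" "p x (y \<oplus>\<^bsub>L\<^esub> z) = p x y + p x z"
      using * L_closed(1) by (simp_all add: pq psi(3) q_add_left ls_add q_add)
  next
    fix a x y assume *: "a \<in> val_ring v" "x \<in> carrier L" "y \<in> carrier L"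
    show "p (lsmult L (\<iota> a) x) y = \<iota> a * p x y" "p x (lsmult L (\<iota> a) y) = \<iota> a * p x y"
      using * L_closed(2) iota_OB[OF *(1)]
      by (simp_all add: pq psi_iota q_rs lsm_rsm[symmetric] q_rs_right iota_commute[of a "q _ _"])
  next
    fix X assume X: "X \<in> frac_space v \<iota> L" and z: "\<forall>Y\<in>frac_space v \<iota> L. frac_pairing \<iota> p X Y = 0"
    obtain x a where x: "x \<in> carrier L" "a \<in> val_ring v - {0}" "X = cl x a" using X by (rule frac_spaceE)
    have "\<exists>t\<in>OB. q (\<psi> x) (lsm Kd (inverse u) (\<psi> y)) = \<iota> 0 * t" if y: "y \<in> carrier L" for y
    proof -
      have "frac_pairing \<iota> p X (cl y 1) = 0" using z cl_frac_space[OF y one_val_ring] by blast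
      then have "q (frac_val x a) (lsm Kd (inverse u) (\<psi> y)) = 0"
        using frac_pairing_cl[OF x(1,2) y one_val_ring] x(3) by (simp add: frac_val_1)
      then have "q (\<psi> x) (lsm Kd (inverse u) (\<psi> y)) = 0" using x by (simp add: frac_val_def q_rs)
      then show ?thesis using OB_closed(1) by auto
    qed
    then obtain g where "\<psi> x = rsm g (\<iota> 0)" using div[OF psi(2)[OF x(1)], of 0] test by blast
    then have "frac_val x a = frac_val \<zero>\<^bsub>L\<^esub> 1" by (simp add: frac_val_def zero_L)
    then show "X = frac_of v \<iota> L \<zero>\<^bsub>L\<^esub>" unfolding x(3) frac_of_cl[OF zero_L(1)] by (rule cl_eqI)
  next
    fix x y assume *: "x \<in> carrier L" "y \<in> carrier L"
    have "bar (p y x) = - q (lsm Kd (inverse u) (\<psi> x)) (\<psi> y)"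
      using * q_skew[of "lsm Kd (inverse u) (\<psi> x)" "\<psi> y"] by (simp add: pq)
    also have "\<dots> = p x y" using * by (simp add: pq q_ls u_OB ls_minus_left q_minus)
    finally show "p x y = bar (p y x)" ..
  next
    fix x y a b assume *: "x \<in> carrier L" "y \<in> carrier L" "a \<in> OB" "b \<in> OB"
    show "p (rsmult L x a) (rsmult L y b) = bar a * p x y * b"
      using * L_closed(3) by (simp add: pq psi(5) q_rs lsm_rsm[symmetric] q_rs_right mult.assoc)
  next
    fix x y a assume *: "x \<in> carrier L" "y \<in> carrier L" "a \<in> OB"
    have "star a \<in> OB" unfolding star using u_OB bar_OB * OB_closed(5) by blast
    moreover have "inverse u * star a = bar a * inverse u" unfolding star using u by (simp flip: mult.assoc)
    ultimately show "p (lsmult L a x) y = p x (lsmult L (star a) y)"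
      using * L_closed(2) by (simp add: pq psi(4) q_ls flip: lsm_mult)
  qed
  moreover have "perfect_pairing v \<iota> OB L p"
    unfolding perfect_pairing_def
  proof (intro equalityI subsetI)
    fix X assume "X \<in> frac_of v \<iota> L ` carrier L"
    then obtain x where x: "x \<in> carrier L" "X = cl x 1" by (auto simp: frac_of_cl)
    have "frac_pairing \<iota> p X (frac_of v \<iota> L y) \<in> OB" if y: "y \<in> carrier L" for y
      using frac_pairing_cl[OF x(1) one_val_ring y one_val_ring] y x int[OF psi(2)[OF x(1)] Mlat_ls[OF psi(2)[OF y] u_OB(2)]]
      by (simp add: frac_of_cl frac_val_1)
    then show "X \<in> {X \<in> frac_space v \<iota> L. \<forall>y\<in>carrier L. frac_pairing \<iota> p X (frac_of v \<iota> L y) \<in> OB}"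
      using cl_frac_space[OF x(1) one_val_ring] x(2) by simp
  next
    fix X assume X: "X \<in> {X \<in> frac_space v \<iota> L. \<forall>y\<in>carrier L. frac_pairing \<iota> p X (frac_of v \<iota> L y) \<in> OB}"
    then have "X \<in> frac_space v \<iota> L" by simp
    then obtain x a where x: "x \<in> carrier L" "a \<in> val_ring v - {0}" "X = cl x a" by (rule frac_spaceE)
    have "\<exists>t\<in>OB. q (\<psi> x) (lsm Kd (inverse u) (\<psi> y)) = \<iota> a * t" if y: "y \<in> carrier L" for y
    proof -
      have "frac_pairing \<iota> p X (frac_of v \<iota> L y) \<in> OB" using X y by blast
      then have "inverse (\<iota> a) * q (\<psi> x) (lsm Kd (inverse u) (\<psi> y)) \<in> OB"
        using frac_pairing_cl[OF x(1,2) y one_val_ring] y x(3)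
        by (simp add: frac_of_cl frac_val_def rsm_1 q_rs bar_inverse)
      moreover have "q (\<psi> x) (lsm Kd (inverse u) (\<psi> y)) = \<iota> a * (inverse (\<iota> a) * q (\<psi> x) (lsm Kd (inverse u) (\<psi> y)))"
        using x by (simp flip: mult.assoc)
      ultimately show ?thesis by blast
    qed
    then obtain g where g: "g \<in> M" "\<psi> x = rsm g (\<iota> a)" using div[OF psi(2)[OF x(1)], of a] test by blast
    have "frac_val x a = frac_val (\<phi> g) 1" using x g by (simp add: frac_val_1 psi_phi) (simp add: frac_val_def rsm_1 flip: rsm_mult)
    then have "X = frac_of v \<iota> L (\<phi> g)" unfolding x(3) frac_of_cl[OF phi(2)[OF g(1)]] by (rule cl_eqI)
    then show "X \<in> frac_of v \<iota> L ` carrier L" using phi(2)[OF g(1)] by blast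
  qed
  ultimately show ?thesis unfolding perfect_hermitian_pairing_def by blast
qed

lemma hyp_sum_isometric:
  assumes h: "hyp_sum M ps"
  shows "isometric OB L (twist_pairing L p u) (embedding_bilattice OB (fst (orthogonal_sum (map bM ps))))
    (gram_pairing bar (snd (orthogonal_sum (map bM ps))))"
proof -
  obtain G where G: "gram_rep (orthogonal_sum (map bM ps)) M G" using hyp_sum_gram_rep[OF h] by blast
  let ?e = "fst (orthogonal_sum (map bM ps))"
  have R: "rep ?e M G" using G unfolding gram_rep_def by blast
  let ?h = "inv_into (carrier (embedding_bilattice OB ?e)) G"
  have hiso: "bimodule_iso OB (mrec Kd M) (embedding_bilattice OB ?e) ?h"
    by (rule bimodule_iso_inv[OF rep_iso[OF R]])
  have b: "bij_betw G (int_vecs OB (fst ?e)) M" using bimodule_isoD(1)[OF rep_iso(1)[OF R]] by simp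
  have hG: "?h f \<in> int_vecs OB (fst ?e)" "G (?h f) = f" if "f \<in> M" for f
    using bimodule_isoD(2)[OF hiso] bij_betw_inv_into_right[OF b] that by auto
  have "gram_pairing bar (snd (orthogonal_sum (map bM ps))) (?h (\<psi> x)) (?h (\<psi> y)) = twist_pairing L p u x y"
    if xy: "x \<in> carrier L" "y \<in> carrier L" for x y
  proof -
    have "gram_pairing bar (snd (orthogonal_sum (map bM ps))) (?h (\<psi> x)) (?h (\<psi> y)) = q (\<psi> x) (\<psi> y)"
      using G hG[OF psi(2)[OF xy(1)]] hG[OF psi(2)[OF xy(2)]] unfolding gram_rep_def by metis
    then show ?thesis using xy L_closed(2) u_OB by (simp add: twist_pairing_def pq psi(4) lsm_u)
  qed
  then show ?thesis using bimodule_iso_trans[OF iso hiso] unfolding isometric_def by blast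
qed

end

text \<open>Twisting by \<open>u\<close> makes the form skew because \<open>star u = - u\<close>,
  and turns adjointness for \<open>star\<close> into adjointness for \<open>bar\<close> because
  \<open>star a * u = u * bar a\<close>.\<close>

lemma (in bilat) form_exists:
  assumes h: "hermitian_pairing v \<iota> bar OB star L p"
  shows "\<exists>q. form v \<iota> bar \<sigma> OB K ordB \<pi> \<omega> L Kd I \<psi> star u q p"
proof -
  note hp1 = h[unfolded hermitian_pairing_def]
  note hp2 = conjunct2[OF hp1] note hp3 = conjunct2[OF hp2] note hp4 = conjunct2[OF hp3] note hp5 = conjunct2[OF hp4]
  have p_add: "p (x \<oplus>\<^bsub>L\<^esub> y) z = p x z + p y z" "p z (x \<oplus>\<^bsub>L\<^esub> y) = p z x + p z y"
    if "x \<in> carrier L" "y \<in> carrier L" "z \<in> carrier L" for x y z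
    using conjunct1[OF hp1] that by blast+
  have p_iota: "p x (lsmult L (\<iota> a) y) = \<iota> a * p x y" if "a \<in> val_ring v" "x \<in> carrier L" "y \<in> carrier L" for a x y
    using conjunct1[OF hp2] that by blast
  have p_bar: "p x y = bar (p y x)" if "x \<in> carrier L" "y \<in> carrier L" for x y
    using conjunct1[OF hp4] that by blast
  have p_rs2: "p (rsmult L x a) (rsmult L y b) = bar a * p x y * b"
    if "x \<in> carrier L" "y \<in> carrier L" "a \<in> OB" "b \<in> OB" for x y a b
    using conjunct1[OF hp5] that by blast
  have p_star: "p (lsmult L a x) y = p x (lsmult L (star a) y)"
    if "x \<in> carrier L" "y \<in> carrier L" "a \<in> OB" for x y a
    using conjunct2[OF hp5] that by blast
  note bm0 = bim[unfolded is_bimodule_def]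
  note bm2 = conjunct2[OF conjunct2[OF conjunct2[OF bm0]]]
  have bm: "lsmult L (a * b) x = lsmult L a (lsmult L b x)"
    "lsmult L (a + b) x = lsmult L a x \<oplus>\<^bsub>L\<^esub> lsmult L b x"
    "rsmult L (lsmult L a x) b = lsmult L a (rsmult L x b)"
    if "a \<in> OB" "b \<in> OB" "x \<in> carrier L" for a b x
    using conjunct1[OF bm2] that by blast+
  have bm_1: "rsmult L x 1 = x" "lsmult L 1 x = x" if "x \<in> carrier L" for x
    using conjunct2[OF bm2] that by blast+
  have p_rs: "p x (rsmult L y b) = p x y * b" if "x \<in> carrier L" "y \<in> carrier L" "b \<in> OB" for x y b
    using p_rs2[OF that(1,2) OB_closed(2) that(3)] that by (simp add: bm_1)
  have p_minus_u: "p x (lsmult L (- u) y) = - p x (lsmult L u y)" if "x \<in> carrier L" "y \<in> carrier L" for x y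
  proof -
    have mu: "- u \<in> OB" using u_OB OB_closed(6) by blast
    have "p x (lsmult L (u + - u) y) = p x (lsmult L u y) + p x (lsmult L (- u) y)"
      unfolding bm(2)[OF u_OB(1) mu that(2)] using that L_closed(2) u_OB mu by (intro p_add(2)) auto
    moreover have "p x (lsmult L (\<iota> 0) y) = 0" using p_iota[of 0 x y] that by (simp add: val_ring_def)
    ultimately show ?thesis by (simp add: eq_neg_iff_add_eq_0 add.commute)
  qed
  define q0 where "q0 f g = p (\<phi> f) (lsmult L u (\<phi> g))" for f g
  have star_OB: "star a \<in> OB" if "a \<in> OB" for a unfolding star using u_OB bar_OB that OB_closed(5) by blast
  have "\<exists>q. model v \<iota> bar \<sigma> OB K ordB \<pi> \<omega> Kd q \<and> (\<forall>x\<in>M. \<forall>y\<in>M. q x y = q0 x y)"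
  proof (rule extend_form[OF finite_I])
    fix x y z assume *: "x \<in> M" "y \<in> M" "z \<in> M"
    then show "q0 (x + y) z = q0 x z + q0 y z"
      using phi(2) L_closed(2) u_OB by (simp add: q0_def phi(3) p_add)
  next
    fix x y b assume *: "x \<in> M" "y \<in> M" "b \<in> OB"
    then show "q0 x (rsm y b) = q0 x y * b"
      using phi(2) L_closed(2) u_OB by (simp add: q0_def phi(5) bm(3)[symmetric] p_rs)
  next
    fix x y assume *: "x \<in> M" "y \<in> M"
    have "q0 y x = bar (p (lsmult L u (\<phi> x)) (\<phi> y))"
      unfolding q0_def using * phi(2) L_closed(2) u_OB by (intro p_bar) auto
    also have "p (lsmult L u (\<phi> x)) (\<phi> y) = p (\<phi> x) (lsmult L (star u) (\<phi> y))"
      using * phi(2) u_OB by (intro p_star) auto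
    also have "star u = - u" unfolding star using u by (simp add: mult.assoc)
    also have "p (\<phi> x) (lsmult L (- u) (\<phi> y)) = - q0 x y"
      unfolding q0_def using * phi(2) by (intro p_minus_u) auto
    finally show "q0 y x = - bar (q0 x y)" by (simp add: bar_minus)
  next
    fix x y a assume *: "x \<in> M" "y \<in> M" "a \<in> OB"
    have "q0 (lsm Kd a x) y = p (\<phi> x) (lsmult L (star a) (lsmult L u (\<phi> y)))"
      unfolding q0_def using * phi(2) L_closed(2) u_OB by (simp add: phi(4) p_star)
    also have "lsmult L (star a) (lsmult L u (\<phi> y)) = lsmult L (star a * u) (\<phi> y)"
      using * phi(2) u_OB star_OB by (simp add: bm(1))
    also have "star a * u = u * bar a" unfolding star using u by (simp add: mult.assoc)
    also have "p (\<phi> x) (lsmult L (u * bar a) (\<phi> y)) = q0 x (lsm Kd (bar a) y)"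
      unfolding q0_def using * phi(2) u_OB bar_OB by (simp add: bm(1) phi(4))
    finally show "q0 (lsm Kd a x) y = q0 x (lsm Kd (bar a) y)" .
  qed
  then obtain q where q: "model v \<iota> bar \<sigma> OB K ordB \<pi> \<omega> Kd q" "\<And>x y. x \<in> M \<Longrightarrow> y \<in> M \<Longrightarrow> q x y = q0 x y" by blast
  have "p x y = q (\<psi> x) (lsm Kd (inverse u) (\<psi> y))" if xy: "x \<in> carrier L" "y \<in> carrier L" for x y
  proof -
    have M: "\<psi> x \<in> M" "\<psi> y \<in> M" "lsm Kd (inverse u) (\<psi> y) \<in> M" using psi(2) xy Mlat_ls u_OB by auto
    have "q (\<psi> x) (lsm Kd (inverse u) (\<psi> y)) = p x (lsmult L u (lsmult L (inverse u) y))"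
      using q(2)[OF M(1,3)] M xy u_OB by (simp add: q0_def phi_psi phi(4))
    also have "lsmult L u (lsmult L (inverse u) y) = lsmult L (u * inverse u) y"
      using u_OB xy by (simp add: bm(1))
    finally show ?thesis using u xy by (simp add: bm_1)
  qed
  then have "form v \<iota> bar \<sigma> OB K ordB \<pi> \<omega> L Kd I \<psi> star u q p"
    by (intro form.intro form_axioms.intro bilat_axioms q(1))
  then show ?thesis by blast
qed


section \<open>Classification\<close>

text \<open>Since \<open>u\<close> is invertible in the order, a pairing is recovered from its twist
  as the twisted value at \<open>x\<close> and \<open>lsmult L (inverse u) y\<close>, and isometries
  respect the left action of \<open>u\<close>.\<close>

lemma isometric_untwist:
  assumes L: "is_bimodule S L" and L': "is_bimodule S L'" and u: "u \<in> S" "inverse u \<in> S" "u \<noteq> 0"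
    and i: "isometric S L (twist_pairing L p u) E g" and i': "isometric S L' (twist_pairing L' p' u) E g"
  shows "isometric S L p L' p'"
proof -
  obtain f f' where f: "bimodule_iso S L E f" "\<And>x y. x \<in> carrier L \<Longrightarrow> y \<in> carrier L \<Longrightarrow> g (f x) (f y) = p x (lsmult L u y)"
    and f': "bimodule_iso S L' E f'" "\<And>x y. x \<in> carrier L' \<Longrightarrow> y \<in> carrier L' \<Longrightarrow> g (f' x) (f' y) = p' x (lsmult L' u y)"
    using i i' unfolding isometric_def twist_pairing_def by blast
  note f'i = bimodule_iso_inv[OF f'(1) bimodule_closed[OF L']]
  define h where "h x = inv_into (carrier L') f' (f x)" for x
  have h: "bimodule_iso S L L' h" unfolding h_def by (rule bimodule_iso_trans[OF f(1) f'i])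
  have f'h: "f' (h x) = f x" if "x \<in> carrier L" for x
    unfolding h_def using bij_betw_inv_into_right[OF bimodule_isoD(1)[OF f'(1)]] bimodule_isoD(2)[OF f(1) that] by blast
  have uu: "lsmult L u (lsmult L (inverse u) y) = y" "lsmult L (inverse u) y \<in> carrier L" if y: "y \<in> carrier L" for y
  proof -
    have "lsmult L (u * inverse u) y = lsmult L u (lsmult L (inverse u) y)" "lsmult L 1 y = y"
      "lsmult L (inverse u) y \<in> carrier L"
      using L u y unfolding is_bimodule_def by blast+
    then show "lsmult L u (lsmult L (inverse u) y) = y" "lsmult L (inverse u) y \<in> carrier L" using u(3) by simp_all
  qed
  have "p' (h x) (h y) = p x y" if x: "x \<in> carrier L" and y: "y \<in> carrier L" for x y
  proof -
    let ?z = "lsmult L (inverse u) y"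
    have z: "?z \<in> carrier L" by (rule uu(2)[OF y])
    have "h y = lsmult L' u (h ?z)" using bimodule_isoD(4)[OF h u(1) z] uu(1)[OF y] by simp
    then have "p' (h x) (h y) = g (f' (h x)) (f' (h ?z))"
      using f'(2) bimodule_isoD(2)[OF h] x z by simp
    also have "\<dots> = p x y" unfolding f'h[OF x] f'h[OF z] f(2)[OF x z] uu(1)[OF y] ..
    finally show ?thesis .
  qed
  then show ?thesis unfolding isometric_def using h by blast
qed

context quat
begin

lemma card_Kstd:
  defines "I r1 r2 t1 t2 \<equiv> {0..<r1 + r2 + t1 + t2 :: nat}"
  shows "card {i \<in> I r1 r2 t1 t2. Kstd r1 r2 t1 i = KO} = r1" "card {i \<in> I r1 r2 t1 t2. Kstd r1 r2 t1 i = KP} = r2"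
    "card {i \<in> I r1 r2 t1 t2. Kstd r1 r2 t1 i = K1} = t1" "card {i \<in> I r1 r2 t1 t2. Kstd r1 r2 t1 i = K2} = t2"
proof -
  have "{i \<in> I r1 r2 t1 t2. Kstd r1 r2 t1 i = KO} = {0..<r1}" by (auto simp: I_def Kstd_def split: if_splits)
  moreover have "{i \<in> I r1 r2 t1 t2. Kstd r1 r2 t1 i = KP} = {r1..<r1 + r2}"
    by (auto simp: I_def Kstd_def split: if_splits)
  moreover have "{i \<in> I r1 r2 t1 t2. Kstd r1 r2 t1 i = K1} = {r1 + r2..<r1 + r2 + t1}"
    by (auto simp: I_def Kstd_def split: if_splits)
  moreover have "{i \<in> I r1 r2 t1 t2. Kstd r1 r2 t1 i = K2} = {r1 + r2 + t1..<r1 + r2 + t1 + t2}"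
    by (auto simp: I_def Kstd_def split: if_splits)
  ultimately show "card {i \<in> I r1 r2 t1 t2. Kstd r1 r2 t1 i = KO} = r1" "card {i \<in> I r1 r2 t1 t2. Kstd r1 r2 t1 i = KP} = r2"
    "card {i \<in> I r1 r2 t1 t2. Kstd r1 r2 t1 i = K1} = t1" "card {i \<in> I r1 r2 t1 t2. Kstd r1 r2 t1 i = K2} = t2"
    by simp_all
qed

lemma structural_bilat:
  assumes L: "structural_invariant v \<iota> OB K \<sigma> \<pi> \<omega> L r1 r2 t1 t2"
    and u: "u \<noteq> 0" "ordB u = 0" "bar u = - u" and star: "\<And>\<alpha>. star \<alpha> = u * bar \<alpha> * inverse u"
  obtains \<psi> where "bilat v \<iota> bar \<sigma> OB K ordB \<pi> \<omega> L (Kstd r1 r2 t1) {0..<r1 + r2 + t1 + t2} \<psi> star u"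
proof -
  obtain \<psi> where psi: "bimodule_iso OB L (mrec (Kstd r1 r2 t1) (Mlat (Kstd r1 r2 t1) {0..<r1 + r2 + t1 + t2})) \<psi>"
    using structural_model[OF L] by blast
  have "is_bimodule OB L" using L unfolding structural_invariant_def bilattice_def by blast
  then have "bilat v \<iota> bar \<sigma> OB K ordB \<pi> \<omega> L (Kstd r1 r2 t1) {0..<r1 + r2 + t1 + t2} \<psi> star u"
    by (unfold_locales) (use psi u star in auto)
  then show thesis by (rule that)
qed

lemma perfect_classification:
  assumes L: "structural_invariant v \<iota> OB K \<sigma> \<pi> \<omega> L r1 r2 t1 t2"
    and u: "u \<noteq> 0" "ordB u = 0" "bar u = - u" and star: "\<And>\<alpha>. star \<alpha> = u * bar \<alpha> * inverse u"
    and p: "perfect_hermitian_pairing v \<iota> bar OB star L p"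
  defines "S \<equiv> standard_skew_sum \<iota> K \<sigma> \<pi> \<omega> (r1 div 2) (r2 div 2) t1"
  shows "even r1 \<and> even r2 \<and> t1 = t2 \<and>
    isometric OB L (twist_pairing L p u) (embedding_bilattice OB (fst S)) (gram_pairing bar (snd S))"
proof -
  let ?I = "{0..<r1 + r2 + t1 + t2}" and ?Kd = "Kstd r1 r2 t1"
  obtain \<psi> where "bilat v \<iota> bar \<sigma> OB K ordB \<pi> \<omega> L ?Kd ?I \<psi> star u"
    using structural_bilat[OF L u star] by blast
  then interpret bilat v \<iota> bar \<sigma> OB K ordB \<pi> \<omega> L ?Kd ?I \<psi> star u .
  have h: "hermitian_pairing v \<iota> bar OB star L p" "perfect_pairing v \<iota> OB L p"
    using p unfolding perfect_hermitian_pairing_def by blast+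
  obtain q where "form v \<iota> bar \<sigma> OB K ordB \<pi> \<omega> L ?Kd ?I \<psi> star u q p" using form_exists[OF h(1)] by blast
  then interpret form v \<iota> bar \<sigma> OB K ordB \<pi> \<omega> L ?Kd ?I \<psi> star u q p .
  note c = frame_classification[OF frame_Mlat[OF finite_I] perfect_perf[OF h(2)], unfolded card_Kstd]
  have "S = orthogonal_sum (map bM (replicate (r1 div 2) H4 @ replicate (r2 div 2) H5 @ replicate t1 H6))"
    by (simp add: S_def standard_skew_sum_def map_replicate)
  then show ?thesis using c hyp_sum_isometric by metis
qed

lemma perfect_exists:
  assumes L: "structural_invariant v \<iota> OB K \<sigma> \<pi> \<omega> L r1 r2 t t"
    and u: "u \<noteq> 0" "ordB u = 0" "bar u = - u" and star: "\<And>\<alpha>. star \<alpha> = u * bar \<alpha> * inverse u"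
    and ev: "even r1" "even r2"
  shows "\<exists>p. perfect_hermitian_pairing v \<iota> bar OB star L p"
proof -
  obtain a b where r: "r1 = 2 * a" "r2 = 2 * b" using ev by (auto elim!: evenE)
  let ?I = "{0..<r1 + r2 + t + t}" and ?Kd = "Kstd r1 r2 t"
  obtain \<psi> where "bilat v \<iota> bar \<sigma> OB K ordB \<pi> \<omega> L ?Kd ?I \<psi> star u"
    using structural_bilat[OF L u star] by blast
  then interpret bilat v \<iota> bar \<sigma> OB K ordB \<pi> \<omega> L ?Kd ?I \<psi> star u .
  \<comment> \<open>Among the \<open>KO\<close> indices the first half is matched with the second,
    likewise among the \<open>KP\<close> indices, and the \<open>K1\<close> indices are matched with
    the \<open>K2\<close> indices.\<close>
  define l where "l = map (\<lambda>m. (m, a + m)) [0..<a] @ map (\<lambda>m. (r1 + m, r1 + b + m)) [0..<b] @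
    map (\<lambda>m. (r1 + r2 + m, r1 + r2 + t + m)) [0..<t]"
  have mem: "(i, j) \<in> set l \<longleftrightarrow> (i < a \<and> j = a + i) \<or> (r1 \<le> i \<and> i < r1 + b \<and> j = b + i) \<or>
      (r1 + r2 \<le> i \<and> i < r1 + r2 + t \<and> j = t + i)" for i j
  proof -
    have *: "(i, j) \<in> set (map (\<lambda>m. (x + m, x + y + m)) [0..<z]) \<longleftrightarrow> x \<le> i \<and> i < x + z \<and> j = y + i" for x y z
    proof
      assume "x \<le> i \<and> i < x + z \<and> j = y + i"
      then show "(i, j) \<in> set (map (\<lambda>m. (x + m, x + y + m)) [0..<z])"
        by (auto intro!: image_eqI[of _ _ "i - x"])
    qed auto
    show ?thesis unfolding l_def set_append Un_iff *[of r1 b b] *[of "r1 + r2" t t] using *[of 0 a a] by simp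
  qed
  have part: "?Kd j = partner (?Kd i) \<and> i \<noteq> j \<and> ?Kd i \<noteq> K2" if "(i, j) \<in> set l" for i j
    using that unfolding mem r by (auto simp: Kstd_def)
  have disj: "{i, j} \<inter> {i', j'} = {}" if "(i, j) \<in> set l" "(i', j') \<in> set l" "(i, j) \<noteq> (i', j')" for i j i' j'
    using that unfolding mem r by auto
  have dist: "distinct l" unfolding l_def by (auto simp: distinct_map inj_on_def r)
  have union: "(\<Union>(i, j)\<in>set l. {i, j}) = ?I"
  proof (intro equalityI subsetI)
    fix x assume "x \<in> (\<Union>(i, j)\<in>set l. {i, j})"
    then obtain i j where "(i, j) \<in> set l" "x = i \<or> x = j" by auto
    then show "x \<in> ?I" unfolding mem r by auto
  next
    fix x assume x: "x \<in> ?I"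
    have "\<exists>i j. (i, j) \<in> set l \<and> (x = i \<or> x = j)"
    proof -
      consider "x < a" | "a \<le> x" "x < 2 * a" | "r1 \<le> x" "x < r1 + b" | "r1 + b \<le> x" "x < r1 + r2"
        | "r1 + r2 \<le> x" "x < r1 + r2 + t" | "r1 + r2 + t \<le> x" "x < r1 + r2 + t + t"
        using x r by (auto simp: not_le[symmetric])
      then show ?thesis
      proof cases
        case 1 then show ?thesis unfolding mem by blast
      next
        case 2 then have "x - a < a \<and> x = a + (x - a)" by auto
        then show ?thesis unfolding mem by blast
      next
        case 3 then show ?thesis unfolding mem by blast
      next
        case 4 then have "r1 \<le> x - b \<and> x - b < r1 + b \<and> x = b + (x - b)" using r by auto
        then show ?thesis unfolding mem by blast
      next
        case 5 then show ?thesis unfolding mem by blast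
      next
        case 6 then have "r1 + r2 \<le> x - t \<and> x - t < r1 + r2 + t \<and> x = t + (x - t)" by auto
        then show ?thesis unfolding mem by blast
      qed
    qed
    then show "x \<in> (\<Union>(i, j)\<in>set l. {i, j})" by auto
  qed
  define p where "p x y = pair_form ?Kd (set l) (\<psi> x) (lsm ?Kd (inverse u) (\<psi> y))" for x y
  interpret form v \<iota> bar \<sigma> OB K ordB \<pi> \<omega> L ?Kd ?I \<psi> star u "pair_form ?Kd (set l)" p
  proof (intro form.intro form_axioms.intro bilat_axioms pair_form_model)
    show "?Kd j = partner (?Kd i)" if "(i, j) \<in> set l" for i j using part that by blast
  qed (simp add: p_def)
  have "hyp_sum M (map (\<lambda>(i, j). plane_of (?Kd i)) l)"
    using pair_form_hyp_sum[OF refl finite_set part disj subset_refl dist] unfolding union .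
  then show ?thesis using hyp_sum_perfect by blast
qed

end

theorem theorem4p2p1:
  fixes v :: "'f::field \<Rightarrow> int"
    and \<iota> :: "'f \<Rightarrow> 'b::division_ring"
    and bar star \<sigma> :: "'b \<Rightarrow> 'b"
    and OB K :: "'b set"
    and ordB :: "'b \<Rightarrow> int"
    and \<pi> :: 'f
    and \<omega> \<gamma> :: 'b
    and L :: "('b, 'l) bimodule"
    and r1 r2 t1 t2 :: nat
  assumes "nonarch_local_field v" and "(2::'f) \<noteq> 0"
    and "quaternion_division_algebra \<iota>"
    and "canonical_involution \<iota> bar"
    and "maximal_order v \<iota> OB"
    and "algebra_valuation v \<iota> ordB"
    and "unramified_quadratic_subfield v \<iota> K"
    and "nontrivial_automorphism \<iota> K \<sigma>"
    and "\<pi> \<noteq> 0" and "v \<pi> = 1"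
    and "cyclic_presentation v \<iota> OB K \<sigma> \<pi> \<omega>"
    and "orthogonal_involution \<iota> star"
    and "\<gamma> \<noteq> 0" and "\<gamma> + bar \<gamma> = 0"
    and "\<forall>\<alpha>. star \<alpha> = \<gamma> * bar \<alpha> * inverse \<gamma>"
    and "even (ordB \<gamma>)"
    and "structural_invariant v \<iota> OB K \<sigma> \<pi> \<omega> L r1 r2 t1 t2"
  shows "((\<exists>p. perfect_hermitian_pairing v \<iota> bar OB star L p) \<longleftrightarrow> even r1 \<and> even r2 \<and> t1 = t2)
    \<and> (even r1 \<and> even r2 \<and> t1 = t2 \<longrightarrow>
        (\<forall>p c u. perfect_hermitian_pairing v \<iota> bar OB star L p \<longrightarrow>
           c \<noteq> 0 \<longrightarrow> u = \<iota> c * \<gamma> \<longrightarrow> ordB u = 0 \<longrightarrow>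
           (case standard_skew_sum \<iota> K \<sigma> \<pi> \<omega> (r1 div 2) (r2 div 2) t1 of (e, C) \<Rightarrow>
              isometric OB L (twist_pairing L p u)
                (embedding_bilattice OB e) (gram_pairing bar C))))
    \<and> (\<forall>s1 s2 t. even s1 \<longrightarrow> even s2 \<longrightarrow>
        (\<exists>(M :: ('b, 'b vec) bimodule) p.
           structural_invariant v \<iota> OB K \<sigma> \<pi> \<omega> M s1 s2 t t \<and>
           perfect_hermitian_pairing v \<iota> bar OB star M p) \<and>
        (\<forall>(M :: ('b, 'm) bimodule) p (M' :: ('b, 'n) bimodule) p'.
           structural_invariant v \<iota> OB K \<sigma> \<pi> \<omega> M s1 s2 t t \<longrightarrow>
           perfect_hermitian_pairing v \<iota> bar OB star M p \<longrightarrow>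
           structural_invariant v \<iota> OB K \<sigma> \<pi> \<omega> M' s1 s2 t t \<longrightarrow>
           perfect_hermitian_pairing v \<iota> bar OB star M' p' \<longrightarrow>
           isometric OB M p M' p'))"
proof -
  interpret quat v \<iota> bar \<sigma> OB K ordB \<pi> \<omega> by unfold_locales (fact assms)+
  have unit: "u \<noteq> 0 \<and> bar u = - u \<and> (\<forall>\<alpha>. star \<alpha> = u * bar \<alpha> * inverse u)" if c: "c \<noteq> 0" "u = \<iota> c * \<gamma>" for c u
  proof -
    have "bar \<gamma> = - \<gamma>" using assms(14) by (simp add: eq_neg_iff_add_eq_0 add.commute)
    then have "bar u = - u" using iota_commute[of c \<gamma>] by (simp add: c bar_mult)
    moreover have "star \<alpha> = u * bar \<alpha> * inverse u" for \<alpha>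
    proof -
      have "u * bar \<alpha> * inverse u = \<iota> c * (\<gamma> * bar \<alpha> * inverse \<gamma>) * inverse (\<iota> c)"
        using c assms(13) by (simp add: nonzero_inverse_mult_distrib mult.assoc)
      also have "\<dots> = \<gamma> * bar \<alpha> * inverse \<gamma>" unfolding iota_commute[of c] using c by (simp add: mult.assoc)
      finally show ?thesis using assms(15) by simp
    qed
    ultimately show ?thesis using c assms(13) by simp
  qed
  obtain m where m: "ordB \<gamma> = 2 * m" using assms(16) by (rule evenE)
  \<comment> \<open>On F the valuation of B is twice \<open>v\<close>, so a scalar of value
    \<open>- m\<close> brings \<open>\<gamma>\<close> of value \<open>2 * m\<close> to value
    0.\<close>
  define c0 where "c0 = (if 0 \<le> m then inverse \<pi> ^ nat m else \<pi> ^ nat (- m))"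
  have c0: "c0 \<noteq> 0" "v c0 = - m" using pi F.val_inverse[of \<pi>] by (auto simp: c0_def F.val_power)
  define u0 where "u0 = \<iota> c0 * \<gamma>"
  have "ordB u0 = 0"
    using B.val_mult[of "\<iota> c0" \<gamma>] c0 assms(13) ram(2)[of c0] ram_2 m by (simp add: u0_def)
  moreover note unit[OF c0(1) u0_def]
  ultimately have u0: "u0 \<noteq> 0" "ordB u0 = 0" "bar u0 = - u0" "\<And>\<alpha>. star \<alpha> = u0 * bar \<alpha> * inverse u0" by blast+
  have u0O: "u0 \<in> OB" "inverse u0 \<in> OB" using u0 B.val_inverse[of u0] by (simp_all add: OB_ge val_ge_def)
  have bim: "is_bimodule OB N" if "structural_invariant v \<iota> OB K \<sigma> \<pi> \<omega> N s1 s2 t t'" for N s1 s2 t t'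
    using that unfolding structural_invariant_def bilattice_def by blast
  show ?thesis
  proof (intro conjI allI impI)
    show "(\<exists>p. perfect_hermitian_pairing v \<iota> bar OB star L p) \<longleftrightarrow> even r1 \<and> even r2 \<and> t1 = t2"
      using perfect_classification[OF assms(17) u0] perfect_exists[of L r1 r2 t1 u0 star] u0 assms(17) by blast
  next
    fix p c u
    assume p: "perfect_hermitian_pairing v \<iota> bar OB star L p" and c: "c \<noteq> 0" "u = \<iota> c * \<gamma>" and o: "ordB u = 0"
    have u: "u \<noteq> 0" "ordB u = 0" "bar u = - u" "\<And>\<alpha>. star \<alpha> = u * bar \<alpha> * inverse u"
      using unit[OF c] o by blast+
    show "case standard_skew_sum \<iota> K \<sigma> \<pi> \<omega> (r1 div 2) (r2 div 2) t1 of (e, C) \<Rightarrow>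
        isometric OB L (twist_pairing L p u) (embedding_bilattice OB e) (gram_pairing bar C)"
      unfolding case_prod_beta using perfect_classification[OF assms(17) u p] by blast
  next
    fix s1 s2 t :: nat
    assume ev: "even s1" "even s2"
    show "\<exists>(M :: ('b, 'b vec) bimodule) p. structural_invariant v \<iota> OB K \<sigma> \<pi> \<omega> M s1 s2 t t \<and>
        perfect_hermitian_pairing v \<iota> bar OB star M p"
      using standard_structural[of s1 s2 t t] perfect_exists[OF standard_structural[of s1 s2 t t] u0 ev] by blast
  next
    fix s1 s2 t :: nat and M :: "('b, 'm) bimodule" and p and M' :: "('b, 'n) bimodule" and p'
    assume *: "structural_invariant v \<iota> OB K \<sigma> \<pi> \<omega> M s1 s2 t t" "perfect_hermitian_pairing v \<iota> bar OB star M p"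
      "structural_invariant v \<iota> OB K \<sigma> \<pi> \<omega> M' s1 s2 t t" "perfect_hermitian_pairing v \<iota> bar OB star M' p'"
    \<comment> \<open>Both twisted pairings are isometric to the same standard sum.\<close>
    show "isometric OB M p M' p'"
      by (rule isometric_untwist[OF bim[OF *(1)] bim[OF *(3)] u0O u0(1)])
        (use perfect_classification[OF *(1) u0 *(2)] perfect_classification[OF *(3) u0 *(4)] in blast)+
  qed
qed

end
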